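(* If $H$ is a tubular group with (VRC) then $H$ is virtually special. In other words, $H$ has a finite index subgroup which embeds in a finitely generated right angled Artin group.
   Context: A subgroup $H$ of a group $G$ is a virtual retract of $G$ if there is a finite index subgroup $K$ of $G$ such that $H \subseteq K$ and there is a homomorphism $\rho: K \to H$ whose restriction to $H$ is the identity map. A group has property (VRC) if every cyclic subgroup is a virtual retract. A tubular group is the fundamental group of a non-empty finite graph of groups where all vertex groups are free abelian of rank $2$ and all edge groups are infinite cyclic. Here graphs are in the sense of Serre: a graph $\Gamma$ has a vertex set $V\Gamma$, an edge set $E\Gamma$, an inversion map $e \mapsto \overline{e}$ on $E\Gamma$ with $\overline{e} \ne e$ and $\overline{\overline{e}} = e$, and incidence maps $\alpha,\omega: E\Gamma \to V\Gamma$ with $\omega(\overline{e}) = \alpha(e)$. An orientation is a decomposition $E\Gamma = E\Gamma^+ \sqcup E\Gamma^-$ with $E\Gamma^- = \{\overline{e} \mid e \in E\Gamma^+\}$. A finite graph of groups $(\mathcal{G},\Gamma)$ consists of a non-empty finite connected graph $\Gamma$, vertex groups $G_v$ ($v \in V\Gamma$), edge groups $G_e$ ($e \in E\Gamma$) with $G_e = G_{\overline{e}}$, and monomorphisms $\alpha_e: G_e \to G_{\alpha(e)}$ ($e \in E\Gamma$); put $\omega_e := \alpha_{\overline{e}}: G_e \to G_{\omega(e)}$. Given a maximal tree $T$ in $\Gamma$ and an orientation, its fundamental group is the group generated by all $G_v$, $v \in V\Gamma$, and free letters $t_e$, $e \in E\Gamma^+$, subject to the relations of the vertex groups, $t_e\,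 \omega_e(a)\, t_e^{-1} = \alpha_e(a)$ for all $e \in E\Gamma^+$, $a \in G_e$, and $t_f = 1$ for all $f \in ET \cap E\Gamma^+$; up to isomorphism it does not depend on the choices. *)

theory Defs
  imports
    "HOL-Algebra.Coset"
    "HOL-Algebra.Elementary_Groups"
    "HOL-Algebra.Free_Abelian_Groups"
    "Graph_Theory.Bidirected_Digraph"
    "Graph_Theory.Digraph_Component"
begin

section \<open>Virtual retracts\<close>

definition finite_index_subgroup :: "'a set \<Rightarrow> ('a, 'm) monoid_scheme \<Rightarrow> bool" where
  "finite_index_subgroup K G \<longleftrightarrow> subgroup K G \<and> finite (rcosets\<^bsub>G\<^esub> K)"

definition virtual_retract :: "'a set \<Rightarrow> ('a, 'm) monoid_scheme \<Rightarrow> bool" where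
  "virtual_retract A G \<longleftrightarrow> subgroup A G \<and>
     (\<exists>K. finite_index_subgroup K G \<and> A \<subseteq> K \<and>
       (\<exists>\<rho> \<in> hom (G\<lparr>carrier := K\<rparr>) (G\<lparr>carrier := A\<rparr>). \<forall>a\<in>A. \<rho> a = a))"

definition VRC :: "('a, 'm) monoid_scheme \<Rightarrow> bool" where
  "VRC G \<longleftrightarrow>
     (\<forall>A. subgroup A G \<and> cyclic_group (G\<lparr>carrier := A\<rparr>) \<longrightarrow> virtual_retract A G)"

section \<open>Group presentations\<close>

text \<open>A letter \<open>(x, True)\<close> stands for the generator \<open>x\<close> and \<open>(x, False)\<close> for its formal
  inverse.  Relations are pairs of words that are to become equal;
  pairs that are not words over the given generators are ignored.\<close>

type_synonym 'x word = "('x \<times> bool) list"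

abbreviation gen :: "'x \<Rightarrow> 'x word" where
  "gen x \<equiv> [(x, True)]"

abbreviation gen_inv :: "'x \<Rightarrow> 'x word" where
  "gen_inv x \<equiv> [(x, False)]"

definition words :: "'x set \<Rightarrow> 'x word set" where
  "words X = lists (X \<times> UNIV)"

inductive pres_eq :: "'x set \<Rightarrow> ('x word \<times> 'x word) set \<Rightarrow> 'x word \<Rightarrow> 'x word \<Rightarrow> bool"
  for X R where
  refl: "w \<in> words X \<Longrightarrow> pres_eq X R w w"
| sym: "pres_eq X R u v \<Longrightarrow> pres_eq X R v u"
| trans: "pres_eq X R u v \<Longrightarrow> pres_eq X R v w \<Longrightarrow> pres_eq X R u w"
| cong: "pres_eq X R u v \<Longrightarrow> a \<in> words X \<Longrightarrow> b \<in> words X \<Longrightarrow>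
    pres_eq X R (a @ u @ b) (a @ v @ b)"
| cancel: "x \<in> X \<Longrightarrow> pres_eq X R [(x, s), (x, \<not> s)] []"
| rel: "(u, v) \<in> R \<Longrightarrow> u \<in> words X \<Longrightarrow> v \<in> words X \<Longrightarrow> pres_eq X R u v"

definition pres_rel :: "'x set \<Rightarrow> ('x word \<times> 'x word) set \<Rightarrow> ('x word \<times> 'x word) set" where
  "pres_rel X R = {(u, v). pres_eq X R u v}"

definition presented_group ::
    "'x set \<Rightarrow> ('x word \<times> 'x word) set \<Rightarrow> 'x word set monoid" where
  "presented_group X R =
     \<lparr>carrier = words X // pres_rel X R,
      monoid.mult = (\<lambda>A B. \<Union>u\<in>A. \<Union>v\<in>B. pres_rel X R `` {u @ v}),
      one = pres_rel X R `` {[]}\<rparr>"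

lemma words_simps [simp]:
  "[] \<in> words X"
  "u @ v \<in> words X \<longleftrightarrow> u \<in> words X \<and> v \<in> words X"
  "p # u \<in> words X \<longleftrightarrow> fst p \<in> X \<and> u \<in> words X"
  by (auto simp: words_def mem_Times_iff)

lemma pres_eq_words: "pres_eq X R u v \<Longrightarrow> u \<in> words X \<and> v \<in> words X"
  by (induction rule: pres_eq.induct) auto

lemma equiv_pres_rel: "equiv (words X) (pres_rel X R)"
proof (rule equivI)
  show "pres_rel X R \<subseteq> words X \<times> words X"
    by (auto simp: pres_rel_def dest: pres_eq_words)
  show "refl_on (words X) (pres_rel X R)"
    by (auto simp: pres_rel_def refl_on_def intro: pres_eq.refl)
  show "Relation.sym (pres_rel X R)"
    by (auto simp: pres_rel_def sym_def intro: pres_eq.sym)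
  show "Relation.trans (pres_rel X R)"
    by (auto simp: pres_rel_def trans_def intro: pres_eq.trans)
qed

lemma pres_eq_append:
  assumes "pres_eq X R u u'" "pres_eq X R v v'"
  shows "pres_eq X R (u @ v) (u' @ v')"
proof -
  have "pres_eq X R ([] @ u @ v) ([] @ u' @ v)"
    using assms pres_eq_words by (intro pres_eq.cong) auto
  moreover have "pres_eq X R (u' @ v @ []) (u' @ v' @ [])"
    using assms pres_eq_words by (intro pres_eq.cong) auto
  ultimately show ?thesis
    by (simp only: append_Nil append_Nil2) (rule pres_eq.trans)
qed

lemma presented_group_mult:
  assumes "u \<in> words X" "v \<in> words X"
  shows "pres_rel X R `` {u} \<otimes>\<^bsub>presented_group X R\<^esub> pres_rel X R `` {v} = pres_rel X R `` {u @ v}"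
proof -
  let ?C = "\<lambda>w. pres_rel X R `` {w}"
  have eq: "?C (u' @ v') = ?C (u @ v)" if "u' \<in> ?C u" "v' \<in> ?C v" for u' v'
  proof (rule equiv_class_eq[OF equiv_pres_rel, symmetric])
    show "(u @ v, u' @ v') \<in> pres_rel X R"
      using that by (auto simp: pres_rel_def intro: pres_eq_append)
  qed
  have ne: "u \<in> ?C u" "v \<in> ?C v"
    using assms by (auto simp: pres_rel_def intro: pres_eq.refl)
  have "?C u \<otimes>\<^bsub>presented_group X R\<^esub> ?C v = (\<Union>u'\<in>?C u. \<Union>v'\<in>?C v. ?C (u' @ v'))"
    by (simp add: presented_group_def)
  also have "\<dots> = (\<Union>u'\<in>?C u. \<Union>v'\<in>?C v. ?C (u @ v))"
    by (intro SUP_cong eq) (rule HOL.refl)+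
  also have "\<dots> = (\<Union>u'\<in>?C u. ?C (u @ v))"
    using ne(2) by (intro SUP_cong cSUP_const HOL.refl) blast
  also have "\<dots> = ?C (u @ v)"
    using ne(1) by (intro cSUP_const) blast
  finally show ?thesis .
qed

lemma pres_eq_inverse:
  "w \<in> words X \<Longrightarrow> pres_eq X R (rev (map (\<lambda>(x, s). (x, \<not> s)) w) @ w) []"
proof (induction w)
  case Nil
  then show ?case by (auto intro: pres_eq.refl)
next
  case (Cons p w)
  obtain x s where p: "p = (x, s)" by (cases p)
  let ?i = "rev (map (\<lambda>(x, s). (x, \<not> s)) w)"
  have "pres_eq X R [(x, \<not> s), (x, \<not> \<not> s)] []"
    using Cons.prems p by (intro pres_eq.cancel) auto
  moreover have "?i \<in> words X" "w \<in> words X"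
    using Cons.prems by (auto simp: words_def)
  ultimately have "pres_eq X R (?i @ [(x, \<not> s), (x, \<not> \<not> s)] @ w) (?i @ [] @ w)"
    by (rule pres_eq.cong)
  moreover have "pres_eq X R (?i @ w) []"
    using Cons by simp
  ultimately show ?case
    unfolding p by (simp add: pres_eq.trans)
qed

lemma group_presented_group: "group (presented_group X R)"
proof (rule groupI)
  let ?G = "presented_group X R"
  have car: "\<exists>u\<in>words X. A = pres_rel X R `` {u}" if "A \<in> carrier ?G" for A
    using that by (auto simp: presented_group_def elim: quotientE)
  have carI: "pres_rel X R `` {u} \<in> carrier ?G" if "u \<in> words X" for u
    using that by (auto simp: presented_group_def intro: quotientI)
  have one: "\<one>\<^bsub>?G\<^esub> = pres_rel X R `` {[]}" by (simp add: presented_group_def)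
  show "\<one>\<^bsub>?G\<^esub> \<in> carrier ?G" by (simp add: one carI)
  fix A assume A: "A \<in> carrier ?G"
  then obtain u where u: "u \<in> words X" "A = pres_rel X R `` {u}" using car by blast
  show "\<one>\<^bsub>?G\<^esub> \<otimes>\<^bsub>?G\<^esub> A = A" using u by (simp add: one presented_group_mult)
  let ?i = "rev (map (\<lambda>(x, s). (x, \<not> s)) u)"
  have i: "?i \<in> words X" using u by (auto simp: words_def)
  have "pres_rel X R `` {?i @ u} = pres_rel X R `` {[]}"
    using pres_eq_inverse[OF u(1)]
    by (intro equiv_class_eq[OF equiv_pres_rel]) (simp add: pres_rel_def)
  then show "\<exists>B\<in>carrier ?G. B \<otimes>\<^bsub>?G\<^esub> A = \<one>\<^bsub>?G\<^esub>"
    using u i by (intro bexI[OF _ carI[OF i]]) (simp add: one presented_group_mult)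
  fix B assume "B \<in> carrier ?G"
  then obtain v where v: "v \<in> words X" "B = pres_rel X R `` {v}" using car by blast
  show "A \<otimes>\<^bsub>?G\<^esub> B \<in> carrier ?G" using u v carI by (simp add: presented_group_mult)
  fix C assume "C \<in> carrier ?G"
  then obtain w where w: "w \<in> words X" "C = pres_rel X R `` {w}" using car by blast
  show "A \<otimes>\<^bsub>?G\<^esub> B \<otimes>\<^bsub>?G\<^esub> C = A \<otimes>\<^bsub>?G\<^esub> (B \<otimes>\<^bsub>?G\<^esub> C)"
    using u v w by (simp add: presented_group_mult)
qed

section \<open>Right angled Artin groups and virtual specialness\<close>

definition raag :: "('a, 'b) pre_digraph \<Rightarrow> 'a word set monoid" where
  "raag \<Delta> = presented_group (verts \<Delta>) {(gen u @ gen v, gen v @ gen u) | u v. (u, v) \<in> arcs_ends \<Delta>}"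

text \<open>The predicate \<^const>\<open>graph\<close> means: finite, symmetric, without loops and multiple arcs.
  Up to isomorphism every finite simple graph has natural numbers as vertices and pairs of
  vertices as arcs, so the types chosen for \<open>\<Delta>\<close> are no restriction.\<close>

definition virtually_special :: "('a, 'm) monoid_scheme \<Rightarrow> bool" where
  "virtually_special G \<longleftrightarrow>
     (\<exists>K (\<Delta> :: (nat, nat \<times> nat) pre_digraph).
        finite_index_subgroup K G \<and> graph \<Delta> \<and>
        (\<exists>\<phi> \<in> hom (G\<lparr>carrier := K\<rparr>) (raag \<Delta>). inj_on \<phi> K))"

section \<open>Graphs of groups\<close>

text \<open>Graphs in the sense of Serre are given by \<^locale>\<open>bidirected_digraph\<close>, with \<open>bar\<close> the
  inversion of edges, \<open>tail\<close> the initial vertex map \<open>\<alpha>\<close> and \<open>head\<close> the terminal vertex map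
  \<open>\<omega>\<close>.  Non-emptiness of the vertex set is part of \<^const>\<open>Digraph_Component.connected\<close>.\<close>

locale finite_graph_of_groups = fin_digraph \<Gamma> + bidirected_digraph \<Gamma> bar
  for \<Gamma> :: "('v, 'e) pre_digraph" and bar :: "'e \<Rightarrow> 'e" +
  fixes Gv :: "'v \<Rightarrow> 'g monoid"
    and Ge :: "'e \<Rightarrow> 'k monoid"
    and emb :: "'e \<Rightarrow> 'k \<Rightarrow> 'g"
  assumes connected_graph: "Digraph_Component.connected \<Gamma>"
    and vertex_group: "v \<in> verts \<Gamma> \<Longrightarrow> group (Gv v)"
    and edge_group: "e \<in> arcs \<Gamma> \<Longrightarrow> group (Ge e)"
    and edge_group_bar: "e \<in> arcs \<Gamma> \<Longrightarrow> Ge (bar e) = Ge e"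
    and emb_hom: "e \<in> arcs \<Gamma> \<Longrightarrow> emb e \<in> hom (Ge e) (Gv (tail \<Gamma> e))"
    and emb_inj: "e \<in> arcs \<Gamma> \<Longrightarrow> inj_on (emb e) (carrier (Ge e))"

locale tubular_graph_of_groups = finite_graph_of_groups +
  assumes vertex_free_abelian_rank_2: "v \<in> verts \<Gamma> \<Longrightarrow> Gv v \<cong> free_Abelian_group {..<2::nat}"
    and edge_infinite_cyclic: "e \<in> arcs \<Gamma> \<Longrightarrow> cyclic_group (Ge e) \<and> infinite (carrier (Ge e))"

text \<open>The library's \<^const>\<open>pre_digraph.cycle\<close> also counts \<open>[e, bar e]\<close> as a cycle, which is not a
  circuit of a Serre graph; it is the only kind of cycle that backtracks.  The library's
  \<^const>\<open>tree\<close> is therefore not the right notion here.\<close>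

definition serre_tree :: "('e \<Rightarrow> 'e) \<Rightarrow> ('v, 'e) pre_digraph \<Rightarrow> bool" where
  "serre_tree bar T \<longleftrightarrow>
     bar ` arcs T \<subseteq> arcs T \<and> Digraph_Component.connected T \<and>
     \<not> (\<exists>p. pre_digraph.cycle T p \<and> \<not> (\<exists>e. p = [e, bar e]))"

definition maximal_tree :: "('v, 'e) pre_digraph \<Rightarrow> ('e \<Rightarrow> 'e) \<Rightarrow> ('v, 'e) pre_digraph \<Rightarrow> bool" where
  "maximal_tree \<Gamma> bar T \<longleftrightarrow> pre_digraph.max_subgraph \<Gamma> (serre_tree bar) T"

definition orientation :: "('v, 'e) pre_digraph \<Rightarrow> ('e \<Rightarrow> 'e) \<Rightarrow> 'e set \<Rightarrow> bool" where
  "orientation \<Gamma> bar Epos \<longleftrightarrow> Epos \<inter> bar ` Epos = {} \<and> Epos \<union> bar ` Epos = arcs \<Gamma>"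

datatype ('v, 'g, 'e) pi1_gen = Vertex_Elem 'v 'g | Stable_Letter 'e

definition pi1_gens ::
    "('v, 'e) pre_digraph \<Rightarrow> ('v \<Rightarrow> 'g monoid) \<Rightarrow> 'e set \<Rightarrow> ('v, 'g, 'e) pi1_gen set" where
  "pi1_gens \<Gamma> Gv Epos =
     {Vertex_Elem v g | v g. v \<in> verts \<Gamma> \<and> g \<in> carrier (Gv v)} \<union> Stable_Letter ` Epos"

text \<open>The relations of a vertex group are those of its multiplication table.\<close>

definition pi1_rels ::
    "('v, 'e) pre_digraph \<Rightarrow> ('e \<Rightarrow> 'e) \<Rightarrow> ('v \<Rightarrow> 'g monoid) \<Rightarrow> ('e \<Rightarrow> 'k monoid) \<Rightarrow>
     ('e \<Rightarrow> 'k \<Rightarrow> 'g) \<Rightarrow> ('v, 'e) pre_digraph \<Rightarrow> 'e set \<Rightarrow>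
     (('v, 'g, 'e) pi1_gen word \<times> ('v, 'g, 'e) pi1_gen word) set" where
  "pi1_rels \<Gamma> bar Gv Ge emb T Epos =
     {(gen (Vertex_Elem v g) @ gen (Vertex_Elem v h), gen (Vertex_Elem v (g \<otimes>\<^bsub>Gv v\<^esub> h))) | v g h.
        v \<in> verts \<Gamma> \<and> g \<in> carrier (Gv v) \<and> h \<in> carrier (Gv v)} \<union>
     {(gen (Stable_Letter e) @ gen (Vertex_Elem (head \<Gamma> e) (emb (bar e) a)) @ gen_inv (Stable_Letter e),
       gen (Vertex_Elem (tail \<Gamma> e) (emb e a))) | e a.
        e \<in> Epos \<and> a \<in> carrier (Ge e)} \<union>
     {(gen (Stable_Letter f), []) | f. f \<in> arcs T \<inter> Epos}"

definition fundamental_group ::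
    "('v, 'e) pre_digraph \<Rightarrow> ('e \<Rightarrow> 'e) \<Rightarrow> ('v \<Rightarrow> 'g monoid) \<Rightarrow> ('e \<Rightarrow> 'k monoid) \<Rightarrow>
     ('e \<Rightarrow> 'k \<Rightarrow> 'g) \<Rightarrow> ('v, 'e) pre_digraph \<Rightarrow> 'e set \<Rightarrow> ('v, 'g, 'e) pi1_gen word set monoid" where
  "fundamental_group \<Gamma> bar Gv Ge emb T Epos =
     presented_group (pi1_gens \<Gamma> Gv Epos) (pi1_rels \<Gamma> bar Gv Ge emb T Epos)"

end

theory Submission
  imports Defs "HOL-Algebra.Bij"
begin

text \<open>No Bass--Serre tree is needed.  By (VRC), differences \<open>\<phi> - \<phi> \<circ> \<rho>\<close> with \<open>\<rho>\<close> a retraction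
  onto a cyclic subgroup provide a finite index subgroup \<open>K\<close> and finitely many characters
  \<open>\<psi>\<^sub>i : K \<rightarrow> \<int>\<close> that separate \<open>K \<inter> C\<^sup>h\<close> from \<open>K \<inter> B\<^sup>h\<close> for every vertex group \<open>B\<close>,
  adjacent edge group \<open>C\<close> and conjugating element \<open>h\<close>.  Take the right angled Artin group with
  commuting generators \<open>x\<^sub>i\<close> and one further generator \<open>y\<^sub>j\<close> for each edge \<open>e\<close> and each double
  coset \<open>j = C d K\<close> of its edge group, where \<open>y\<^sub>j\<close> commutes with \<open>x\<^sub>i\<close> unless \<open>\<psi>\<^sub>i\<close> vanishes
  on \<open>K \<inter> C\<^sup>d\<close>.  Let \<open>\<phi>(k)\<close> be the product of the \<open>x\<^sub>i\<close> with exponents \<open>\<psi>\<^sub>i(k)\<close>.  A stable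
  letter \<open>t\<^sub>e\<close> met at the point \<open>p = c d k\<close> of the group is read as \<open>\<phi>(k)\<inverse> y\<^sub>j \<phi>(k)\<close>, while vertex
  groups are read trivially.  This respects the relations of the edges, and after conjugation by a
  potential on the maximal tree also the relations \<open>t\<^sub>f = 1\<close>.  The resulting cocycle \<open>c\<close> gives
  the homomorphism \<open>k \<mapsto> \<phi>(k) c\<^sub>k(1)\<close> on \<open>K\<close>.  The kernel of the projection to the \<open>x\<^sub>i\<close> is
  free on the conjugates of the \<open>y\<^sub>j\<close>, and by separation a reduced path in the graph of groups is
  read as a reduced word in them.  Hence an element of the kernel lies in a vertex group and is killed
  by all \<open>\<psi>\<^sub>i\<close>, so it is trivial.\<close>

section \<open>Homomorphisms out of presented groups\<close>

text \<open>With vertex groups read trivially, the edge relation says that the reading of a stable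
  letter at \<open>p\<close> does not change when \<open>p\<close> is multiplied from the left by
  its edge group \<open>C\<close>. Since \<phi> lives on \<open>K\<close> only, getting back to a
  homomorphism on \<open>K\<close> requires equivariance under \<open>K\<close> from the right. The
  two conditions determine the reading on a double coset \<open>C d K\<close> from its value at
  \<open>d\<close>, and they are compatible exactly when that value commutes with \<phi> on
  \<open>K \<inter> C^d\<close>; this is where the commutation relations come from. They pull
  against faithfulness: at two points \<open>p\<close> and \<open>g p\<close>, with \<open>g\<close>
  in the adjacent vertex group but outside \<open>C\<close>, the conjugates of \<open>y_j\<close>
  must stay different, or a path without backtracking could be read as a cancelling word. The
  exponents that survive in such a conjugate are those of the characters vanishing on
  \<open>K \<inter> C^d\<close>, so the separation has to be achieved by these characters alone, and
  for all \<open>d\<close> at once with finitely many of them.\<close>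

definition word_eval :: "('a, 'm) monoid_scheme \<Rightarrow> ('x \<Rightarrow> 'a) \<Rightarrow> 'x word \<Rightarrow> 'a" where
  "word_eval G f w =
     foldr (\<lambda>(x, s) a. (if s then f x else inv\<^bsub>G\<^esub> f x) \<otimes>\<^bsub>G\<^esub> a) w \<one>\<^bsub>G\<^esub>"

lemma word_eval_simps [simp]:
  "word_eval G f [] = \<one>\<^bsub>G\<^esub>"
  "word_eval G f ((x, s) # w) = (if s then f x else inv\<^bsub>G\<^esub> f x) \<otimes>\<^bsub>G\<^esub> word_eval G f w"
  by (simp_all add: word_eval_def)

context group
begin

lemma word_eval_closed [simp]:
  "f \<in> X \<rightarrow> carrier G \<Longrightarrow> w \<in> words X \<Longrightarrow> word_eval G f w \<in> carrier G"
  by (induction w) (auto simp: Pi_iff)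

lemma word_eval_append:
  "f \<in> X \<rightarrow> carrier G \<Longrightarrow> u \<in> words X \<Longrightarrow> v \<in> words X \<Longrightarrow>
     word_eval G f (u @ v) = word_eval G f u \<otimes> word_eval G f v"
  by (induction u) (auto simp: Pi_iff m_assoc)

lemma word_eval_pres_eq:
  assumes f: "f \<in> X \<rightarrow> carrier G"
    and R: "\<And>u v. (u, v) \<in> R \<Longrightarrow> u \<in> words X \<Longrightarrow> v \<in> words X \<Longrightarrow> word_eval G f u = word_eval G f v"
    and "pres_eq X R u v"
  shows "word_eval G f u = word_eval G f v"
  using assms(3)
proof (induction rule: pres_eq.induct)
  case (cong u v a b)
  then show ?case
    using pres_eq_words[OF cong(1)] f by (simp add: word_eval_append)
next
  case (cancel x s)
  then have "f x \<in> carrier G" using f by auto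
  then show ?case by (cases s) auto
qed (use R in auto)

lemma presented_group_lift:
  assumes f: "f \<in> X \<rightarrow> carrier G"
    and R: "\<And>u v. (u, v) \<in> R \<Longrightarrow> u \<in> words X \<Longrightarrow> v \<in> words X \<Longrightarrow> word_eval G f u = word_eval G f v"
  obtains h where "h \<in> hom (presented_group X R) G"
    "\<And>w. w \<in> words X \<Longrightarrow> h (pres_rel X R `` {w}) = word_eval G f w"
proof -
  define h where "h A = word_eval G f (SOME w. w \<in> A)" for A
  have h: "h (pres_rel X R `` {w}) = word_eval G f w" if "w \<in> words X" for w
  proof -
    have "w \<in> pres_rel X R `` {w}" using that by (auto simp: pres_rel_def intro: pres_eq.refl)
    then have "(SOME w'. w' \<in> pres_rel X R `` {w}) \<in> pres_rel X R `` {w}" by (rule someI)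
    then show ?thesis
      unfolding h_def by (intro word_eval_pres_eq[OF f R, symmetric]) (auto simp: pres_rel_def)
  qed
  have "h \<in> hom (presented_group X R) G"
  proof (rule homI)
    fix A assume "A \<in> carrier (presented_group X R)"
    then obtain u where u: "u \<in> words X" "A = pres_rel X R `` {u}"
      by (auto simp: presented_group_def elim: quotientE)
    show "h A \<in> carrier G" using u h f by simp
    fix B assume "B \<in> carrier (presented_group X R)"
    then obtain v where v: "v \<in> words X" "B = pres_rel X R `` {v}"
      by (auto simp: presented_group_def elim: quotientE)
    show "h (A \<otimes>\<^bsub>presented_group X R\<^esub> B) = h A \<otimes> h B"
      using u v f by (simp add: presented_group_mult h word_eval_append)
  qed
  with h show ?thesis using that by blast
qed

end

lemma word_eval_hom:
  assumes "group G" "group H" "h \<in> hom G H" "f \<in> X \<rightarrow> carrier G" "w \<in> words X"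
  shows "h (word_eval G f w) = word_eval H (\<lambda>x. h (f x)) w"
proof -
  interpret group_hom G H h using assms by (simp add: group_hom_def group_hom_axioms_def)
  show ?thesis using assms(4,5) by (induction w) (auto simp: Pi_iff)
qed

definition pres_gen :: "'x set \<Rightarrow> ('x word \<times> 'x word) set \<Rightarrow> 'x \<Rightarrow> 'x word set" where
  "pres_gen X R x = pres_rel X R `` {gen x}"

lemma pres_class_closed:
  "w \<in> words X \<Longrightarrow> pres_rel X R `` {w} \<in> carrier (presented_group X R)"
  by (auto simp: presented_group_def intro: quotientI)

lemma pres_gen_closed: "pres_gen X R \<in> X \<rightarrow> carrier (presented_group X R)"
  by (simp add: pres_gen_def pres_class_closed)

lemma word_eval_pres_gen:
  "w \<in> words X \<Longrightarrow> word_eval (presented_group X R) (pres_gen X R) w = pres_rel X R `` {w}"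
proof (induction w)
  case Nil
  then show ?case by (simp add: presented_group_def)
next
  case (Cons p w)
  interpret P: group "presented_group X R" by (rule group_presented_group)
  obtain x s where p: "p = (x, s)" by (cases p)
  with Cons have x: "x \<in> X" and w: "w \<in> words X" by auto
  have inv: "inv\<^bsub>presented_group X R\<^esub> (pres_rel X R `` {gen x}) = pres_rel X R `` {gen_inv x}"
  proof (rule P.inv_equality)
    have "pres_rel X R `` {[(x, False), (x, True)]} = pres_rel X R `` {[]}"
      using pres_eq.cancel[OF x, of R False]
      by (intro equiv_class_eq[OF equiv_pres_rel]) (simp add: pres_rel_def)
    then show "pres_rel X R `` {gen_inv x} \<otimes>\<^bsub>presented_group X R\<^esub> pres_rel X R `` {gen x}
        = \<one>\<^bsub>presented_group X R\<^esub>"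
      using x by (simp add: presented_group_mult) (simp add: presented_group_def)
  qed (use x in \<open>simp_all add: pres_class_closed\<close>)
  show ?case
    using Cons x w
    by (cases s) (simp_all add: p pres_gen_def inv presented_group_mult)
qed

lemma presented_group_carrier_eval:
  assumes "A \<in> carrier (presented_group X R)"
  obtains w where "w \<in> words X" "A = word_eval (presented_group X R) (pres_gen X R) w"
  using assms by (auto simp: presented_group_def word_eval_pres_gen[unfolded presented_group_def]
      elim!: quotientE)

lemma presented_group_rel:
  assumes "(u, v) \<in> R" "u \<in> words X" "v \<in> words X"
  shows "word_eval (presented_group X R) (pres_gen X R) u = word_eval (presented_group X R) (pres_gen X R) v"
proof -
  have "(u, v) \<in> pres_rel X R" using assms by (simp add: pres_rel_def pres_eq.rel)
  then show ?thesis using assms equiv_class_eq[OF equiv_pres_rel] by (simp add: word_eval_pres_gen)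
qed

text \<open>Carries generators and universal property over to \<open>H\<close>, so that later
  arguments multiply in \<open>H\<close> and never in classes of words. The last clause ranges over
  all \<open>W\<close> and \<open>f\<close>, but over one type of \<open>W\<close>.\<close>

lemma iso_presented_group:
  assumes H: "group H" and iso: "H \<cong> presented_group X R"
  obtains \<eta> where "\<eta> \<in> X \<rightarrow> carrier H"
    "\<And>u v. (u, v) \<in> R \<Longrightarrow> u \<in> words X \<Longrightarrow> v \<in> words X \<Longrightarrow> word_eval H \<eta> u = word_eval H \<eta> v"
    "\<And>h. h \<in> carrier H \<Longrightarrow> \<exists>w\<in>words X. h = word_eval H \<eta> w"
    "\<And>(W :: ('w, 'n) monoid_scheme) f. group W \<Longrightarrow> f \<in> X \<rightarrow> carrier W \<Longrightarrow>
       (\<And>u v. (u, v) \<in> R \<Longrightarrow> u \<in> words X \<Longrightarrow> v \<in> words X \<Longrightarrow> word_eval W f u = word_eval W f v) \<Longrightarrow>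
       \<exists>\<Theta>\<in>hom H W. \<forall>x\<in>X. \<Theta> (\<eta> x) = f x"
proof -
  let ?P = "presented_group X R"
  have P: "group ?P" by (rule group_presented_group)
  obtain i where i: "i \<in> iso H ?P" using iso by (auto simp: is_iso_def)
  define j where "j = inv_into (carrier H) i"
  have j: "j \<in> iso ?P H" unfolding j_def using i by (rule group.iso_set_sym[OF H])
  then have jh: "j \<in> hom ?P H" and jb: "bij_betw j (carrier ?P) (carrier H)" by (auto simp: iso_def)
  have ij: "i (j A) = A" if "A \<in> carrier ?P" for A
    using i that unfolding j_def by (auto simp: iso_def bij_betw_def f_inv_into_f)
  define \<eta> where "\<eta> x = j (pres_gen X R x)" for x
  have eval: "word_eval H \<eta> w = j (word_eval ?P (pres_gen X R) w)" if "w \<in> words X" for w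
    unfolding \<eta>_def using word_eval_hom[OF P H jh pres_gen_closed that] by simp
  show ?thesis
  proof (rule that)
    show "\<eta> \<in> X \<rightarrow> carrier H"
      using pres_gen_closed hom_in_carrier[OF jh] by (fastforce simp: \<eta>_def)
    show "word_eval H \<eta> u = word_eval H \<eta> v" if "(u, v) \<in> R" "u \<in> words X" "v \<in> words X" for u v
      using presented_group_rel[OF that] that by (simp add: eval)
    show "\<exists>w\<in>words X. h = word_eval H \<eta> w" if "h \<in> carrier H" for h
    proof -
      have "h \<in> j ` carrier ?P" using bij_betw_imp_surj_on[OF jb] that by simp
      then obtain A where A: "A \<in> carrier ?P" "h = j A" by (elim imageE)
      obtain w where w: "w \<in> words X" "A = word_eval ?P (pres_gen X R) w"
        using presented_group_carrier_eval[OF A(1)] .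
      have "h = word_eval H \<eta> w" unfolding eval[OF w(1)] A(2) w(2) ..
      then show ?thesis using w(1) by blast
    qed
    fix W :: "('w, 'n) monoid_scheme" and f
    assume W: "group W" and f: "f \<in> X \<rightarrow> carrier W"
      and R: "\<And>u v. (u, v) \<in> R \<Longrightarrow> u \<in> words X \<Longrightarrow> v \<in> words X \<Longrightarrow> word_eval W f u = word_eval W f v"
    obtain h where h: "h \<in> hom ?P W" "\<And>w. w \<in> words X \<Longrightarrow> h (pres_rel X R `` {w}) = word_eval W f w"
      using group.presented_group_lift[OF W f R] by blast
    show "\<exists>\<Theta>\<in>hom H W. \<forall>x\<in>X. \<Theta> (\<eta> x) = f x"
    proof (intro bexI ballI)
      show "h \<circ> i \<in> hom H W" using i h(1) by (auto simp: iso_def intro: hom_compose)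
      fix x assume x: "x \<in> X"
      have "pres_gen X R x \<in> carrier ?P" by (rule Pi_mem[OF pres_gen_closed x])
      then have "(h \<circ> i) (\<eta> x) = h (pres_gen X R x)" by (simp add: \<eta>_def ij)
      also have "\<dots> = word_eval W f (gen x)" unfolding pres_gen_def using x by (intro h(2)) simp
      also have "\<dots> = f x"
        using x f W by (simp add: Pi_iff group.is_monoid monoid.r_one)
      finally show "(h \<circ> i) (\<eta> x) = f x" .
    qed
  qed
qed

section \<open>Maximal trees\<close>

text \<open>Connectedness is reachability in the symmetrised graph, where arcs may be used against
  their direction; the arc at which a path leaves \<open>U\<close> is therefore found without a
  direction.\<close>

lemma connected_crossing:
  assumes "Digraph_Component.connected G" "u \<in> U" "U \<subseteq> verts G" "U \<noteq> verts G"
  obtains e where "e \<in> arcs G" "(tail G e \<in> U) \<noteq> (head G e \<in> U)"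
proof -
  obtain v where v: "v \<in> verts G" "v \<notin> U" using assms by blast
  let ?S = "with_proj (mk_symmetric G)"
  have "(u, v) \<in> rtrancl_on (verts ?S) (arcs_ends ?S)"
    using assms v by (auto simp: Digraph_Component.connected_def strongly_connected_def reachable_def)
  then have "v \<in> U \<or> (\<exists>e\<in>arcs G. (tail G e \<in> U) \<noteq> (head G e \<in> U))"
    by (induction rule: rtrancl_on_induct) (use \<open>u \<in> U\<close> in \<open>auto simp: parcs_mk_symmetric\<close>)
  with v that show ?thesis by blast
qed

text \<open>Everything about \<open>bar\<close> is asked for on the arcs only, so that a tree inside
  \<Gamma>, with the same \<open>bar\<close>, is an instance as well.\<close>

locale serre_graph = wf_digraph G for G :: "('v, 'e) pre_digraph" +
  fixes bar :: "'e \<Rightarrow> 'e"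
  assumes bar_arcs: "e \<in> arcs G \<Longrightarrow> bar e \<in> arcs G"
    and bar_neq: "e \<in> arcs G \<Longrightarrow> bar e \<noteq> e"
    and bar_bar: "e \<in> arcs G \<Longrightarrow> bar (bar e) = e"
    and tail_bar: "e \<in> arcs G \<Longrightarrow> tail G (bar e) = head G e"
begin

lemma head_bar: "e \<in> arcs G \<Longrightarrow> head G (bar e) = tail G e"
  using tail_bar[of "bar e"] by (simp add: bar_arcs bar_bar)

lemma connected_exit:
  assumes "Digraph_Component.connected G" "u \<in> U" "U \<subseteq> verts G" "U \<noteq> verts G"
  obtains e where "e \<in> arcs G" "tail G e \<in> U" "head G e \<notin> U"
proof -
  obtain e where "e \<in> arcs G" "(tail G e \<in> U) \<noteq> (head G e \<in> U)"
    using connected_crossing[OF assms] .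
  then show ?thesis
    using that[of e] that[of "bar e"] by (auto simp: bar_arcs tail_bar head_bar)
qed

text \<open>The potential is built along a growing subtree: a second edge from the subtree to a new
  vertex would close up to a circuit.\<close>

lemma serre_tree_potential:
  assumes tree: "serre_tree bar G" and fin: "finite (verts G)" and v0: "v0 \<in> verts G"
    and W: "group W" and \<tau>: "\<tau> \<in> arcs G \<rightarrow> carrier W"
    and \<tau>_bar: "\<And>e. e \<in> arcs G \<Longrightarrow> \<tau> (bar e) = inv\<^bsub>W\<^esub> \<tau> e"
  obtains \<gamma> where "\<gamma> v0 = \<one>\<^bsub>W\<^esub>" "\<gamma> \<in> verts G \<rightarrow> carrier W"
    "\<And>e. e \<in> arcs G \<Longrightarrow> \<gamma> (head G e) = \<gamma> (tail G e) \<otimes>\<^bsub>W\<^esub> \<tau> e"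
proof -
  interpret W: group W by (rule W)
  have conn: "Digraph_Component.connected G"
    and acyc: "\<And>p. cycle p \<Longrightarrow> \<exists>e. p = [e, bar e]"
    using tree by (auto simp: serre_tree_def)
  \<comment> \<open>The last clause joins the vertices of \<open>U\<close> by simple paths inside
    \<open>U\<close>; closing such a path through a vertex outside \<open>U\<close> gives a
    cycle.\<close>
  define good where "good U \<gamma> \<longleftrightarrow> v0 \<in> U \<and> U \<subseteq> verts G \<and> \<gamma> v0 = \<one>\<^bsub>W\<^esub> \<and> \<gamma> \<in> U \<rightarrow> carrier W \<and>
      (\<forall>e\<in>arcs G. tail G e \<in> U \<and> head G e \<in> U \<longrightarrow> \<gamma> (head G e) = \<gamma> (tail G e) \<otimes>\<^bsub>W\<^esub> \<tau> e) \<and>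
      (\<forall>u\<in>U. \<forall>w\<in>U. \<exists>p. apath u p w \<and> set (awalk_verts u p) \<subseteq> U)" for U \<gamma>
  have no_loop: False if "e \<in> arcs G" "tail G e = head G e" for e
  proof -
    have "cycle [e]"
      using that by (auto simp: cycle_def awalk_Cons_iff awalk_Nil_iff intro: head_in_verts)
    then show False using acyc by blast
  qed
  have "good {v0} (\<lambda>_. \<one>\<^bsub>W\<^esub>)"
    using v0 by (auto simp: good_def apath_Nil_iff dest: no_loop intro!: exI[of _ "[]"])
  then have "{U. \<exists>\<gamma>. good U \<gamma>} \<noteq> {}" by blast
  moreover have "finite {U. \<exists>\<gamma>. good U \<gamma>}"
    by (rule finite_subset[of _ "Pow (verts G)"]) (auto simp: good_def fin)
  ultimately obtain U where U: "\<exists>\<gamma>. good U \<gamma>"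
    and max: "\<And>U' \<gamma>. good U' \<gamma> \<Longrightarrow> U \<subseteq> U' \<Longrightarrow> U = U'"
    using finite_has_maximal[of "{U. \<exists>\<gamma>. good U \<gamma>}"] by blast
  from U obtain \<gamma> where \<gamma>: "good U \<gamma>" by blast
  have "U = verts G"
  proof (rule ccontr)
    assume "U \<noteq> verts G"
    then obtain e where e: "e \<in> arcs G" "tail G e \<in> U" "head G e \<notin> U"
      using connected_exit[OF conn, of v0 U] \<gamma> by (auto simp: good_def)
    define w where "w = head G e"
    have w: "w \<in> verts G" "w \<notin> U" using e by (auto simp: w_def)
    have uniq: "f = e" if f: "f \<in> arcs G" "tail G f \<in> U" "head G f = w" for f
    proof (rule ccontr)
      assume "f \<noteq> e"
      obtain p where p: "apath (tail G e) p (tail G f)" "set (awalk_verts (tail G e) p) \<subseteq> U"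
        using \<gamma> e(2) f(2) unfolding good_def by blast
      have pw: "awalk (tail G e) p (tail G f)" and pd: "distinct (awalk_verts (tail G e) p)"
        using p by (auto simp: apath_def)
      have aw: "awalk (tail G e) (p @ [f]) w"
        using pw f by (auto simp: awalk_Cons_iff awalk_Nil_iff awlast_of_awalk w)
      have "awalk w (bar e # p @ [f]) w"
        unfolding awalk_Cons_iff using aw e by (simp add: bar_arcs tail_bar head_bar w_def)
      moreover have "awalk_verts (tail G e) (p @ [f]) = awalk_verts (tail G e) p @ [w]"
        using awalk_verts_append[OF aw] f by simp
      ultimately have "cycle (bar e # p @ [f])"
        unfolding cycle_def using pd p w e by (intro exI[of _ w]) (auto simp: head_bar)
      \<comment> \<open>The cycle has the form \<open>[g, bar g]\<close> only if \<open>p\<close> is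
        empty and \<open>f\<close> is \<open>bar (bar e)\<close>.\<close>
      then obtain g where "bar e # p @ [f] = [g, bar g]" using acyc by blast
      then have "f = e" using e bar_bar by (cases p) auto
      with \<open>f \<noteq> e\<close> show False by simp
    qed
    define \<gamma>' where "\<gamma>' = \<gamma>(w := \<gamma> (tail G e) \<otimes>\<^bsub>W\<^esub> \<tau> e)"
    have "good (insert w U) \<gamma>'"
      unfolding good_def
    proof (intro conjI ballI impI)
      show "v0 \<in> insert w U" "insert w U \<subseteq> verts G" using \<gamma> w by (auto simp: good_def)
      show "\<gamma>' v0 = \<one>\<^bsub>W\<^esub>" using \<gamma> w by (auto simp: good_def \<gamma>'_def)
      show "\<gamma>' \<in> insert w U \<rightarrow> carrier W"
        using \<gamma> w e \<tau> by (auto simp: good_def \<gamma>'_def Pi_iff)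
    next
      fix f assume f: "f \<in> arcs G" "tail G f \<in> insert w U \<and> head G f \<in> insert w U"
      consider "tail G f \<in> U" "head G f \<in> U" | "tail G f \<in> U" "head G f = w"
        | "tail G f = w" "head G f \<in> U"
        using f no_loop[of f] by auto
      then show "\<gamma>' (head G f) = \<gamma>' (tail G f) \<otimes>\<^bsub>W\<^esub> \<tau> f"
      proof cases
        case 1
        then show ?thesis using \<gamma> w f by (auto simp: good_def \<gamma>'_def)
      next
        case 2
        then show ?thesis using uniq[OF f(1)] e w by (auto simp: \<gamma>'_def)
      next
        case 3
        \<comment> \<open>An edge from \<open>w\<close> back into \<open>U\<close> is the inverse of
          \<open>e\<close> by uniqueness; its relation is that of \<open>e\<close>, solved for the
          other end.\<close>
        then have "bar f = e" using uniq[of "bar f"] f by (auto simp: bar_arcs tail_bar head_bar)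
        then have "f = bar e" using f bar_bar by auto
        moreover have "\<gamma> (tail G e) \<in> carrier W" "\<tau> e \<in> carrier W"
          using \<gamma> e \<tau> by (auto simp: good_def)
        ultimately show ?thesis
          using 3 w e by (auto simp: \<gamma>'_def tail_bar head_bar w_def \<tau>_bar W.m_assoc)
      qed
    next
      fix x y assume xy: "x \<in> insert w U" "y \<in> insert w U"
      have old: "\<exists>p. apath x p y \<and> set (awalk_verts x p) \<subseteq> U" if "x \<in> U" "y \<in> U" for x y
        using that \<gamma> by (auto simp: good_def)
      consider "x \<in> U" "y \<in> U" | "x = w" "y = w" | "x = w" "y \<in> U" | "x \<in> U" "y = w"
        using xy by blast
      then show "\<exists>p. apath x p y \<and> set (awalk_verts x p) \<subseteq> insert w U"
      proof cases
        case 1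
        then show ?thesis using old by blast
      next
        case 2
        then show ?thesis using w by (auto simp: apath_Nil_iff intro!: exI[of _ "[]"])
      next
        case 3
        then obtain p where "apath (tail G e) p y" "set (awalk_verts (tail G e) p) \<subseteq> U"
          using old e by blast
        then show ?thesis
          using 3 e w by (intro exI[of _ "bar e # p"])
            (auto simp: apath_Cons_iff bar_arcs tail_bar head_bar w_def)
      next
        case 4
        then obtain p where p: "apath x p (tail G e)" "set (awalk_verts x p) \<subseteq> U"
          using old e by blast
        have pl: "awlast x p = tail G e" using p by (auto simp: apath_def)
        have ap: "apath x (p @ [e]) w"
          unfolding apath_append_iff pl
          using p e w by (auto simp: apath_Cons_iff apath_Nil_iff w_def)
        have "awalk_verts x (p @ [e]) = awalk_verts x p @ [w]"
          using awalk_verts_append[of x p "[e]" w] ap by (simp add: apath_def w_def)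
        then show ?thesis using ap p 4 by (intro exI[of _ "p @ [e]"]) auto
      qed
    qed
    with max[of "insert w U" \<gamma>'] w show False by blast
  qed
  with \<gamma> that[of \<gamma>] show ?thesis by (auto simp: good_def)
qed

text \<open>A missing vertex \<open>w\<close> can be hung onto the tree by one edge \<open>e\<close>
  and its inverse. A cycle through \<open>e\<close> has to backtrack at \<open>w\<close>, where no
  other edge of the larger graph ends, so the larger graph is still a tree.\<close>

lemma maximal_tree_spanning:
  assumes conn: "Digraph_Component.connected G" and T: "maximal_tree G bar T"
  shows "verts T = verts G"
proof (rule ccontr)
  have sub: "subgraph T G" and tree: "serre_tree bar T"
    and max: "\<And>T'. T' \<noteq> T \<Longrightarrow> subgraph T T' \<Longrightarrow> subgraph T' G \<Longrightarrow> \<not> serre_tree bar T'"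
    using T by (auto simp: maximal_tree_def max_subgraph_def)
  interpret T: wf_digraph T using sub by (simp add: subgraph_def)
  have TG: "tail T = tail G" "head T = head G" "verts T \<subseteq> verts G" "arcs T \<subseteq> arcs G"
    using sub by (auto simp: subgraph_def compatible_def)
  have connT: "Digraph_Component.connected T" and barT: "bar ` arcs T \<subseteq> arcs T"
    using tree by (auto simp: serre_tree_def)
  assume "verts T \<noteq> verts G"
  moreover obtain v0 where "v0 \<in> verts T"
    using connT by (auto simp: Digraph_Component.connected_def strongly_connected_def)
  ultimately obtain e where e: "e \<in> arcs G" "tail G e \<in> verts T" "head G e \<notin> verts T"
    using connected_exit[OF conn] TG by metis
  define a where "a = tail G e"
  define w where "w = head G e"
  have aw: "a \<in> verts T" "w \<notin> verts T" "a \<noteq> w" using e by (auto simp: a_def w_def)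
  define T' where "T' = \<lparr>verts = insert w (verts T), arcs = insert e (insert (bar e) (arcs T)),
     tail = tail G, head = head G\<rparr>"
  have T'_simps [simp]: "verts T' = insert w (verts T)" "arcs T' = insert e (insert (bar e) (arcs T))"
     "tail T' = tail G" "head T' = head G"
    by (auto simp: T'_def)
  have Tw: "tail G f \<in> verts T" "head G f \<in> verts T" if "f \<in> arcs T" for f
    using T.wellformed[OF that] TG by auto
  interpret T': wf_digraph T'
    by unfold_locales (use e Tw in \<open>auto simp: a_def w_def tail_bar head_bar\<close>)
  have subT': "subgraph T T'" "subgraph T' G"
    using TG e T.wf_digraph_axioms T'.wf_digraph_axioms wf_digraph_axioms bar_arcs
    by (auto simp: subgraph_def compatible_def w_def)
  have "serre_tree bar T'"
    unfolding serre_tree_def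
  proof (intro conjI notI)
    show "bar ` arcs T' \<subseteq> arcs T'" using barT e by (auto simp: bar_bar)
  next
    let ?S = "with_proj (mk_symmetric T)" and ?S' = "with_proj (mk_symmetric T')"
    interpret S': pair_wf_digraph "mk_symmetric T'" ..
    have reach: "x \<rightarrow>\<^sup>*\<^bsub>?S'\<^esub> y" if "x \<in> verts T" "y \<in> verts T" for x y
    proof -
      have "x \<rightarrow>\<^sup>*\<^bsub>?S\<^esub> y"
        using connT that by (auto simp: Digraph_Component.connected_def strongly_connected_def)
      then show ?thesis
        by (rule pre_digraph.reachable_mono) (rule subgraph_mk_symmetric[OF subT'(1)])
    qed
    have "a \<rightarrow>\<^sup>*\<^bsub>?S'\<^esub> w" "w \<rightarrow>\<^sup>*\<^bsub>?S'\<^esub> a"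
      by (auto intro!: S'.reachable_adjI simp: parcs_mk_symmetric a_def w_def)
    moreover have "w \<rightarrow>\<^sup>*\<^bsub>?S'\<^esub> w" by (rule S'.reachable_refl) simp
    ultimately have "x \<rightarrow>\<^sup>*\<^bsub>?S'\<^esub> y" if "x \<in> insert w (verts T)" "y \<in> insert w (verts T)" for x y
      using that reach[OF aw(1), of y] reach[OF _ aw(1), of x] reach[of x y]
      by (elim insertE) (blast intro: S'.reachable_trans)+
    then show "Digraph_Component.connected T'"
      by (auto simp: Digraph_Component.connected_def strongly_connected_def)
  next
    assume "\<exists>p. pre_digraph.cycle T' p \<and> \<not> (\<exists>e. p = [e, bar e])"
    then obtain p where p: "T'.cycle p" "\<And>f. p \<noteq> [f, bar f]" by blast
    then obtain u where u: "T'.awalk u p u" "distinct (tl (T'.awalk_verts u p))" "p \<noteq> []"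
      by (auto simp: T'.cycle_def)
    have out_w: "f = bar e" if "f \<in> arcs T'" "tail G f = w" for f
      using that aw Tw a_def by auto
    have in_w: "f = e" if "f \<in> arcs T'" "head G f = w" for f
      using that aw Tw a_def e by (auto simp: head_bar)
    have apath_trivial: "q = []" if "T'.awalk x q x" "distinct (T'.awalk_verts x q)" for x q
      using that T'.apath_nonempty_ends[of x q x] by (auto simp: T'.apath_def)
    have consD: "f \<in> arcs T'" "tail G f = x" "T'.awalk (head G f) q y"
      if "T'.awalk x (f # q) y" for f x y q
      using that unfolding T'.awalk_Cons_iff T'_simps by simp_all
    \<comment> \<open>A walk gets to the tail \<open>w\<close> of \<open>bar e\<close> only by
      starting there or by arriving through \<open>e\<close>.\<close>
    have enters: "x = w \<or> e \<in> set q" if "T'.awalk x q y" "bar e \<in> set q" for x y q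
      using that
    proof (induction q arbitrary: x)
      case (Cons f q)
      have f: "f \<in> arcs T'" "x = tail G f" "T'.awalk (head G f) q y"
        using Cons.prems(1) unfolding T'.awalk_Cons_iff T'_simps by simp_all
      show ?case
      proof (cases "f = bar e")
        case True
        then show ?thesis using f(2) e(1) by (simp add: tail_bar w_def)
      next
        case False
        then have "head G f = w \<or> e \<in> set q"
          using Cons.IH[OF f(3)] Cons.prems(2) by simp
        then show ?thesis using in_w[OF f(1)] by auto
      qed
    qed simp
    have ends_w: "e \<in> set q" if "T'.awalk x q w" "q \<noteq> []" for x q
      using that
    proof (induction q arbitrary: x)
      case (Cons f q)
      have f: "f \<in> arcs T'" "T'.awalk (head G f) q w"
        using Cons.prems(1) unfolding T'.awalk_Cons_iff T'_simps by simp_all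
      show ?case
      proof (cases "q = []")
        case True
        then have "head G f = w" using f(2) by (simp add: T'.awalk_Nil_iff)
        then show ?thesis using in_w[OF f(1)] by simp
      next
        case False
        then show ?thesis using Cons.IH[OF f(2)] by simp
      qed
    qed simp
    show False
    proof (cases "e \<in> set p")
      case False
      \<comment> \<open>If \<open>bar e\<close> occurred without \<open>e\<close>, the cycle would
        start at \<open>w\<close>, hence also end there, and the only way into \<open>w\<close> is
        \<open>e\<close>. So the cycle lies in the old tree.\<close>
      have "bar e \<notin> set p"
      proof
        assume "bar e \<in> set p"
        then have "u = w" using enters[OF u(1)] False by blast
        then show False using ends_w[of u p] u False by simp
      qed
      with False have "set p \<subseteq> arcs T" using u(1) by (auto simp: T'.awalk_def)
      moreover have "compatible T' T" using TG by (simp add: compatible_def)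
      moreover have "u \<in> verts T" using calculation(1) u Tw
        by (cases p) (auto simp: T'.awalk_Cons_iff)
      ultimately have "T.cycle p"
        using u unfolding T.cycle_def T.awalk_def T'.awalk_def
        by (auto simp: compatible_cas compatible_awalk_verts)
      then obtain f where "p = [f, bar f]" using tree unfolding serre_tree_def by blast
      then show False using p(2) by simp
    next
      case True
      then obtain p1 q where pq: "p = p1 @ e # q" by (auto simp: in_set_conv_decomp)
      have p1: "T'.awalk u p1 a" and q: "T'.awalk w q u"
        using u(1) pq by (auto simp: T'.awalk_Cons_iff a_def w_def)
      have verts: "T'.awalk_verts u p = T'.awalk_verts u p1 @ T'.awalk_verts w q"
        using T'.awalk_verts_append[of u p1 "e # q" u] u(1) pq p1 by (simp add: w_def)
      have d: "distinct (tl (T'.awalk_verts u p1))" "distinct (T'.awalk_verts w q)"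
        "set (tl (T'.awalk_verts u p1)) \<inter> set (T'.awalk_verts w q) = {}"
        using u(2) verts by (auto simp: tl_append split: list.splits)
      show False
      proof (cases q)
        \<comment> \<open>The cycle ends with \<open>e\<close>, so it starts at \<open>w\<close> and
          leaves by \<open>bar e\<close>. What remains is a simple walk from \<open>a\<close> to
          \<open>a\<close>, hence empty.\<close>
        case Nil
        then have uw: "u = w" using q by (auto simp: T'.awalk_Nil_iff)
        have "p1 \<noteq> []" using p1 uw aw(3) by (auto simp only: T'.awalk_Nil_iff)
        then obtain f r where r: "p1 = f # r" by (cases p1) auto
        have fr: "f \<in> arcs T'" "tail G f = w" "T'.awalk (head G f) r a"
          using consD p1 r uw by blast+
        then have f: "f = bar e" using out_w by blast
        then have "T'.awalk a r a" using fr(3) e(1) by (simp only: head_bar a_def)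
        moreover have "distinct (T'.awalk_verts a r)"
          using d(1) r f e by (simp add: head_bar a_def)
        ultimately have "r = []" by (rule apath_trivial)
        then show False using p(2)[of "bar e"] pq Nil r f e by (simp add: bar_bar)
      next
        case (Cons f r)
        then have fr: "f \<in> arcs T'" "tail G f = w" "T'.awalk (head G f) r u"
          using consD q by blast+
        then have f: "f = bar e" using out_w by blast
        then have r: "T'.awalk a r u" using fr(3) e(1) by (simp only: head_bar a_def)
        have qv: "T'.awalk_verts w q = w # T'.awalk_verts a r"
          using Cons f e by (simp add: tail_bar head_bar w_def a_def)
        \<comment> \<open>After \<open>e\<close> comes \<open>bar e\<close>, and the cycle is back
          at \<open>a\<close>; a nonempty \<open>p1\<close> would make it visit \<open>a\<close>
          twice.\<close>
        have "p1 = []"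
        proof (rule ccontr)
          assume "p1 \<noteq> []"
          then have "last (T'.awalk_verts u p1) \<in> set (tl (T'.awalk_verts u p1))"
            by (cases p1) auto
          moreover have "last (T'.awalk_verts u p1) = a" using p1 by (rule T'.awlast_of_awalk) simp
          moreover have "a \<in> set (T'.awalk_verts a r)"
            using r by (rule T'.hd_in_awalk_verts)
          ultimately show False using d(3) qv by auto
        qed
        then have "u = a" using p1 by (simp only: T'.awalk_Nil_iff)
        then have "r = []" using r apath_trivial[of a r] d(2) qv by auto
        then show False using p(2)[of e] pq \<open>p1 = []\<close> Cons f by simp
      qed
    qed
  qed
  moreover have "T' \<noteq> T" using aw by (metis T'_simps(1) insertI1)
  ultimately show False using max subT' by blast
qed

end

section \<open>Finite index and virtual retractions\<close>

context group
begin

text \<open>Each fibre of \<open>f\<close> lies in one coset, so the index is at most the number of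
  values. The finite index claims below come down to a choice of \<open>f\<close>.\<close>

lemma finite_index_subgroupI:
  assumes K: "subgroup K G" and fin: "finite (f ` carrier G)"
    and f: "\<And>x y. x \<in> carrier G \<Longrightarrow> y \<in> carrier G \<Longrightarrow> f x = f y \<Longrightarrow> x \<otimes> inv y \<in> K"
  shows "finite_index_subgroup K G"
proof -
  interpret K: subgroup K G by (rule K)
  define s where "s y = (SOME x. x \<in> carrier G \<and> f x = y)" for y
  have s: "s (f x) \<in> carrier G" "f (s (f x)) = f x" if "x \<in> carrier G" for x
    using someI[of "\<lambda>z. z \<in> carrier G \<and> f z = f x" x] that by (auto simp: s_def)
  have "K #> s (f x) = K #> x" if "x \<in> carrier G" for x
  proof (rule repr_independence)
    show "x \<in> K #> s (f x)"
      using f[of x "s (f x)"] s[OF that] that K.rcos_module by auto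
  qed (use s that K in auto)
  then have "rcosets K \<subseteq> (\<lambda>y. K #> s y) ` (f ` carrier G)"
    by (force simp: RCOSETS_def)
  then show ?thesis
    unfolding finite_index_subgroup_def using K fin finite_subset by blast
qed

lemma finite_index_rcos:
  assumes "finite_index_subgroup K G"
  shows "finite ((\<lambda>x. K #> x) ` carrier G)"
    and "\<And>x y. x \<in> carrier G \<Longrightarrow> y \<in> carrier G \<Longrightarrow> K #> x = K #> y \<Longrightarrow> x \<otimes> inv y \<in> K"
proof -
  have K: "subgroup K G" and fin: "finite (rcosets K)"
    using assms by (auto simp: finite_index_subgroup_def)
  interpret K: subgroup K G by (rule K)
  have "(\<lambda>x. K #> x) ` carrier G = rcosets K" by (auto simp: RCOSETS_def)
  with fin show "finite ((\<lambda>x. K #> x) ` carrier G)" by simp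
  show "x \<otimes> inv y \<in> K" if "x \<in> carrier G" "y \<in> carrier G" "K #> x = K #> y" for x y
  proof -
    have "x \<in> K #> y" using that rcos_self[OF that(1) K] by simp
    then show ?thesis using that K.rcos_module_imp by blast
  qed
qed

lemma finite_index_trans:
  assumes K: "finite_index_subgroup K G" and M: "subgroup M G" "M \<subseteq> K"
    and fin: "finite (f ` K)"
    and f: "\<And>x y. x \<in> K \<Longrightarrow> y \<in> K \<Longrightarrow> f x = f y \<Longrightarrow> x \<otimes> inv y \<in> M"
  shows "finite_index_subgroup M G"
proof -
  have KG: "subgroup K G" using K by (simp add: finite_index_subgroup_def)
  interpret K: subgroup K G by (rule KG)
  define s where "s C = (SOME x. x \<in> C)" for C :: "'a set"
  have s: "s (K #> x) \<in> carrier G" "x \<otimes> inv (s (K #> x)) \<in> K" if "x \<in> carrier G" for x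
  proof -
    have "x \<in> K #> x" using that KG by (rule rcos_self)
    then have sx: "s (K #> x) \<in> K #> x" unfolding s_def by (rule someI)
    with that show sG: "s (K #> x) \<in> carrier G"
      using r_coset_subset_G K.subset by blast
    have "K #> x = K #> s (K #> x)" using sx that KG by (rule repr_independence)
    then show "x \<otimes> inv (s (K #> x)) \<in> K" using finite_index_rcos(2)[OF K that sG] by simp
  qed
  \<comment> \<open>The coset of \<open>x\<close>, together with \<open>f\<close> of the factor in
    \<open>K\<close> that remains after the chosen representative is split off; for equal cosets the
    representative cancels in \<open>x \<otimes> inv y\<close>.\<close>
  define g where "g x = (K #> x, f (x \<otimes> inv (s (K #> x))))" for x
  show ?thesis
  proof (rule finite_index_subgroupI[of _ g])
    have "g ` carrier G \<subseteq> (\<lambda>x. K #> x) ` carrier G \<times> f ` K"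
      using s by (auto simp: g_def)
    then show "finite (g ` carrier G)"
      using finite_index_rcos(1)[OF K] fin by (meson finite_SigmaI finite_subset)
  next
    fix x y assume xy: "x \<in> carrier G" "y \<in> carrier G" "g x = g y"
    let ?s = "s (K #> x)"
    have "(x \<otimes> inv ?s) \<otimes> inv (y \<otimes> inv ?s) \<in> M"
      using xy s[of x] s[of y] by (intro f) (auto simp: g_def)
    moreover have "(x \<otimes> inv ?s) \<otimes> inv (y \<otimes> inv ?s) = x \<otimes> inv y"
      using xy s[of x] by (simp add: inv_mult_group m_assoc) (simp flip: m_assoc)
    ultimately show "x \<otimes> inv y \<in> M" by simp
  qed (use M in auto)
qed

lemma finite_index_Int:
  assumes "finite_index_subgroup K G" "finite_index_subgroup L G"
  shows "finite_index_subgroup (K \<inter> L) G"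
proof (rule finite_index_subgroupI[of _ "\<lambda>x. (K #> x, L #> x)"])
  show "subgroup (K \<inter> L) G"
    using assms by (intro subgroups_Inter_pair) (auto simp: finite_index_subgroup_def)
  have "(\<lambda>x. (K #> x, L #> x)) ` carrier G \<subseteq>
      (\<lambda>x. K #> x) ` carrier G \<times> (\<lambda>x. L #> x) ` carrier G" by auto
  then show "finite ((\<lambda>x. (K #> x, L #> x)) ` carrier G)"
    using finite_index_rcos(1)[OF assms(1)] finite_index_rcos(1)[OF assms(2)]
    by (meson finite_SigmaI finite_subset)
qed (use finite_index_rcos(2)[OF assms(1)] finite_index_rcos(2)[OF assms(2)] in auto)

lemma finite_index_carrier: "finite_index_subgroup (carrier G) G"
  by (rule finite_index_subgroupI[of _ "\<lambda>_. ()"]) (auto intro: subgroup_self)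

lemma finite_index_INT:
  assumes "finite I" "\<And>i. i \<in> I \<Longrightarrow> finite_index_subgroup (K i) G"
  shows "finite_index_subgroup (carrier G \<inter> (\<Inter>i\<in>I. K i)) G"
  using assms
proof (induction I rule: finite_induct)
  case (insert i I)
  then have "finite_index_subgroup (K i \<inter> (carrier G \<inter> (\<Inter>i\<in>I. K i))) G"
    by (simp add: finite_index_Int)
  moreover have "K i \<inter> (carrier G \<inter> (\<Inter>i\<in>I. K i)) = carrier G \<inter> (\<Inter>i\<in>insert i I. K i)"
    by auto
  ultimately show ?case by simp
qed (simp add: finite_index_carrier)

text \<open>\<open>N\<close> is the kernel of the action on the cosets of \<open>K\<close> by right
  translation, and a finite set has only finitely many self-maps.\<close>

lemma finite_index_normal_core:
  assumes K: "finite_index_subgroup K G"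
  obtains N where "finite_index_subgroup N G" "N \<subseteq> K"
    "\<And>g x. g \<in> carrier G \<Longrightarrow> x \<in> N \<Longrightarrow> g \<otimes> x \<otimes> inv g \<in> N"
proof -
  define N where "N = {x \<in> carrier G. \<forall>g\<in>carrier G. g \<otimes> x \<otimes> inv g \<in> K}"
  have KG: "subgroup K G" using K by (simp add: finite_index_subgroup_def)
  interpret K: subgroup K G by (rule KG)
  have N_sub: "subgroup N G"
  proof (rule subgroupI)
    show "N \<noteq> {}" by (auto simp: N_def intro!: exI[of _ \<one>])
  next
    fix x assume x: "x \<in> N"
    have "g \<otimes> inv x \<otimes> inv g \<in> K" if "g \<in> carrier G" for g
    proof -
      have "inv (g \<otimes> x \<otimes> inv g) \<in> K" using x that by (auto simp: N_def)
      moreover have "inv (g \<otimes> x \<otimes> inv g) = g \<otimes> inv x \<otimes> inv g"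
        using x that by (simp add: N_def inv_mult_group m_assoc)
      ultimately show ?thesis by simp
    qed
    then show "inv x \<in> N" using x by (simp add: N_def)
  next
    fix x y assume xy: "x \<in> N" "y \<in> N"
    have "g \<otimes> (x \<otimes> y) \<otimes> inv g \<in> K" if g: "g \<in> carrier G" for g
    proof -
      have "(g \<otimes> x \<otimes> inv g) \<otimes> (g \<otimes> y \<otimes> inv g) \<in> K" using xy g by (auto simp: N_def)
      moreover have "(g \<otimes> x \<otimes> inv g) \<otimes> (g \<otimes> y \<otimes> inv g) = g \<otimes> (x \<otimes> y) \<otimes> inv g"
        using xy g by (simp add: N_def m_assoc) (simp add: N_def flip: m_assoc)
      ultimately show ?thesis by simp
    qed
    then show "x \<otimes> y \<in> N" using xy by (simp add: N_def)
  qed (auto simp: N_def)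
  have "finite_index_subgroup N G"
  proof (rule finite_index_subgroupI[of _ "\<lambda>x. \<lambda>C\<in>rcosets K. C #> x"])
    let ?R = "rcosets K"
    have "C #> x \<in> ?R" if "C \<in> ?R" "x \<in> carrier G" for C x
      using that K.subset by (auto simp: RCOSETS_def coset_mult_assoc)
    then have "(\<lambda>x. \<lambda>C\<in>?R. C #> x) ` carrier G \<subseteq> ?R \<rightarrow>\<^sub>E ?R"
      by (intro image_subsetI) (simp add: restrict_PiE_iff)
    moreover have "finite (?R \<rightarrow>\<^sub>E ?R)"
      using K by (intro finite_PiE) (auto simp: finite_index_subgroup_def)
    ultimately show "finite ((\<lambda>x. \<lambda>C\<in>?R. C #> x) ` carrier G)" by (rule finite_subset)
  next
    fix x y assume xy: "x \<in> carrier G" "y \<in> carrier G"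
      and eq: "(\<lambda>C\<in>rcosets K. C #> x) = (\<lambda>C\<in>rcosets K. C #> y)"
    have "g \<otimes> (x \<otimes> inv y) \<otimes> inv g \<in> K" if g: "g \<in> carrier G" for g
    proof -
      have "K #> g \<in> rcosets K" using g by (auto simp: RCOSETS_def)
      then have "(K #> g) #> x = (K #> g) #> y" using fun_cong[OF eq, of "K #> g"] by simp
      then have "K #> (g \<otimes> x) = K #> (g \<otimes> y)"
        using g xy K.subset by (simp add: coset_mult_assoc)
      then have "(g \<otimes> x) \<otimes> inv (g \<otimes> y) \<in> K"
        using g xy finite_index_rcos(2)[OF K] by simp
      then show ?thesis using g xy by (simp add: inv_mult_group m_assoc)
    qed
    then show "x \<otimes> inv y \<in> N" using xy by (simp add: N_def)
  qed (rule N_sub)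
  moreover have "N \<subseteq> K"
    using K.subset by (auto simp: N_def dest: bspec[of _ _ \<one>])
  moreover have "g \<otimes> x \<otimes> inv g \<in> N" if g: "g \<in> carrier G" and x: "x \<in> N" for g x
  proof -
    have "h \<otimes> (g \<otimes> x \<otimes> inv g) \<otimes> inv h \<in> K" if h: "h \<in> carrier G" for h
    proof -
      have "(h \<otimes> g) \<otimes> x \<otimes> inv (h \<otimes> g) \<in> K" using x g h by (auto simp: N_def)
      then show ?thesis using x g h by (simp add: N_def inv_mult_group m_assoc)
    qed
    then show ?thesis using x g by (simp add: N_def)
  qed
  ultimately show ?thesis using that by blast
qed


section \<open>Cyclic subgroups and the characters obtained from retractions\<close>

lemma cyclic_subgroup_range:
  assumes "c \<in> carrier G"
  shows "subgroup (range (\<lambda>n::int. c [^] n)) G"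
    "cyclic_group (G\<lparr>carrier := range (\<lambda>n::int. c [^] n)\<rparr>)"
proof -
  let ?C = "range (\<lambda>n::int. c [^] n)"
  show sub: "subgroup ?C G"
  proof (rule subgroupI)
    fix x y assume "x \<in> ?C" "y \<in> ?C"
    then obtain m n :: int where "x = c [^] m" "y = c [^] n" by auto
    then show "inv x \<in> ?C" "x \<otimes> y \<in> ?C"
      using assms by (auto simp flip: int_pow_neg int_pow_mult)
  qed (use assms in auto)
  interpret C: group "G\<lparr>carrier := ?C\<rparr>" using sub by (rule subgroup.subgroup_is_group) (rule is_group)
  have c: "c \<in> ?C" using assms by (metis int_pow_1 rangeI)
  have "(\<lambda>n::int. c [^] n) = (\<lambda>n::int. c [^]\<^bsub>G\<lparr>carrier := ?C\<rparr>\<^esub> n)"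
    using int_pow_consistent[OF sub c] by (rule ext)
  then have "?C = range (\<lambda>n::int. c [^]\<^bsub>G\<lparr>carrier := ?C\<rparr>\<^esub> n)"
    by (rule arg_cong)
  moreover have "carrier (G\<lparr>carrier := ?C\<rparr>) = ?C" by simp
  ultimately have "carrier (G\<lparr>carrier := ?C\<rparr>) = range (\<lambda>n::int. c [^]\<^bsub>G\<lparr>carrier := ?C\<rparr>\<^esub> n)"
    by (rule HOL.trans[rotated])
  then show "cyclic_group (G\<lparr>carrier := ?C\<rparr>)"
    unfolding C.cyclic_group by (rule bexI) (simp add: c)
qed

lemma VRC_retraction:
  assumes "VRC G" "c \<in> carrier G"
  obtains K \<rho> where "finite_index_subgroup K G" "range (\<lambda>n::int. c [^] n) \<subseteq> K"
    "\<And>x. x \<in> K \<Longrightarrow> \<rho> x \<in> range (\<lambda>n::int. c [^] n)"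
    "\<And>x y. x \<in> K \<Longrightarrow> y \<in> K \<Longrightarrow> \<rho> (x \<otimes> y) = \<rho> x \<otimes> \<rho> y"
    "\<And>x. x \<in> range (\<lambda>n::int. c [^] n) \<Longrightarrow> \<rho> x = x"
proof -
  have "virtual_retract (range (\<lambda>n::int. c [^] n)) G"
    using assms cyclic_subgroup_range[of c] by (auto simp: VRC_def)
  then obtain K \<rho> where K: "finite_index_subgroup K G" "range (\<lambda>n::int. c [^] n) \<subseteq> K"
    and \<rho>: "\<rho> \<in> hom (G\<lparr>carrier := K\<rparr>) (G\<lparr>carrier := range (\<lambda>n::int. c [^] n)\<rparr>)"
      "\<forall>x\<in>range (\<lambda>n::int. c [^] n). \<rho> x = x"
    unfolding virtual_retract_def by blast
  show ?thesis
    using that[of K \<rho>] K \<rho> hom_in_carrier[OF \<rho>(1)] hom_mult[OF \<rho>(1)] by simp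
qed

text \<open>As \<rho> takes values in \<open>C\<close>, only the cosets of \<open>D\<close> that
  meet \<open>C\<close> count, and \<open>f\<close> has to tell just these apart. Applied with
  trivial \<open>D\<close> when \<open>C\<close> is finite, and with \<open>D\<close> of finite
  index.\<close>

lemma finite_index_preimage:
  assumes K: "finite_index_subgroup K G" and C: "subgroup C G" "C \<subseteq> K"
    and \<rho>: "\<And>x. x \<in> K \<Longrightarrow> \<rho> x \<in> C" "\<And>x y. x \<in> K \<Longrightarrow> y \<in> K \<Longrightarrow> \<rho> (x \<otimes> y) = \<rho> x \<otimes> \<rho> y"
    and D: "subgroup D G" and fin: "finite (f ` C)"
    and f: "\<And>x y. x \<in> C \<Longrightarrow> y \<in> C \<Longrightarrow> f x = f y \<Longrightarrow> x \<otimes> inv y \<in> D"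
  shows "finite_index_subgroup {x \<in> K. \<rho> x \<in> D} G"
proof -
  have KG: "subgroup K G" using K by (simp add: finite_index_subgroup_def)
  interpret K: subgroup K G by (rule KG)
  interpret C: subgroup C G by (rule C)
  interpret D: subgroup D G by (rule D)
  have \<rho>G: "\<rho> x \<in> carrier G" if "x \<in> K" for x using \<rho>(1)[OF that] C.subset by blast
  have one: "\<rho> \<one> = \<one>"
    using \<rho>(2)[of \<one> \<one>] \<rho>G[of \<one>] by (simp add: l_cancel_one)
  have inv: "\<rho> (inv x) = inv (\<rho> x)" if "x \<in> K" for x
    using \<rho>(2)[of "inv x" x] \<rho>G that one by (intro inv_equality[symmetric]) auto
  have sub: "subgroup {x \<in> K. \<rho> x \<in> D} G"
    using K.subset by (intro subgroupI) (auto simp: one inv \<rho>(2) intro!: exI[of _ \<one>])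
  show ?thesis
  proof (rule finite_index_trans[OF K sub])
    show "finite ((\<lambda>x. f (\<rho> x)) ` K)"
      using \<rho>(1) by (intro finite_subset[OF _ fin]) auto
  next
    fix x y assume "x \<in> K" "y \<in> K" "f (\<rho> x) = f (\<rho> y)"
    then show "x \<otimes> inv y \<in> {x \<in> K. \<rho> x \<in> D}"
      using f[of "\<rho> x" "\<rho> y"] \<rho>(1) by (auto simp: \<rho>(2) inv)
  qed auto
qed

text \<open>For \<open>c\<close> of infinite order the character is the exponent of the retraction.
  For \<open>c\<close> of finite order \<open>K\<close> is shrunk to the kernel of the retraction,
  which meets the cyclic group trivially, and the zero character will do.\<close>

lemma VRC_hom_int:
  assumes V: "VRC G" and c: "c \<in> carrier G"
  obtains K \<phi> where "finite_index_subgroup K G"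
    "\<And>x y. x \<in> K \<Longrightarrow> y \<in> K \<Longrightarrow> \<phi> (x \<otimes> y) = \<phi> x + (\<phi> y :: int)"
    "\<And>n::int. c [^] n \<in> K \<Longrightarrow> \<phi> (c [^] n) = 0 \<Longrightarrow> c [^] n = \<one>"
proof -
  let ?C = "range (\<lambda>n::int. c [^] n)"
  obtain K \<rho> where K: "finite_index_subgroup K G" "?C \<subseteq> K" "\<And>x. x \<in> K \<Longrightarrow> \<rho> x \<in> ?C"
    "\<And>x y. x \<in> K \<Longrightarrow> y \<in> K \<Longrightarrow> \<rho> (x \<otimes> y) = \<rho> x \<otimes> \<rho> y" "\<And>x. x \<in> ?C \<Longrightarrow> \<rho> x = x"
    using VRC_retraction[OF V c] by blast
  have C: "subgroup ?C G" using cyclic_subgroup_range[OF c] by simp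
  show ?thesis
  proof (cases "inj (\<lambda>n::int. c [^] n)")
    case True
    define \<phi> where "\<phi> x = inv_into UNIV (\<lambda>n::int. c [^] n) (\<rho> x)" for x
    have \<phi>: "\<phi> x = n" if "\<rho> x = c [^] n" for x n
      unfolding \<phi>_def that by (rule inv_into_f_f[OF True]) simp
    show ?thesis
    proof (rule that[of K \<phi>])
      fix x y assume xy: "x \<in> K" "y \<in> K"
      obtain m n :: int where "\<rho> x = c [^] m" "\<rho> y = c [^] n" using K(3) xy by (meson rangeE)
      then show "\<phi> (x \<otimes> y) = \<phi> x + \<phi> y"
        using xy c \<phi> by (simp add: K(4) int_pow_mult)
    next
      fix n :: int assume "c [^] n \<in> K" "\<phi> (c [^] n) = 0"
      then show "c [^] n = \<one>" using \<phi>[of "c [^] n" n] K(5) by simp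
    qed (rule K)
  next
    case False
    then obtain m n :: int where "m < n" "c [^] m = c [^] n"
      by (metis injI linorder_neq_iff)
    define d where "d = n - m"
    have d: "d > 0" "c [^] d = \<one>"
      using \<open>m < n\<close> \<open>c [^] m = c [^] n\<close> c by (auto simp: d_def int_pow_diff)
    have "c [^] k = c [^] (k mod d)" for k
    proof -
      have "c [^] k = c [^] (d * (k div d) + k mod d)" by simp
      also have "\<dots> = (c [^] d) [^] (k div d) \<otimes> c [^] (k mod d)"
        using c by (simp only: int_pow_mult int_pow_pow)
      finally show ?thesis using c d by simp
    qed
    then have "?C \<subseteq> (\<lambda>n::int. c [^] n) ` {0..<d}"
      using d(1) by (auto intro!: image_eqI[of _ _ "_ mod d"])
    then have fin: "finite (id ` ?C)" by (simp add: finite_subset)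
    have "finite_index_subgroup {x \<in> K. \<rho> x \<in> {\<one>}} G"
      by (rule finite_index_preimage[OF K(1) C K(2) K(3,4) triv_subgroup fin])
        (use c in auto)
    then show ?thesis
      using K(5) by (intro that[of "{x \<in> K. \<rho> x \<in> {\<one>}}" "\<lambda>_. 0"]) auto
  qed
qed

section \<open>Commuting elements and images of Z^2\<close>

lemma commute_nat_pow:
  assumes "x \<in> carrier G" "y \<in> carrier G" "x \<otimes> y = y \<otimes> x"
  shows "x \<otimes> y [^] (i::nat) = y [^] i \<otimes> x"
proof (induction i)
  case (Suc i)
  have "x \<otimes> (y [^] i \<otimes> y) = y [^] i \<otimes> (x \<otimes> y)"
    using assms Suc by (metis m_assoc nat_pow_closed)
  then show ?case using assms by (simp add: m_assoc)
qed (use assms in simp)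

lemma commute_inv:
  assumes "x \<in> carrier G" "y \<in> carrier G" "x \<otimes> y = y \<otimes> x"
  shows "x \<otimes> inv y = inv y \<otimes> x"
proof -
  have "inv y \<otimes> x = inv y \<otimes> (x \<otimes> y) \<otimes> inv y"
    using assms(1,2) by (simp add: m_assoc)
  also have "\<dots> = inv y \<otimes> (y \<otimes> x) \<otimes> inv y" using assms by simp
  also have "\<dots> = x \<otimes> inv y" using assms(1,2) by (simp flip: m_assoc)
  finally show ?thesis by simp
qed

lemma commute_int_pow:
  assumes "x \<in> carrier G" "y \<in> carrier G" "x \<otimes> y = y \<otimes> x"
  shows "x \<otimes> y [^] (k::int) = y [^] k \<otimes> x"
  unfolding int_pow_def2[of G y k]
  using commute_nat_pow[OF assms] commute_inv[OF assms(1) _ commute_nat_pow[OF assms]] assms(2)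
  by (cases "k < 0") (simp_all only: if_True if_False nat_pow_closed)

lemma commute_mult:
  assumes "x \<in> carrier G" "y \<in> carrier G" "z \<in> carrier G" "x \<otimes> y = y \<otimes> x" "x \<otimes> z = z \<otimes> x"
  shows "x \<otimes> (y \<otimes> z) = (y \<otimes> z) \<otimes> x"
  using assms by (metis m_assoc)

lemma int_pow_commute:
  fixes m n :: int
  assumes "a \<in> carrier G" "b \<in> carrier G" "a \<otimes> b = b \<otimes> a"
  shows "a [^] m \<otimes> b [^] n = b [^] n \<otimes> a [^] m"
  using assms commute_int_pow[of a b n] commute_int_pow[of "b [^] n" a m] by simp

definition additive_on :: "'a set \<Rightarrow> ('a \<Rightarrow> int) \<Rightarrow> bool" where
  "additive_on K \<phi> \<longleftrightarrow> (\<forall>x\<in>K. \<forall>y\<in>K. \<phi> (x \<otimes> y) = \<phi> x + \<phi> y)"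

lemma additive_on_one: "subgroup K G \<Longrightarrow> additive_on K \<phi> \<Longrightarrow> \<phi> \<one> = 0"
  using subgroup.one_closed[of K G] by (force simp: additive_on_def)

lemma additive_on_inv:
  assumes "subgroup K G" "additive_on K \<phi>" "x \<in> K"
  shows "\<phi> (inv x) = - \<phi> x"
proof -
  have "x \<in> carrier G" "inv x \<in> K" using assms by (auto simp: subgroup.mem_carrier subgroup.m_inv_closed)
  then have "\<phi> (x \<otimes> inv x) = \<phi> x + \<phi> (inv x)"
    using assms(2,3) unfolding additive_on_def by blast
  then show ?thesis using \<open>x \<in> carrier G\<close> additive_on_one[OF assms(1,2)] by simp
qed

lemma additive_on_subset: "additive_on K \<phi> \<Longrightarrow> L \<subseteq> K \<Longrightarrow> additive_on L \<phi>"
  by (auto simp: additive_on_def)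

text \<open>The homomorphic images of Z^2: vertex groups are met only through their images, so
  \<open>a\<close> and \<open>b\<close> may satisfy further relations.\<close>

definition bicyclic :: "'a set \<Rightarrow> bool" where
  "bicyclic B \<longleftrightarrow> (\<exists>a\<in>carrier G. \<exists>b\<in>carrier G. a \<otimes> b = b \<otimes> a \<and>
     B = {a [^] m \<otimes> b [^] n | (m::int) (n::int). True})"

lemma bicyclic_mult:
  fixes m n m' n' :: int
  assumes "a \<in> carrier G" "b \<in> carrier G" "a \<otimes> b = b \<otimes> a"
  shows "(a [^] m \<otimes> b [^] n) \<otimes> (a [^] m' \<otimes> b [^] n') = a [^] (m + m') \<otimes> b [^] (n + n')"
proof -
  have "(a [^] m \<otimes> b [^] n) \<otimes> (a [^] m' \<otimes> b [^] n') = a [^] m \<otimes> (b [^] n \<otimes> a [^] m') \<otimes> b [^] n'"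
    using assms by (simp add: m_assoc)
  also have "\<dots> = a [^] m \<otimes> (a [^] m' \<otimes> b [^] n) \<otimes> b [^] n'"
    using assms by (simp add: int_pow_commute)
  finally show ?thesis using assms by (simp add: int_pow_mult m_assoc)
qed

lemma bicyclic_pow:
  fixes m n k :: int
  assumes "a \<in> carrier G" "b \<in> carrier G" "a \<otimes> b = b \<otimes> a"
  shows "(a [^] m \<otimes> b [^] n) [^] k = a [^] (m * k) \<otimes> b [^] (n * k)"
  using assms by (simp add: int_pow_mult_distrib int_pow_commute int_pow_pow)

lemma bicyclic_subgroup:
  assumes "bicyclic B"
  shows "subgroup B G"
proof -
  obtain a b where ab: "a \<in> carrier G" "b \<in> carrier G" "a \<otimes> b = b \<otimes> a"
    and B: "B = {a [^] m \<otimes> b [^] n | (m::int) (n::int). True}"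
    using assms unfolding bicyclic_def by blast
  show ?thesis
  proof (rule subgroupI)
    fix x y assume xy: "x \<in> B" "y \<in> B"
    obtain m n m' n' :: int where x: "x = a [^] m \<otimes> b [^] n" and y: "y = a [^] m' \<otimes> b [^] n'"
      using xy by (auto simp: B)
    show "x \<otimes> y \<in> B" using ab by (auto simp: x y bicyclic_mult B)
    have "a [^] (-m) \<otimes> b [^] (-n) \<otimes> x = \<one>" unfolding x using ab by (simp add: bicyclic_mult)
    then have "inv x = a [^] (-m) \<otimes> b [^] (-n)" using ab x by (intro inv_equality) auto
    then show "inv x \<in> B" unfolding B by blast
  qed (use ab in \<open>auto simp: B\<close>)
qed

lemma bicyclic_image_free_Abelian:
  assumes h: "h \<in> hom (free_Abelian_group {..<2::nat}) G"
  shows "bicyclic (h ` carrier (free_Abelian_group {..<2::nat}))"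
proof -
  let ?F = "free_Abelian_group {..<2::nat}"
  interpret h: group_hom ?F G h
    using h is_group by (simp add: group_hom_def group_hom_axioms_def)
  let ?e = "frag_of :: nat \<Rightarrow> nat \<Rightarrow>\<^sub>0 int"
  have e: "?e 0 \<in> carrier ?F" "?e 1 \<in> carrier ?F" by simp_all
  have val: "h (frag_cmul m (?e 0) + frag_cmul n (?e 1)) = h (?e 0) [^] m \<otimes> h (?e 1) [^] n" for m n :: int
  proof -
    have "h (?e 0 [^]\<^bsub>?F\<^esub> m \<otimes>\<^bsub>?F\<^esub> ?e 1 [^]\<^bsub>?F\<^esub> n) = h (?e 0) [^] m \<otimes> h (?e 1) [^] n"
      using e by (simp only: h.hom_mult h.int_pow_closed h.hom_int_pow h.G.int_pow_closed)
    then show ?thesis using e by simp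
  qed
  have "c = frag_cmul (Poly_Mapping.lookup c 0) (?e 0) + frag_cmul (Poly_Mapping.lookup c 1) (?e 1)"
    if c: "c \<in> carrier ?F" for c
  proof (rule poly_mapping_eqI)
    fix k
    have look: "Poly_Mapping.lookup (frag_cmul m (?e i)) l = (if l = i then m else 0)" for m i l
      by simp
    have "Poly_Mapping.lookup c k = 0" if "k \<ge> 2"
      using c that by (auto simp: in_keys_iff)
    then show "Poly_Mapping.lookup c k = Poly_Mapping.lookup
        (frag_cmul (Poly_Mapping.lookup c 0) (?e 0) + frag_cmul (Poly_Mapping.lookup c 1) (?e 1)) k"
      unfolding lookup_add look by (cases "k = 0"; cases "k = 1") auto
  qed
  then have hc: "h c = h (?e 0) [^] Poly_Mapping.lookup c 0 \<otimes> h (?e 1) [^] Poly_Mapping.lookup c 1"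
    if "c \<in> carrier ?F" for c using that val by metis
  have mem: "frag_cmul m (?e 0) + frag_cmul n (?e 1) \<in> carrier ?F" for m n
    using e by (metis carrier_free_Abelian_group_iff h.G.int_pow_closed h.G.m_closed
        int_pow_free_Abelian_group mult_free_Abelian_group)
  have "h ` carrier ?F = {h (?e 0) [^] m \<otimes> h (?e 1) [^] n | (m::int) (n::int). True}"
  proof (intro equalityI subsetI)
    show "y \<in> {h (?e 0) [^] m \<otimes> h (?e 1) [^] n | (m::int) (n::int). True}" if "y \<in> h ` carrier ?F" for y
      using that hc by blast
    fix y assume "y \<in> {h (?e 0) [^] m \<otimes> h (?e 1) [^] n | (m::int) (n::int). True}"
    then obtain m n :: int where "y = h (frag_cmul m (?e 0) + frag_cmul n (?e 1))"
      using val by force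
    then show "y \<in> h ` carrier ?F" using mem by blast
  qed
  moreover have "h (?e 0) \<otimes> h (?e 1) = h (?e 1) \<otimes> h (?e 0)"
    using e by (metis add.commute h.hom_mult mult_free_Abelian_group)
  ultimately show ?thesis
    unfolding bicyclic_def using e h.hom_closed by blast
qed

lemma bicyclic_hom_image:
  assumes "bicyclic B" "h \<in> hom G G"
  shows "bicyclic (h ` B)"
proof -
  interpret h: group_hom G G h
    using assms(2) is_group by (simp add: group_hom_def group_hom_axioms_def)
  obtain a b where ab: "a \<in> carrier G" "b \<in> carrier G" "a \<otimes> b = b \<otimes> a"
    and B: "B = {a [^] m \<otimes> b [^] n | (m::int) (n::int). True}"
    using assms(1) unfolding bicyclic_def by blast
  have "h (a [^] m \<otimes> b [^] n) = h a [^] m \<otimes> h b [^] n" for m n :: int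
    using ab by (simp add: h.hom_int_pow)
  then have "h ` B = {h a [^] m \<otimes> h b [^] n | (m::int) (n::int). True}"
    unfolding B by (auto simp: image_iff) metis
  moreover have "h a \<otimes> h b = h b \<otimes> h a" using ab by (metis h.hom_mult)
  ultimately show ?thesis unfolding bicyclic_def using ab h.hom_closed by blast
qed

text \<open>The set is the conjugate of \<open>B\<close> by \<open>inv s\<close>, written as a
  preimage because membership is later tested after conjugation by a stable letter.\<close>

lemma bicyclic_conj:
  assumes "bicyclic B" "s \<in> carrier G"
  shows "bicyclic {y \<in> carrier G. s \<otimes> y \<otimes> inv s \<in> B}"
proof -
  have BG: "B \<subseteq> carrier G" using bicyclic_subgroup[OF assms(1)] by (rule subgroup.subset)
  have c1: "s \<otimes> (inv s \<otimes> b \<otimes> s) \<otimes> inv s = b" if "b \<in> carrier G" for b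
  proof -
    have "s \<otimes> (inv s \<otimes> b \<otimes> s) \<otimes> inv s = (s \<otimes> inv s) \<otimes> b \<otimes> (s \<otimes> inv s)"
      using that assms(2) by (simp only: m_assoc m_closed inv_closed)
    then show ?thesis using that assms(2) by simp
  qed
  have c2: "inv s \<otimes> (s \<otimes> y \<otimes> inv s) \<otimes> s = y" if "y \<in> carrier G" for y
  proof -
    have "inv s \<otimes> (s \<otimes> y \<otimes> inv s) \<otimes> s = (inv s \<otimes> s) \<otimes> y \<otimes> (inv s \<otimes> s)"
      using that assms(2) by (simp only: m_assoc m_closed inv_closed)
    then show ?thesis using that assms(2) by simp
  qed
  have "(\<lambda>b. inv s \<otimes> b \<otimes> s) \<in> hom G G"
  proof (rule homI)
    fix x y assume xy: "x \<in> carrier G" "y \<in> carrier G"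
    have "(inv s \<otimes> x \<otimes> s) \<otimes> (inv s \<otimes> y \<otimes> s) = inv s \<otimes> x \<otimes> (s \<otimes> inv s) \<otimes> y \<otimes> s"
      using xy assms(2) by (simp only: m_assoc m_closed inv_closed)
    then show "inv s \<otimes> (x \<otimes> y) \<otimes> s = (inv s \<otimes> x \<otimes> s) \<otimes> (inv s \<otimes> y \<otimes> s)"
      using xy assms(2) by (simp add: m_assoc)
  qed (use assms in simp)
  then have "bicyclic ((\<lambda>b. inv s \<otimes> b \<otimes> s) ` B)" by (rule bicyclic_hom_image[OF assms(1)])
  moreover have "(\<lambda>b. inv s \<otimes> b \<otimes> s) ` B = {y \<in> carrier G. s \<otimes> y \<otimes> inv s \<in> B}"
    using BG c1 c2 assms(2) by (force simp: image_iff subset_iff)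
  ultimately show ?thesis by simp
qed

text \<open>The kernel is cyclic because it projects injectively to the exponent of the second generator.\<close>

lemma bicyclic_character_kernel:
  assumes ab: "a \<in> carrier G" "b \<in> carrier G" "a \<otimes> b = b \<otimes> a"
    and K: "subgroup K G" "additive_on K \<phi>"
    and inj: "\<And>m::int. a [^] m \<in> K \<Longrightarrow> \<phi> (a [^] m) = 0 \<Longrightarrow> a [^] m = \<one>"
  obtains u where "u \<in> carrier G"
    "{x \<in> K. \<phi> x = 0 \<and> (\<exists>(m::int) (n::int). x = a [^] m \<otimes> b [^] n)} \<subseteq> range (\<lambda>n::int. u [^] n)"
proof -
  let ?p = "\<lambda>(m::int) (n::int). a [^] m \<otimes> b [^] n"
  \<comment> \<open>\<open>S\<close> is the subgroup of Z^2 formed by the exponents of kernel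
    elements, and \<open>comb\<close> is the division step of the Euclidean algorithm in it.\<close>
  define S where "S = {(m, n). ?p m n \<in> K \<and> \<phi> (?p m n) = 0}"
  have comb: "(m - k * m', n - k * n') \<in> S" if "(m, n) \<in> S" "(m', n') \<in> S" for m n m' n' k
  proof -
    let ?x = "?p m' n'"
    have x: "?x \<in> K" "\<phi> ?x = 0" using that by (auto simp: S_def)
    have "?x [^] j \<in> K \<and> \<phi> (?x [^] j) = 0" for j :: nat
      using x K additive_on_one[OF K] subgroup.one_closed[OF K(1)] subgroup.m_closed[OF K(1)]
      by (induction j) (auto simp: additive_on_def)
    then have "?x [^] j \<in> K \<and> \<phi> (?x [^] j) = 0" for j :: int
      unfolding int_pow_def2[of G ?x j]
      using additive_on_inv[OF K] subgroup.m_inv_closed[OF K(1)]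
      by (cases "j < 0") (simp_all only: if_True if_False minus_zero)
    then have "?p m n \<otimes> ?x [^] (-k) \<in> K \<and> \<phi> (?p m n \<otimes> ?x [^] (-k)) = 0"
      using that K subgroup.m_closed[OF K(1)] by (auto simp: S_def additive_on_def)
    moreover have "?p m n \<otimes> ?x [^] (-k) = ?p (m - k * m') (n - k * n')"
      unfolding bicyclic_pow[OF ab] bicyclic_mult[OF ab] by (simp add: mult.commute)
    ultimately show ?thesis by (simp add: S_def)
  qed
  have triv: "?p m 0 = \<one>" if "(m, 0) \<in> S" for m
    using that inj[of m] ab by (simp add: S_def)
  show ?thesis
  proof (cases "\<exists>m n. (m, n) \<in> S \<and> n > 0")
    case True
    then obtain m n where "(m, n) \<in> S" "n > 0" by blast
    then have "\<exists>k>0. \<exists>m. (m, int k) \<in> S" by (intro exI[of _ "nat n"]) auto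
    \<comment> \<open>The least positive second exponent divides all the others, so a kernel element
      differs from a power of the chosen one by a power of \<open>a\<close> alone, which is trivial
      by \<open>triv\<close>.\<close>
    define d where "d = (LEAST k. k > 0 \<and> (\<exists>m. (m, int k) \<in> S))"
    have d: "d > 0" "\<exists>m. (m, int d) \<in> S"
      using LeastI_ex[OF \<open>\<exists>k>0. \<exists>m. (m, int k) \<in> S\<close>] by (auto simp: d_def)
    then obtain m0 where m0: "(m0, int d) \<in> S" by blast
    have min: "\<not> (k > 0 \<and> (\<exists>m. (m, int k) \<in> S))" if "k < d" for k
      using not_less_Least that unfolding d_def by blast
    show ?thesis
    proof (rule that[of "?p m0 (int d)"])
      show "{x \<in> K. \<phi> x = 0 \<and> (\<exists>m n. x = ?p m n)} \<subseteq> range (\<lambda>n::int. ?p m0 (int d) [^] n)"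
      proof
        fix x assume "x \<in> {x \<in> K. \<phi> x = 0 \<and> (\<exists>m n. x = ?p m n)}"
        then obtain m n where x: "x = ?p m n" "(m, n) \<in> S" by (auto simp: S_def)
        define q where "q = n div int d"
        have nq: "n - q * int d = n mod int d" by (simp add: q_def minus_div_mult_eq_mod)
        have *: "(m - q * m0, n mod int d) \<in> S" using comb[OF x(2) m0, of q] nq by simp
        have "n mod int d = 0"
        proof (rule ccontr)
          assume "n mod int d \<noteq> 0"
          then have "nat (n mod int d) > 0" "nat (n mod int d) < d" "int (nat (n mod int d)) = n mod int d"
            using d(1) pos_mod_sign[of "int d" n] pos_mod_bound[of "int d" n] by linarith+
          then show False using min * by metis
        qed
        then have "?p (m - q * m0) 0 = \<one>" and n: "n = q * int d" using * triv nq by auto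
        then have "?p m n = ?p m0 (int d) [^] q"
          using bicyclic_mult[OF ab, of "m - q * m0" 0 "m0 * q" "int d * q"] ab
          unfolding bicyclic_pow[OF ab] by (simp add: mult.commute)
        then show "x \<in> range (\<lambda>n::int. ?p m0 (int d) [^] n)" using x by simp
      qed
    qed (use ab in simp)
  next
    case False
    have "x = \<one>" if x: "x \<in> K" "\<phi> x = 0" "x = ?p m n" for x m n
    proof -
      have S: "(m, n) \<in> S" using x by (simp add: S_def)
      \<comment> \<open>Subtracting the pair twice from itself gives its negative, so neither
        \<open>n\<close> nor \<open>-n\<close> is positive.\<close>
      have "(m - 2 * m, n - 2 * n) \<in> S" by (rule comb[OF S S])
      then have "\<not> n > 0" "\<not> n - 2 * n > 0" using S False by blast+
      then have "n = 0" by linarith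
      then show ?thesis using triv S x by simp
    qed
    then show ?thesis by (intro that[of \<one>]) auto
  qed
qed

text \<open>One character per rank: the first is injective on the powers of \<open>a\<close> in
  \<open>K\<close>, so its kernel inside \<open>B\<close> is contained in a cyclic group, and the
  second is chosen to be injective on that one.\<close>

lemma VRC_bicyclic:
  assumes V: "VRC G" and B: "bicyclic B"
  obtains K \<phi> \<phi>' where "finite_index_subgroup K G" "additive_on K \<phi>" "additive_on K \<phi>'"
    "\<And>x. x \<in> B \<Longrightarrow> x \<in> K \<Longrightarrow> \<phi> x = 0 \<Longrightarrow> \<phi>' x = 0 \<Longrightarrow> x = \<one>"
proof -
  obtain a b where ab: "a \<in> carrier G" "b \<in> carrier G" "a \<otimes> b = b \<otimes> a"
    and B_eq: "B = {a [^] m \<otimes> b [^] n | (m::int) (n::int). True}"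
    using B unfolding bicyclic_def by blast
  obtain K \<phi> where K: "finite_index_subgroup K G"
    "\<And>x y. x \<in> K \<Longrightarrow> y \<in> K \<Longrightarrow> \<phi> (x \<otimes> y) = \<phi> x + (\<phi> y :: int)"
    "\<And>n::int. a [^] n \<in> K \<Longrightarrow> \<phi> (a [^] n) = 0 \<Longrightarrow> a [^] n = \<one>"
    using VRC_hom_int[OF V ab(1)] by blast
  have KG: "subgroup K G" "additive_on K \<phi>"
    using K by (auto simp: finite_index_subgroup_def additive_on_def)
  obtain u where u: "u \<in> carrier G"
    "{x \<in> K. \<phi> x = 0 \<and> (\<exists>(m::int) (n::int). x = a [^] m \<otimes> b [^] n)} \<subseteq> range (\<lambda>n::int. u [^] n)"
    using bicyclic_character_kernel[OF ab KG K(3)] by blast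
  obtain L \<psi> where L: "finite_index_subgroup L G"
    "\<And>x y. x \<in> L \<Longrightarrow> y \<in> L \<Longrightarrow> \<psi> (x \<otimes> y) = \<psi> x + (\<psi> y :: int)"
    "\<And>n::int. u [^] n \<in> L \<Longrightarrow> \<psi> (u [^] n) = 0 \<Longrightarrow> u [^] n = \<one>"
    using VRC_hom_int[OF V u(1)] by blast
  show ?thesis
  proof (rule that[of "K \<inter> L" \<phi> \<psi>])
    show "finite_index_subgroup (K \<inter> L) G" using K L by (simp add: finite_index_Int)
    show "additive_on (K \<inter> L) \<phi>" "additive_on (K \<inter> L) \<psi>" using K L by (auto simp: additive_on_def)
    fix x assume x: "x \<in> B" "x \<in> K \<inter> L" "\<phi> x = 0" "\<psi> x = 0"
    then have "x \<in> range (\<lambda>n::int. u [^] n)" using u B_eq by blast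
    then show "x = \<one>" using x L(3) by auto
  qed
qed

text \<open>With \<open>\<rho>\<close> a retraction onto the cyclic subgroup \<open>C\<close>, the differences \<open>\<phi> - \<phi> \<circ> \<rho>\<close> vanish on \<open>C\<close>
  and detect everything in \<open>B\<close> outside \<open>C\<close>.\<close>

lemma VRC_separate_cyclic:
  assumes V: "VRC G" and B: "bicyclic B"
    and c: "c \<in> carrier G" and CB: "range (\<lambda>n::int. c [^] n) \<subseteq> B"
  obtains K \<psi> \<psi>' where "finite_index_subgroup K G" "additive_on K \<psi>" "additive_on K \<psi>'"
    "\<And>x. x \<in> B \<Longrightarrow> x \<in> K \<Longrightarrow> \<psi> x = 0 \<and> \<psi>' x = 0 \<longleftrightarrow> x \<in> range (\<lambda>n::int. c [^] n)"
proof -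
  let ?C = "range (\<lambda>n::int. c [^] n)"
  obtain K \<phi> \<phi>' where K: "finite_index_subgroup K G" and \<phi>: "additive_on K \<phi>" "additive_on K \<phi>'"
    and inj: "\<And>x. x \<in> B \<Longrightarrow> x \<in> K \<Longrightarrow> \<phi> x = 0 \<Longrightarrow> \<phi>' x = 0 \<Longrightarrow> x = \<one>"
    using VRC_bicyclic[OF V B] by blast
  obtain L \<rho> where L: "finite_index_subgroup L G" "?C \<subseteq> L" "\<And>x. x \<in> L \<Longrightarrow> \<rho> x \<in> ?C"
    "\<And>x y. x \<in> L \<Longrightarrow> y \<in> L \<Longrightarrow> \<rho> (x \<otimes> y) = \<rho> x \<otimes> \<rho> y" "\<And>x. x \<in> ?C \<Longrightarrow> \<rho> x = x"
    using VRC_retraction[OF V c] by blast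
  have KG: "subgroup K G" using K by (simp add: finite_index_subgroup_def)
  have CG: "subgroup ?C G" using cyclic_subgroup_range[OF c] by simp
  have BG: "subgroup B G" using B by (rule bicyclic_subgroup)
  \<comment> \<open>\<open>\<phi> \<circ> \<rho>\<close> is additive where \<rho> lands in
    \<open>K\<close>; by \<open>finite_index_preimage\<close> this restriction keeps the index
    finite.\<close>
  define M where "M = K \<inter> {x \<in> L. \<rho> x \<in> K}"
  have "finite_index_subgroup {x \<in> L. \<rho> x \<in> K} G"
  proof (rule finite_index_preimage[OF L(1) CG L(2) L(3,4) KG])
    show "finite ((\<lambda>x. K #> x) ` ?C)"
      using finite_index_rcos(1)[OF K] subgroup.subset[OF CG] by (meson finite_subset image_mono)
    show "x \<otimes> inv y \<in> K" if "x \<in> ?C" "y \<in> ?C" "K #> x = K #> y" for x y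
      using finite_index_rcos(2)[OF K _ _ that(3)] that(1,2) subgroup.mem_carrier[OF CG] by blast
  qed
  then have M: "finite_index_subgroup M G"
    unfolding M_def using K by (rule finite_index_Int[rotated])
  have add: "additive_on M (\<lambda>x. \<chi> x - \<chi> (\<rho> x))" if "additive_on K \<chi>" for \<chi>
    using that by (auto simp: additive_on_def M_def L(4))
  show ?thesis
  proof (rule that[OF M add[OF \<phi>(1)] add[OF \<phi>(2)]])
    fix x assume x: "x \<in> B" "x \<in> M"
    have xG: "x \<in> carrier G" "\<rho> x \<in> carrier G" "\<rho> x \<in> K" "x \<in> K" "\<rho> x \<in> ?C"
      using x L(3) subgroup.mem_carrier[OF KG] by (auto simp: M_def)
    show "\<phi> x - \<phi> (\<rho> x) = 0 \<and> \<phi>' x - \<phi>' (\<rho> x) = 0 \<longleftrightarrow> x \<in> ?C"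
    proof
      assume eq: "\<phi> x - \<phi> (\<rho> x) = 0 \<and> \<phi>' x - \<phi>' (\<rho> x) = 0"
      have "\<chi> (x \<otimes> inv (\<rho> x)) = \<chi> x - \<chi> (\<rho> x)" if "additive_on K \<chi>" for \<chi>
        using that xG additive_on_inv[OF KG that] subgroup.m_inv_closed[OF KG]
        by (simp add: additive_on_def)
      \<comment> \<open>The quotient lies in \<open>B\<close> because \<open>C\<close> does, and
        both characters vanish on it.\<close>
      then have "x \<otimes> inv (\<rho> x) = \<one>"
        using eq \<phi> x xG CB KG BG
        by (intro inj) (auto simp: subgroup.m_closed subgroup.m_inv_closed subset_iff)
      then have "x = \<rho> x" using xG by (metis inv_closed inv_equality inv_inv)
      then show "x \<in> ?C" using xG by simp
    qed (simp add: L(5))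
  qed
qed

text \<open>The condition is invariant under conjugation, so that it serves all the conjugates of the
  subgroups in \<open>\<L>\<close> at once: only finitely many conjugates of each character occur.\<close>

theorem VRC_separating_characters:
  assumes V: "VRC G" and fin: "finite \<L>"
    and \<L>: "\<And>B C. (B, C) \<in> \<L> \<Longrightarrow> bicyclic B \<and> C \<subseteq> B \<and> (\<exists>c\<in>carrier G. C = range (\<lambda>n::int. c [^] n))"
  obtains K \<psi> and N :: nat where "finite_index_subgroup K G" "\<And>i. i < N \<Longrightarrow> additive_on K (\<psi> i)"
    "\<And>B C g x. (B, C) \<in> \<L> \<Longrightarrow> g \<in> carrier G \<Longrightarrow> x \<in> K \<Longrightarrow> g \<otimes> x \<otimes> inv g \<in> B \<Longrightarrow>
       (\<And>i. i < N \<Longrightarrow> (\<And>y. y \<in> K \<Longrightarrow> g \<otimes> y \<otimes> inv g \<in> C \<Longrightarrow> \<psi> i y = 0) \<Longrightarrow> \<psi> i x = 0) \<Longrightarrow>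
       g \<otimes> x \<otimes> inv g \<in> C"
proof -
  define sep where "sep l K \<chi> \<longleftrightarrow> finite_index_subgroup K G \<and>
      (\<forall>b::bool. additive_on K (\<chi> b)) \<and> (\<forall>x\<in>fst l \<inter> K. (\<forall>b. \<chi> b x = 0) \<longleftrightarrow> x \<in> snd l)" for l K \<chi>
  have "\<exists>K \<chi>. sep l K \<chi>" if "l \<in> \<L>" for l
  proof -
    obtain B C where l: "l = (B, C)" by (cases l)
    with \<L> that obtain c where c: "bicyclic B" "C \<subseteq> B" "c \<in> carrier G" "C = range (\<lambda>n::int. c [^] n)"
      by metis
    from c(2) have "range (\<lambda>n::int. c [^] n) \<subseteq> B" unfolding c(4) .
    from VRC_separate_cyclic[OF V c(1,3) this, folded c(4)]
    obtain K \<psi> \<psi>' where "finite_index_subgroup K G" "additive_on K \<psi>" "additive_on K \<psi>'"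
      "\<And>x. x \<in> B \<Longrightarrow> x \<in> K \<Longrightarrow> \<psi> x = 0 \<and> \<psi>' x = 0 \<longleftrightarrow> x \<in> C"
      by metis
    then have "sep l K (\<lambda>b. if b then \<psi> else \<psi>')" by (auto simp: sep_def l all_bool_eq)
    then show ?thesis by blast
  qed
  then obtain KK \<chi> where sep: "\<And>l. l \<in> \<L> \<Longrightarrow> sep l (KK l) (\<chi> l)" by metis
  have "finite_index_subgroup (carrier G \<inter> (\<Inter>l\<in>\<L>. KK l)) G"
    using fin sep by (intro finite_index_INT) (auto simp: sep_def)
  \<comment> \<open>Normality of \<open>K\<close> makes a character composed with conjugation by any
    \<open>g\<close> a character of \<open>K\<close> again.\<close>
  then obtain K where K: "finite_index_subgroup K G" "K \<subseteq> carrier G \<inter> (\<Inter>l\<in>\<L>. KK l)"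
    and conj: "\<And>g x. g \<in> carrier G \<Longrightarrow> x \<in> K \<Longrightarrow> g \<otimes> x \<otimes> inv g \<in> K"
    using finite_index_normal_core by metis
  have KG: "subgroup K G" using K by (simp add: finite_index_subgroup_def)
  \<comment> \<open>The value 0 outside \<open>K\<close> makes conjugates that agree on
    \<open>K\<close> equal as functions, so that they can be counted.\<close>
  define \<theta> where "\<theta> l b g x = (if x \<in> K then \<chi> l b (g \<otimes> x \<otimes> inv g) else 0)" for l b g x
  have add\<chi>: "additive_on K (\<chi> l b)" if "l \<in> \<L>" for l b
  proof (rule additive_on_subset)
    show "additive_on (KK l) (\<chi> l b)" using sep[OF that] by (simp add: sep_def)
    show "K \<subseteq> KK l" using K(2) that by blast
  qed
  have add\<theta>: "additive_on K (\<theta> l b g)" if "l \<in> \<L>" "g \<in> carrier G" for l b g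
    unfolding additive_on_def
  proof (intro ballI)
    fix x y assume xy: "x \<in> K" "y \<in> K"
    then have xyG: "x \<in> carrier G" "y \<in> carrier G" using subgroup.mem_carrier[OF KG] by auto
    have "g \<otimes> (x \<otimes> y) \<otimes> inv g = (g \<otimes> x \<otimes> inv g) \<otimes> (g \<otimes> y \<otimes> inv g)"
      using xyG that(2) by (simp add: m_assoc) (simp flip: m_assoc)
    then show "\<theta> l b g (x \<otimes> y) = \<theta> l b g x + \<theta> l b g y"
      using add\<chi>[OF that(1)] conj that xy subgroup.m_closed[OF KG]
      by (simp add: \<theta>_def additive_on_def)
  qed
  \<comment> \<open>A map into an abelian group does not see conjugation inside \<open>K\<close>, so
    a conjugate character depends only on the coset of \<open>g\<close>.\<close>
  have \<theta>_coset: "\<theta> l b g = \<theta> l b h" if lgh: "l \<in> \<L>" "g \<in> carrier G" "h \<in> carrier G" "K #> g = K #> h" for l b g h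
  proof
    fix x
    show "\<theta> l b g x = \<theta> l b h x"
    proof (cases "x \<in> K")
      case True
      let ?k = "g \<otimes> inv h" and ?y = "h \<otimes> x \<otimes> inv h"
      have k: "?k \<in> K" using finite_index_rcos(2)[OF K(1) lgh(2,3,4)] .
      have y: "?y \<in> K" using conj True lgh by blast
      have xG: "x \<in> carrier G" using True subgroup.mem_carrier[OF KG] by auto
      have "g \<otimes> x \<otimes> inv g = ?k \<otimes> (?y \<otimes> inv ?k)"
        using xG lgh by (simp add: inv_mult_group m_assoc) (simp flip: m_assoc)
      then have "\<chi> l b (g \<otimes> x \<otimes> inv g) = \<chi> l b ?y"
        using add\<chi>[OF lgh(1)] k y additive_on_inv[OF KG add\<chi>[OF lgh(1)] k]
          subgroup.m_closed[OF KG] subgroup.m_inv_closed[OF KG]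
        by (simp add: additive_on_def)
      then show ?thesis using True by (simp add: \<theta>_def)
    qed (simp add: \<theta>_def)
  qed
  define F where "F = (\<Union>l\<in>\<L>. \<Union>b. \<theta> l b ` carrier G)"
  have "finite (\<theta> l b ` carrier G)" if "l \<in> \<L>" for l b
  proof -
    define s where "s C = (SOME g. g \<in> carrier G \<and> K #> g = C)" for C
    have "\<theta> l b g = \<theta> l b (s (K #> g))" if "g \<in> carrier G" for g
    proof -
      have "s (K #> g) \<in> carrier G \<and> K #> s (K #> g) = K #> g"
        unfolding s_def by (rule someI[of _ g]) (use that in simp)
      then show ?thesis using \<theta>_coset[OF \<open>l \<in> \<L>\<close> that] by simp
    qed
    then have "\<theta> l b ` carrier G \<subseteq> (\<lambda>C. \<theta> l b (s C)) ` ((\<lambda>g. K #> g) ` carrier G)" by auto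
    then show ?thesis using finite_index_rcos(1)[OF K(1)] finite_subset by blast
  qed
  then have "finite F" using fin by (auto simp: F_def)
  then obtain N and \<psi> :: "nat \<Rightarrow> 'a \<Rightarrow> int" where F: "F = \<psi> ` {i. i < N}"
    using finite_imp_nat_seg_image_inj_on by blast
  show ?thesis
  proof (rule that[OF K(1), of N \<psi>])
    fix i assume "i < N"
    then have "\<psi> i \<in> F" using F by blast
    then show "additive_on K (\<psi> i)" using add\<theta> by (auto simp: F_def)
  next
    fix B C g x
    assume BC: "(B, C) \<in> \<L>" and g: "g \<in> carrier G" and x: "x \<in> K" "g \<otimes> x \<otimes> inv g \<in> B"
      and vanish: "\<And>i. i < N \<Longrightarrow> (\<And>y. y \<in> K \<Longrightarrow> g \<otimes> y \<otimes> inv g \<in> C \<Longrightarrow> \<psi> i y = 0) \<Longrightarrow> \<psi> i x = 0"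
    have sepBC: "(\<forall>b. \<chi> (B, C) b z = 0) \<longleftrightarrow> z \<in> C" if "z \<in> B" "z \<in> K" for z
    proof -
      have "z \<in> fst (B, C) \<inter> KK (B, C)" using that K(2) BC by auto
      then show ?thesis using sep[OF BC] unfolding sep_def by (metis snd_conv)
    qed
    have "\<chi> (B, C) b (g \<otimes> x \<otimes> inv g) = 0" for b
    proof -
      have "\<theta> (B, C) b g \<in> F" using BC g by (auto simp: F_def)
      then obtain i where i: "i < N" "\<psi> i = \<theta> (B, C) b g" using F by auto
      \<comment> \<open>The conjugate by this very \<open>g\<close> is one of the listed characters,
        and it vanishes on whatever \<open>g\<close> conjugates into \<open>C\<close>; so the
        hypothesis on \<open>x\<close> applies to it.\<close>
      have "\<psi> i y = 0" if "y \<in> K" "g \<otimes> y \<otimes> inv g \<in> C" for y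
        using that sepBC[of "g \<otimes> y \<otimes> inv g"] conj[OF g] \<L>[OF BC] i by (auto simp: \<theta>_def)
      then have "\<psi> i x = 0" using vanish i by blast
      then show ?thesis using i x by (simp add: \<theta>_def)
    qed
    then show "g \<otimes> x \<otimes> inv g \<in> C" using sepBC x conj[OF g] by blast
  qed
qed

end

lemma hom_image_cyclic:
  assumes "group A" "group G" "cyclic_group A" "h \<in> hom A G"
  shows "\<exists>c\<in>carrier G. h ` carrier A = range (\<lambda>n::int. c [^]\<^bsub>G\<^esub> n)"
proof -
  interpret h: group_hom A G h using assms by (simp add: group_hom_def group_hom_axioms_def)
  obtain x where x: "x \<in> carrier A" "carrier A = range (\<lambda>n::int. x [^]\<^bsub>A\<^esub> n)"
    using assms(3) h.G.cyclic_group by blast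
  have "h ` carrier A = range (\<lambda>n::int. h x [^]\<^bsub>G\<^esub> n)"
    unfolding x(2) image_image using x(1) by (simp add: h.hom_int_pow)
  then show ?thesis using x(1) h.hom_closed by blast
qed

section \<open>Reduced words\<close>

abbreviation flip :: "'s \<times> bool \<Rightarrow> 's \<times> bool" where
  "flip l \<equiv> (fst l, \<not> snd l)"

definition reduced :: "('s \<times> bool) list \<Rightarrow> bool" where
  "reduced = successively (\<lambda>l m. m \<noteq> flip l)"

lemma reduced_Nil [simp]: "reduced []"
  and reduced_single [simp]: "reduced [l]"
  and reduced_Cons_Cons [simp]: "reduced (l # m # w) \<longleftrightarrow> m \<noteq> flip l \<and> reduced (m # w)"
  by (simp_all add: reduced_def)

lemma reduced_Cons: "reduced (l # w) \<longleftrightarrow> w = [] \<or> hd w \<noteq> flip l \<and> reduced w"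
  by (cases w) auto

text \<open>Left multiplication in the free group; off the reduced words it is the identity, so that it is
  a bijection of all words.\<close>

definition lmul :: "'s \<times> bool \<Rightarrow> ('s \<times> bool) list \<Rightarrow> ('s \<times> bool) list" where
  "lmul l w = (if \<not> reduced w then w else if w \<noteq> [] \<and> hd w = flip l then tl w else l # w)"

lemma lmul_flip: "lmul (flip l) (lmul l w) = w"
proof (cases "reduced w")
  case True
  then show ?thesis
    by (cases w; cases "tl w") (auto simp: lmul_def reduced_Cons prod_eq_iff)
qed (simp add: lmul_def)

lemma lmul_Cons: "reduced (l # w) \<Longrightarrow> lmul l w = l # w"
  by (auto simp: lmul_def reduced_Cons)

lemma bij_lmul: "bij (lmul l)"
proof (rule o_bij)
  show "lmul (flip l) \<circ> lmul l = id" by (auto simp: lmul_flip)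
  have "lmul (flip (flip l)) (lmul (flip l) w) = w" for w by (rule lmul_flip)
  then show "lmul l \<circ> lmul (flip l) = id" by (auto simp: fun_eq_iff)
qed

lemma BijGroup_UNIV:
  "carrier (BijGroup UNIV) = {f. bij f}"
  "bij f \<Longrightarrow> bij g \<Longrightarrow> f \<otimes>\<^bsub>BijGroup UNIV\<^esub> g = f \<circ> g"
  "\<one>\<^bsub>BijGroup UNIV\<^esub> = id"
  by (auto simp: BijGroup_def Bij_def compose_def fun_eq_iff)

lemma inv_BijGroup_UNIV:
  assumes "f \<circ> g = id" "g \<circ> f = id"
  shows "inv\<^bsub>BijGroup UNIV\<^esub> f = g"
proof (rule group.inv_equality[OF group_BijGroup])
  have "bij f" "bij g" using assms by (auto intro: o_bij)
  then show "g \<otimes>\<^bsub>BijGroup UNIV\<^esub> f = \<one>\<^bsub>BijGroup UNIV\<^esub>"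
    "f \<in> carrier (BijGroup UNIV)" "g \<in> carrier (BijGroup UNIV)"
    using assms by (simp_all add: BijGroup_UNIV)
qed

lemma inv_lmul: "inv\<^bsub>BijGroup UNIV\<^esub> (lmul l) = lmul (flip l)"
  using lmul_flip[of "flip l"] by (intro inv_BijGroup_UNIV) (auto simp: fun_eq_iff lmul_flip)

lemma lmul_map:
  assumes "inj f" "\<And>l. f (flip l) = flip (f l)"
  shows "lmul (f l) (map f w) = map f (lmul l w)"
proof -
  have eq: "f m = flip (f l) \<longleftrightarrow> m = flip l" for l m
    using assms by (metis injD)
  have red: "reduced (map f w) \<longleftrightarrow> reduced w" for w
    by (induction w rule: induct_list012) (simp_all add: eq)
  show ?thesis
  proof (cases w)
    case (Cons m u)
    then show ?thesis
      using red[of w] eq[of m l] by (simp add: lmul_def)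
  qed (simp add: lmul_def)
qed

section \<open>Monomials in commuting elements\<close>

primrec monomial :: "('a, 'm) monoid_scheme \<Rightarrow> (nat \<Rightarrow> 'a) \<Rightarrow> (nat \<Rightarrow> int) \<Rightarrow> nat \<Rightarrow> 'a" where
  "monomial G x v 0 = \<one>\<^bsub>G\<^esub>"
| "monomial G x v (Suc n) = monomial G x v n \<otimes>\<^bsub>G\<^esub> x n [^]\<^bsub>G\<^esub> v n"

context group
begin

lemma monomial_closed [simp]:
  "(\<And>i. i < n \<Longrightarrow> x i \<in> carrier G) \<Longrightarrow> monomial G x v n \<in> carrier G"
  by (induction n) auto

lemma monomial_zero:
  "(\<And>i. i < n \<Longrightarrow> v i = 0) \<Longrightarrow> monomial G x v n = \<one>"
  by (induction n) auto

text \<open>Generators with exponent zero are exempt from commuting. This is how the edges of the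
  Artin group are matched with the values of the characters.\<close>

lemma monomial_commute:
  assumes "y \<in> carrier G" "\<And>i. i < n \<Longrightarrow> x i \<in> carrier G"
    "\<And>i. i < n \<Longrightarrow> v i = 0 \<or> y \<otimes> x i = x i \<otimes> y"
  shows "y \<otimes> monomial G x v n = monomial G x v n \<otimes> y"
  using assms
proof (induction n)
  case (Suc n)
  have "y \<otimes> x n [^] v n = x n [^] v n \<otimes> y"
    using Suc.prems(1) Suc.prems(2,3)[of n] by (cases "v n = 0") (auto intro: commute_int_pow)
  then show ?case using Suc by (simp add: commute_mult)
qed simp

lemma monomial_add:
  assumes "\<And>i. i < n \<Longrightarrow> x i \<in> carrier G"
    "\<And>i j. i < n \<Longrightarrow> j < n \<Longrightarrow> x i \<otimes> x j = x j \<otimes> x i"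
  shows "monomial G x (\<lambda>i. v i + w i) n = monomial G x v n \<otimes> monomial G x w n"
  using assms
proof (induction n)
  case (Suc n)
  let ?v = "monomial G x v n" and ?w = "monomial G x w n" and ?a = "x n [^] v n" and ?b = "x n [^] w n"
  have cl: "?v \<in> carrier G" "?w \<in> carrier G" "?a \<in> carrier G" "?b \<in> carrier G" using Suc.prems by auto
  have xw: "?w \<otimes> x n = x n \<otimes> ?w"
    using Suc.prems by (intro monomial_commute[symmetric]) auto
  have aw: "?w \<otimes> ?a = ?a \<otimes> ?w"
    using cl Suc.prems(1) xw by (intro commute_int_pow) auto
  have "monomial G x (\<lambda>i. v i + w i) (Suc n) = (?v \<otimes> ?w) \<otimes> (?a \<otimes> ?b)"
    using Suc by (simp add: int_pow_mult)
  also have "\<dots> = ?v \<otimes> (?w \<otimes> ?a) \<otimes> ?b" using cl by (simp add: m_assoc)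
  also have "\<dots> = (?v \<otimes> ?a) \<otimes> (?w \<otimes> ?b)" unfolding aw using cl by (simp add: m_assoc)
  finally show ?case by simp
qed simp

end

lemma hom_monomial:
  assumes "group G" "group H" "h \<in> hom G H" "\<And>i. i < n \<Longrightarrow> x i \<in> carrier G"
  shows "h (monomial G x v n) = monomial H (\<lambda>i. h (x i)) v n"
proof -
  interpret group_hom G H h using assms by (simp add: group_hom_def group_hom_axioms_def)
  show ?thesis using assms(4) by (induction n) (auto simp: hom_int_pow)
qed

lemma monomial_cong:
  "(\<And>i. i < n \<Longrightarrow> x i = y i) \<Longrightarrow> monomial G x v n = monomial G y v n"
  by (induction n) auto

lemma monomial_exponent_cong:
  "(\<And>i. i < n \<Longrightarrow> v i = w i) \<Longrightarrow> monomial G x v n = monomial G x w n"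
  by (induction n) auto

lemma monomial_integer_group:
  "monomial integer_group x v n = (\<Sum>i<n. v i * x i)"
  by (induction n) simp_all

section \<open>A family of right angled Artin groups\<close>

text \<open>\<open>Q j\<close> is the set of vertices of the clique \<open>{..<n}\<close> that are not joined to \<open>j \<ge> n\<close>.\<close>

definition split_graph :: "nat \<Rightarrow> nat \<Rightarrow> (nat \<Rightarrow> nat set) \<Rightarrow> (nat, nat \<times> nat) pre_digraph" where
  "split_graph n m Q = \<lparr>verts = {..<n + m},
     arcs = {(i, j). i < n + m \<and> j < n + m \<and> i \<noteq> j \<and>
       (i < n \<and> j < n \<or> i < n \<and> n \<le> j \<and> i \<notin> Q j \<or> j < n \<and> n \<le> i \<and> j \<notin> Q i)},
     tail = fst, head = snd\<rparr>"

lemma graph_split_graph: "graph (split_graph n m Q)"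
proof -
  let ?D = "split_graph n m Q"
  have ends: "arcs_ends ?D = arcs ?D"
    by (simp add: arcs_ends_conv split_graph_def)
  have arcs: "i < n + m \<and> j < n + m \<and> i \<noteq> j \<and> (j, i) \<in> arcs ?D" if "(i, j) \<in> arcs ?D" for i j
    using that by (auto simp: split_graph_def)
  have "finite (arcs ?D)"
    by (rule finite_subset[of _ "{..<n + m} \<times> {..<n + m}"]) (use arcs in auto)
  moreover have "symmetric ?D"
    unfolding symmetric_def Relation.sym_def ends using arcs by blast
  moreover have "verts ?D = {..<n + m}" "tail ?D = fst" "head ?D = snd"
    by (simp_all add: split_graph_def)
  ultimately show ?thesis
    using arcs by unfold_locales (auto simp: arc_to_ends_def)
qed

text \<open>A letter \<open>((j, z), b)\<close> stands for the generator \<open>j\<close>, or its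
  inverse, conjugated by the monomial with exponents \<open>z\<close>, which stands on the left and
  its inverse on the right. Conjugation by a further monomial adds exponents; those outside
  \<open>Q j\<close> belong to generators that commute with \<open>j\<close> and leave no
  trace.\<close>

definition shift :: "(nat \<Rightarrow> nat set) \<Rightarrow> (nat \<Rightarrow> int) \<Rightarrow> (nat \<times> (nat \<Rightarrow> int)) \<times> bool \<Rightarrow> (nat \<times> (nat \<Rightarrow> int)) \<times> bool" where
  "shift Q v = (\<lambda>((j, z), b). ((j, \<lambda>i. if i \<in> Q j then z i + v i else z i), b))"

lemma shift_flip: "shift Q v (flip l) = flip (shift Q v l)"
  by (simp add: shift_def split: prod.split)

lemma shift_shift: "shift Q v (shift Q w l) = shift Q (\<lambda>i. v i + w i) l"
  by (auto simp: shift_def fun_eq_iff split: prod.split)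

lemma shift_zero: "shift Q (\<lambda>_. 0) = id"
  by (auto simp: shift_def fun_eq_iff)

lemma bij_map_shift: "bij (map (shift Q v))"
  and inj_shift: "inj (shift Q v)"
  and inv_map_shift: "inv\<^bsub>BijGroup UNIV\<^esub> (map (shift Q v)) = map (shift Q (\<lambda>i. - v i))"
proof -
  have *: "shift Q v \<circ> shift Q (\<lambda>i. - v i) = id" "shift Q (\<lambda>i. - v i) \<circ> shift Q v = id"
    by (auto simp: shift_shift shift_zero[unfolded fun_eq_iff])
  have "shift Q (\<lambda>i. - v i) (shift Q v l) = l" for l
    using fun_cong[OF *(2), of l] by simp
  then show "inj (shift Q v)" by (rule inj_on_inverseI)
  have m: "map (shift Q v) \<circ> map (shift Q (\<lambda>i. - v i)) = id"
    "map (shift Q (\<lambda>i. - v i)) \<circ> map (shift Q v) = id"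
    by (simp_all only: map_comp_map * list.map_id0)
  show "bij (map (shift Q v))" using m by (intro o_bij)
  show "inv\<^bsub>BijGroup UNIV\<^esub> (map (shift Q v)) = map (shift Q (\<lambda>i. - v i))"
    using m by (rule inv_BijGroup_UNIV)
qed

lemma lmul_map_shift: "lmul (shift Q v l) (map (shift Q v) w) = map (shift Q v) (lmul l w)"
proof (rule lmul_map)
  show "inj (shift Q v)" by (rule inj_shift)
  show "shift Q v (flip l) = flip (shift Q v l)" for l by (rule shift_flip)
qed

lemma map_shift_mult:
  "map (shift Q u) \<otimes>\<^bsub>BijGroup UNIV\<^esub> map (shift Q w) = map (shift Q (\<lambda>i. u i + w i))"
proof -
  have "shift Q u \<circ> shift Q w = shift Q (\<lambda>i. u i + w i)"
    by (simp add: fun_eq_iff shift_shift)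
  then show ?thesis
    by (simp only: BijGroup_UNIV bij_map_shift map_comp_map)
qed

lemma map_shift_int_pow:
  "map (shift Q v) [^]\<^bsub>BijGroup UNIV\<^esub> (k::int) = map (shift Q (\<lambda>i. k * v i))"
proof -
  let ?W = "BijGroup (UNIV :: ((nat \<times> (nat \<Rightarrow> int)) \<times> bool) list set)"
  interpret W: group ?W by (rule group_BijGroup)
  have nat: "map (shift Q v) [^]\<^bsub>?W\<^esub> (i::nat) = map (shift Q (\<lambda>j. int i * v j))" for i
  proof (induction i)
    case (Suc i)
    have "(\<lambda>j. int i * v j + v j) = (\<lambda>j. int (Suc i) * v j)" by (simp add: algebra_simps)
    then show ?case by (simp only: W.nat_pow_Suc Suc map_shift_mult)
  qed (simp add: BijGroup_UNIV shift_zero)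
  show ?thesis
    unfolding int_pow_def2 nat inv_map_shift by simp
qed

locale split_raag =
  fixes n m :: nat and Q :: "nat \<Rightarrow> nat set"
begin

abbreviation R :: "nat word set monoid" where "R \<equiv> raag (split_graph n m Q)"

definition x :: "nat \<Rightarrow> nat word set" where
  "x = pres_gen (verts (split_graph n m Q))
     {(gen u @ gen v, gen v @ gen u) | u v. (u, v) \<in> arcs_ends (split_graph n m Q)}"

sublocale R: group R
  unfolding raag_def by (rule group_presented_group)

lemma x_closed [simp]: "i < n + m \<Longrightarrow> x i \<in> carrier R"
  unfolding x_def raag_def
  using pres_gen_closed by (force simp: split_graph_def)

lemma x_commute:
  assumes "(i, j) \<in> arcs (split_graph n m Q)"
  shows "x i \<otimes>\<^bsub>R\<^esub> x j = x j \<otimes>\<^bsub>R\<^esub> x i"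
proof -
  let ?V = "verts (split_graph n m Q)"
    and ?E = "{(gen u @ gen v, gen v @ gen u) | u v. (u, v) \<in> arcs_ends (split_graph n m Q)}"
  have ij: "i < n + m" "j < n + m" using assms by (auto simp: split_graph_def)
  have "(gen i @ gen j, gen j @ gen i) \<in> ?E"
    using assms by (force simp: arcs_ends_conv split_graph_def)
  then have "word_eval R x (gen i @ gen j) = word_eval R x (gen j @ gen i)"
    unfolding x_def raag_def by (rule presented_group_rel) (use ij in \<open>auto simp: split_graph_def\<close>)
  then show ?thesis using ij by simp
qed

lemma lift:
  assumes W: "group W" and f: "\<And>i. i < n + m \<Longrightarrow> f i \<in> carrier W"
    and comm: "\<And>i j. (i, j) \<in> arcs (split_graph n m Q) \<Longrightarrow> f i \<otimes>\<^bsub>W\<^esub> f j = f j \<otimes>\<^bsub>W\<^esub> f i"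
  obtains h where "h \<in> hom R W" "\<And>i. i < n + m \<Longrightarrow> h (x i) = f i"
proof -
  interpret W: group W by (rule W)
  let ?V = "verts (split_graph n m Q)"
    and ?E = "{(gen u @ gen v, gen v @ gen u) | u v. (u, v) \<in> arcs_ends (split_graph n m Q)}"
  have fV: "f \<in> ?V \<rightarrow> carrier W" using f by (auto simp: split_graph_def)
  obtain h where h: "h \<in> hom (presented_group ?V ?E) W"
    "\<And>w. w \<in> words ?V \<Longrightarrow> h (pres_rel ?V ?E `` {w}) = word_eval W f w"
  proof (rule W.presented_group_lift[OF fV, of ?E])
    fix u v assume "(u, v) \<in> ?E"
    then obtain i j where "u = gen i @ gen j" "v = gen j @ gen i" "(i, j) \<in> arcs (split_graph n m Q)"
      by (auto simp: arcs_ends_conv split_graph_def)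
    moreover from this have "f i \<in> carrier W" "f j \<in> carrier W" using f by (auto simp: split_graph_def)
    ultimately show "word_eval W f u = word_eval W f v" using comm by simp
  qed blast
  show ?thesis
  proof (rule that)
    show "h \<in> hom R W" using h by (simp add: raag_def)
    show "h (x i) = f i" if "i < n + m" for i
      using h(2)[of "gen i"] that f[OF that] by (simp add: x_def pres_gen_def split_graph_def)
  qed
qed

lemma exponent_hom:
  assumes "i < n"
  obtains h where "h \<in> hom R integer_group" "\<And>j. j < n + m \<Longrightarrow> h (x j) = (if j = i then 1 else 0)"
  by (rule lift[of integer_group "\<lambda>j. if j = i then 1 else 0"]) auto

text \<open>The action on the free group with basis \<open>(j, z)\<close>, where \<open>z\<close> is supported on \<open>Q j\<close>.\<close>

lemma word_action:
  obtains h where "h \<in> hom R (BijGroup UNIV)"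
    "\<And>i. i < n \<Longrightarrow> h (x i) = map (shift Q (\<lambda>k. of_bool (k = i)))"
    "\<And>j. n \<le> j \<Longrightarrow> j < n + m \<Longrightarrow> h (x j) = lmul ((j, \<lambda>_. 0), True)"
proof -
  define f where "f i = (if i < n then map (shift Q (\<lambda>k. of_bool (k = i))) else lmul ((i, \<lambda>_. 0), True))" for i
  have bij: "bij (f i)" for i by (simp add: f_def bij_map_shift bij_lmul)
  have fX: "f i = map (shift Q (\<lambda>k. of_bool (k = i)))" if "i < n" for i
    using that by (simp add: f_def)
  have fT: "f j = lmul ((j, \<lambda>_. 0), True)" if "n \<le> j" for j
    using that by (simp add: f_def)
  have comm1: "f i \<circ> f j = f j \<circ> f i" if "i < n" "n \<le> j" "i \<notin> Q j" for i j
  proof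
    fix w
    let ?\<sigma> = "shift Q (\<lambda>k. of_bool (k = i))" and ?l = "((j, \<lambda>_. 0 :: int), True)"
    \<comment> \<open>As \<open>i\<close> lies outside \<open>Q j\<close>, the shift by
      \<open>i\<close> fixes the letter of \<open>j\<close>, and this is the required
      commutation.\<close>
    have "(\<lambda>k. if k \<in> Q j then 0 + of_bool (k = i) else 0) = (\<lambda>_. 0 :: int)"
      using that(3) by (intro ext) auto
    then have l: "?\<sigma> ?l = ?l" by (simp only: shift_def prod.case)
    have "lmul (?\<sigma> ?l) (map ?\<sigma> w) = map ?\<sigma> (lmul ?l w)"
      by (rule lmul_map_shift)
    then have "map ?\<sigma> (lmul ?l w) = lmul ?l (map ?\<sigma> w)" by (simp only: l)
    then show "(f i \<circ> f j) w = (f j \<circ> f i) w"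
      by (simp only: o_apply fX[OF that(1)] fT[OF that(2)])
  qed
  have comm2: "f i \<circ> f j = f j \<circ> f i" if "i < n" "j < n" for i j
  proof -
    let ?u = "\<lambda>k. of_bool (k = i) :: int" and ?v = "\<lambda>k. of_bool (k = j) :: int"
    have "shift Q ?u \<circ> shift Q ?v = shift Q ?v \<circ> shift Q ?u"
      by (rule ext) (simp add: shift_shift add.commute)
    then show ?thesis by (simp only: fX[OF that(1)] fX[OF that(2)] map_comp_map)
  qed
  obtain h where h: "h \<in> hom R (BijGroup UNIV)" "\<And>i. i < n + m \<Longrightarrow> h (x i) = f i"
  proof (rule lift[of "BijGroup UNIV" f])
    fix i j assume "(i, j) \<in> arcs (split_graph n m Q)"
    then consider "i < n" "j < n" | "i < n" "n \<le> j" "i \<notin> Q j" | "j < n" "n \<le> i" "j \<notin> Q i"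
      by (auto simp: split_graph_def)
    then have "f i \<circ> f j = f j \<circ> f i"
    proof cases
      case 3
      show ?thesis by (rule comm1[OF 3, symmetric])
    qed (rule comm2 comm1; assumption)+
    then show "f i \<otimes>\<^bsub>BijGroup UNIV\<^esub> f j = f j \<otimes>\<^bsub>BijGroup UNIV\<^esub> f i"
      by (simp only: BijGroup_UNIV bij)
  next
    show "group (BijGroup (UNIV :: ((nat \<times> (nat \<Rightarrow> int)) \<times> bool) list set))" by (rule group_BijGroup)
    show "f i \<in> carrier (BijGroup UNIV)" for i using bij by (simp add: BijGroup_UNIV)
  qed blast
  show ?thesis
  proof (rule that[OF h(1)])
    show "h (x i) = map (shift Q (\<lambda>k. of_bool (k = i)))" if "i < n" for i
      using h(2)[of i] that by (simp add: f_def)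
    show "h (x j) = lmul ((j, \<lambda>_. 0), True)" if "n \<le> j" "j < n + m" for j
      using h(2)[of j] that by (simp add: f_def)
  qed
qed

text \<open>A monomial sees only the exponents below \<open>n\<close>, whereas a shift would use all
  of them; hence the cut-off.\<close>

lemma word_action_monomial:
  assumes h: "h \<in> hom R (BijGroup UNIV)"
    "\<And>i. i < n \<Longrightarrow> h (x i) = map (shift Q (\<lambda>k. of_bool (k = i)))"
  shows "h (monomial R x v n) = map (shift Q (\<lambda>i. if i < n then v i else 0))"
proof -
  let ?W = "BijGroup (UNIV :: ((nat \<times> (nat \<Rightarrow> int)) \<times> bool) list set)"
  have aux: "monomial ?W (\<lambda>i. map (shift Q (\<lambda>k. of_bool (k = i)))) v l
      = map (shift Q (\<lambda>i. if i < l then v i else 0))" for l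
  proof (induction l)
    case 0
    then show ?case by (simp add: BijGroup_UNIV shift_zero)
  next
    case (Suc l)
    have "(\<lambda>i. (if i < l then v i else 0) + v l * of_bool (i = l)) = (\<lambda>i. if i < Suc l then v i else 0)"
      by (simp add: fun_eq_iff less_Suc_eq)
    then show ?case
      by (simp only: monomial.simps Suc map_shift_int_pow map_shift_mult)
  qed
  have "h (monomial R x v n) = monomial ?W (\<lambda>i. h (x i)) v n"
    by (rule hom_monomial[OF R.is_group group_BijGroup h(1)]) simp
  also have "\<dots> = monomial ?W (\<lambda>i. map (shift Q (\<lambda>k. of_bool (k = i)))) v n"
    using h(2) by (rule monomial_cong)
  also have "\<dots> = map (shift Q (\<lambda>i. if i < n then v i else 0))"
    by (rule aux)
  finally show ?thesis .
qed

end

section \<open>Equivariant cocycles\<close>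

text \<open>The permutational wreath product of \<open>R\<close> by the left translations of \<open>G\<close>, restricted to functions
  that are equivariant under right translations by \<open>K\<close>.\<close>

definition cocycle_group ::
    "('a, 'm) monoid_scheme \<Rightarrow> 'a set \<Rightarrow> ('r, 'n) monoid_scheme \<Rightarrow> ('a \<Rightarrow> 'r) \<Rightarrow> (('a \<Rightarrow> 'r) \<times> 'a) monoid" where
  "cocycle_group G K R \<phi> =
     \<lparr>carrier = {(f, h). h \<in> carrier G \<and> f \<in> carrier G \<rightarrow>\<^sub>E carrier R \<and>
        (\<forall>p\<in>carrier G. \<forall>k\<in>K. f (p \<otimes>\<^bsub>G\<^esub> k) = inv\<^bsub>R\<^esub> \<phi> k \<otimes>\<^bsub>R\<^esub> f p \<otimes>\<^bsub>R\<^esub> \<phi> k)},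
      monoid.mult = (\<lambda>(f, h) (f', h'). (\<lambda>p\<in>carrier G. f (h' \<otimes>\<^bsub>G\<^esub> p) \<otimes>\<^bsub>R\<^esub> f' p, h \<otimes>\<^bsub>G\<^esub> h')),
      one = (\<lambda>p\<in>carrier G. \<one>\<^bsub>R\<^esub>, \<one>\<^bsub>G\<^esub>)\<rparr>"

locale equivariant_cocycles = G: group G + R: group R for G :: "('a, 'm) monoid_scheme" (structure)
    and R :: "('r, 'n) monoid_scheme" +
  fixes K :: "'a set" and \<phi> :: "'a \<Rightarrow> 'r"
  assumes K_sub: "subgroup K G"
    and \<phi>_hom: "\<phi> \<in> hom (G\<lparr>carrier := K\<rparr>) R"
begin

abbreviation W :: "(('a \<Rightarrow> 'r) \<times> 'a) monoid" where "W \<equiv> cocycle_group G K R \<phi>"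

lemma K_carrier [simp]: "k \<in> K \<Longrightarrow> k \<in> carrier G"
  using K_sub by (rule subgroup.mem_carrier)

lemma \<phi>_closed [simp]: "k \<in> K \<Longrightarrow> \<phi> k \<in> carrier R"
  using \<phi>_hom by (auto simp: hom_def)

lemma \<phi>_mult: "k \<in> K \<Longrightarrow> l \<in> K \<Longrightarrow> \<phi> (k \<otimes> l) = \<phi> k \<otimes>\<^bsub>R\<^esub> \<phi> l"
  using \<phi>_hom by (auto simp: hom_def)

lemma W_carrier:
  "w \<in> carrier W \<longleftrightarrow> snd w \<in> carrier G \<and> fst w \<in> carrier G \<rightarrow>\<^sub>E carrier R \<and>
     (\<forall>p\<in>carrier G. \<forall>k\<in>K. fst w (p \<otimes> k) = inv\<^bsub>R\<^esub> \<phi> k \<otimes>\<^bsub>R\<^esub> fst w p \<otimes>\<^bsub>R\<^esub> \<phi> k)"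
  by (cases w) (simp add: cocycle_group_def)

lemma W_closed:
  assumes "w \<in> carrier W"
  shows "snd w \<in> carrier G" "p \<in> carrier G \<Longrightarrow> fst w p \<in> carrier R"
    "p \<in> carrier G \<Longrightarrow> k \<in> K \<Longrightarrow> fst w (p \<otimes> k) = inv\<^bsub>R\<^esub> \<phi> k \<otimes>\<^bsub>R\<^esub> fst w p \<otimes>\<^bsub>R\<^esub> \<phi> k"
    "fst w \<in> extensional (carrier G)"
  using assms by (auto simp: W_carrier PiE_iff)

lemma W_eqI:
  assumes "w \<in> carrier W" "w' \<in> carrier W" "snd w = snd w'"
    "\<And>p. p \<in> carrier G \<Longrightarrow> fst w p = fst w' p"
  shows "w = w'"
  using assms W_closed(4) by (intro prod_eqI extensionalityI[of _ "carrier G"]) auto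

lemma W_mult:
  "w \<otimes>\<^bsub>W\<^esub> w' = (\<lambda>p\<in>carrier G. fst w (snd w' \<otimes> p) \<otimes>\<^bsub>R\<^esub> fst w' p, snd w \<otimes> snd w')"
  by (simp add: cocycle_group_def split: prod.split)

lemma W_one: "\<one>\<^bsub>W\<^esub> = (\<lambda>p\<in>carrier G. \<one>\<^bsub>R\<^esub>, \<one>)"
  by (simp add: cocycle_group_def)

lemma W_memI:
  assumes "h \<in> carrier G" "\<And>p. p \<in> carrier G \<Longrightarrow> f p \<in> carrier R"
    "\<And>p k. p \<in> carrier G \<Longrightarrow> k \<in> K \<Longrightarrow> f (p \<otimes> k) = inv\<^bsub>R\<^esub> \<phi> k \<otimes>\<^bsub>R\<^esub> f p \<otimes>\<^bsub>R\<^esub> \<phi> k"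
  shows "(\<lambda>p\<in>carrier G. f p, h) \<in> carrier W"
  using assms by (auto simp: W_carrier)

lemma conj_mult:
  assumes "k \<in> K" "a \<in> carrier R" "b \<in> carrier R"
  shows "(inv\<^bsub>R\<^esub> \<phi> k \<otimes>\<^bsub>R\<^esub> a \<otimes>\<^bsub>R\<^esub> \<phi> k) \<otimes>\<^bsub>R\<^esub> (inv\<^bsub>R\<^esub> \<phi> k \<otimes>\<^bsub>R\<^esub> b \<otimes>\<^bsub>R\<^esub> \<phi> k)
    = inv\<^bsub>R\<^esub> \<phi> k \<otimes>\<^bsub>R\<^esub> (a \<otimes>\<^bsub>R\<^esub> b) \<otimes>\<^bsub>R\<^esub> \<phi> k"
proof -
  have "\<phi> k \<otimes>\<^bsub>R\<^esub> (inv\<^bsub>R\<^esub> \<phi> k \<otimes>\<^bsub>R\<^esub> (b \<otimes>\<^bsub>R\<^esub> \<phi> k)) = b \<otimes>\<^bsub>R\<^esub> \<phi> k"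
    using assms by (simp flip: R.m_assoc)
  then show ?thesis using assms by (simp add: R.m_assoc)
qed

lemma W_mult_closed:
  assumes w: "w \<in> carrier W" and w': "w' \<in> carrier W"
  shows "w \<otimes>\<^bsub>W\<^esub> w' \<in> carrier W"
  unfolding W_mult
proof (rule W_memI)
  fix p k assume pk: "p \<in> carrier G" "k \<in> K"
  have "fst w (snd w' \<otimes> (p \<otimes> k)) = inv\<^bsub>R\<^esub> \<phi> k \<otimes>\<^bsub>R\<^esub> fst w (snd w' \<otimes> p) \<otimes>\<^bsub>R\<^esub> \<phi> k"
    using pk W_closed(3)[OF w, of "snd w' \<otimes> p" k] W_closed(1)[OF w'] by (simp add: G.m_assoc)
  then show "fst w (snd w' \<otimes> (p \<otimes> k)) \<otimes>\<^bsub>R\<^esub> fst w' (p \<otimes> k)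
      = inv\<^bsub>R\<^esub> \<phi> k \<otimes>\<^bsub>R\<^esub> (fst w (snd w' \<otimes> p) \<otimes>\<^bsub>R\<^esub> fst w' p) \<otimes>\<^bsub>R\<^esub> \<phi> k"
    using pk W_closed[OF w] W_closed[OF w'] by (simp add: conj_mult)
qed (use W_closed[OF w] W_closed[OF w'] in auto)

lemma W_inv_closed:
  assumes w: "w \<in> carrier W"
  shows "(\<lambda>p\<in>carrier G. inv\<^bsub>R\<^esub> fst w (inv (snd w) \<otimes> p), inv (snd w)) \<in> carrier W"
proof (rule W_memI)
  fix p k assume pk: "p \<in> carrier G" "k \<in> K"
  have "fst w (inv (snd w) \<otimes> (p \<otimes> k)) = inv\<^bsub>R\<^esub> \<phi> k \<otimes>\<^bsub>R\<^esub> fst w (inv (snd w) \<otimes> p) \<otimes>\<^bsub>R\<^esub> \<phi> k"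
    using pk W_closed(3)[OF w, of "inv (snd w) \<otimes> p" k] W_closed(1)[OF w] by (simp add: G.m_assoc)
  then show "inv\<^bsub>R\<^esub> fst w (inv (snd w) \<otimes> (p \<otimes> k))
      = inv\<^bsub>R\<^esub> \<phi> k \<otimes>\<^bsub>R\<^esub> inv\<^bsub>R\<^esub> fst w (inv (snd w) \<otimes> p) \<otimes>\<^bsub>R\<^esub> \<phi> k"
    using pk W_closed[OF w] by (simp add: R.inv_mult_group R.m_assoc)
qed (use W_closed[OF w] in auto)

lemma W_one_closed: "\<one>\<^bsub>W\<^esub> \<in> carrier W"
  unfolding W_one by (rule W_memI) auto

lemma W_inv_left:
  assumes w: "w \<in> carrier W"
  shows "(\<lambda>p\<in>carrier G. inv\<^bsub>R\<^esub> fst w (inv (snd w) \<otimes> p), inv (snd w)) \<otimes>\<^bsub>W\<^esub> w = \<one>\<^bsub>W\<^esub>"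
proof (rule W_eqI[OF W_mult_closed[OF W_inv_closed[OF w] w] W_one_closed])
  fix p assume p: "p \<in> carrier G"
  have "inv (snd w) \<otimes> (snd w \<otimes> p) = p" using p W_closed[OF w] by (simp flip: G.m_assoc)
  then show "fst ((\<lambda>p\<in>carrier G. inv\<^bsub>R\<^esub> fst w (inv (snd w) \<otimes> p), inv (snd w)) \<otimes>\<^bsub>W\<^esub> w) p = fst \<one>\<^bsub>W\<^esub> p"
    using p W_closed[OF w] by (simp add: W_mult W_one)
qed (use W_closed[OF w] in \<open>simp add: W_mult W_one\<close>)

sublocale W: group W
proof (rule groupI)
  show "w \<otimes>\<^bsub>W\<^esub> w' \<otimes>\<^bsub>W\<^esub> w'' = w \<otimes>\<^bsub>W\<^esub> (w' \<otimes>\<^bsub>W\<^esub> w'')"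
    if w: "w \<in> carrier W" "w' \<in> carrier W" "w'' \<in> carrier W" for w w' w''
  proof (rule W_eqI)
    show "w \<otimes>\<^bsub>W\<^esub> w' \<otimes>\<^bsub>W\<^esub> w'' \<in> carrier W" "w \<otimes>\<^bsub>W\<^esub> (w' \<otimes>\<^bsub>W\<^esub> w'') \<in> carrier W"
      using w by (simp_all add: W_mult_closed)
    show "snd (w \<otimes>\<^bsub>W\<^esub> w' \<otimes>\<^bsub>W\<^esub> w'') = snd (w \<otimes>\<^bsub>W\<^esub> (w' \<otimes>\<^bsub>W\<^esub> w''))"
      using w by (simp add: W_mult W_closed(1) G.m_assoc)
    show "fst (w \<otimes>\<^bsub>W\<^esub> w' \<otimes>\<^bsub>W\<^esub> w'') p = fst (w \<otimes>\<^bsub>W\<^esub> (w' \<otimes>\<^bsub>W\<^esub> w'')) p" if "p \<in> carrier G" for p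
      using w that by (simp add: W_mult W_closed(1,2) G.m_assoc R.m_assoc)
  qed
  show "\<one>\<^bsub>W\<^esub> \<otimes>\<^bsub>W\<^esub> w = w" if w: "w \<in> carrier W" for w
    by (rule W_eqI) (use w W_closed[OF w] in \<open>simp_all add: W_mult_closed W_one_closed\<close>,
      simp_all add: W_mult W_one)
  show "\<exists>w'\<in>carrier W. w' \<otimes>\<^bsub>W\<^esub> w = \<one>\<^bsub>W\<^esub>" if w: "w \<in> carrier W" for w
    using W_inv_closed[OF w] W_inv_left[OF w] by blast
qed (simp_all add: W_mult_closed W_one_closed)

lemma W_inv:
  assumes "w \<in> carrier W"
  shows "inv\<^bsub>W\<^esub> w = (\<lambda>p\<in>carrier G. inv\<^bsub>R\<^esub> fst w (inv (snd w) \<otimes> p), inv (snd w))"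
  using assms by (intro W.inv_equality W_inv_left W_inv_closed)

definition const :: "'a \<Rightarrow> ('a \<Rightarrow> 'r) \<times> 'a" where
  "const g = (\<lambda>p\<in>carrier G. \<one>\<^bsub>R\<^esub>, g)"

lemma const_hom: "const \<in> hom G W"
proof (rule homI)
  show "const g \<in> carrier W" if "g \<in> carrier G" for g
    unfolding const_def using that by (intro W_memI) auto
  show "const (g \<otimes> h) = const g \<otimes>\<^bsub>W\<^esub> const h" if "g \<in> carrier G" "h \<in> carrier G" for g h
    using that by (auto simp: const_def W_mult fun_eq_iff)
qed

text \<open>A section \<open>\<Theta>\<close> of the projection to \<open>G\<close> restricts on \<open>K\<close> to a twisted homomorphism, and
  multiplying by \<open>\<phi>\<close> undoes the twist.\<close>

lemma untwist_hom:
  assumes \<Theta>: "\<Theta> \<in> hom G W" and snd: "\<And>g. g \<in> carrier G \<Longrightarrow> snd (\<Theta> g) = g"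
  shows "(\<lambda>k. \<phi> k \<otimes>\<^bsub>R\<^esub> fst (\<Theta> k) \<one>) \<in> hom (G\<lparr>carrier := K\<rparr>) R"
proof (rule homI)
  have cl: "\<Theta> k \<in> carrier W" if "k \<in> K" for k using \<Theta> that by (auto simp: hom_def)
  show "\<phi> k \<otimes>\<^bsub>R\<^esub> fst (\<Theta> k) \<one> \<in> carrier R" if "k \<in> carrier (G\<lparr>carrier := K\<rparr>)" for k
    using that W_closed(2)[OF cl] by simp
  fix k l assume "k \<in> carrier (G\<lparr>carrier := K\<rparr>)" "l \<in> carrier (G\<lparr>carrier := K\<rparr>)"
  then have kl: "k \<in> K" "l \<in> K" by auto
  let ?c = "\<lambda>k. fst (\<Theta> k) \<one>"
  have c: "?c k \<in> carrier R" "?c l \<in> carrier R" using kl W_closed(2)[OF cl] by auto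
  have "\<Theta> (k \<otimes> l) = \<Theta> k \<otimes>\<^bsub>W\<^esub> \<Theta> l" using \<Theta> kl by (simp add: hom_def)
  then have "?c (k \<otimes> l) = fst (\<Theta> k) (\<one> \<otimes> l) \<otimes>\<^bsub>R\<^esub> ?c l" using kl snd by (simp add: W_mult)
  also have "fst (\<Theta> k) (\<one> \<otimes> l) = inv\<^bsub>R\<^esub> \<phi> l \<otimes>\<^bsub>R\<^esub> ?c k \<otimes>\<^bsub>R\<^esub> \<phi> l"
    using W_closed(3)[OF cl] kl by blast
  finally have "?c (k \<otimes> l) = inv\<^bsub>R\<^esub> \<phi> l \<otimes>\<^bsub>R\<^esub> ?c k \<otimes>\<^bsub>R\<^esub> \<phi> l \<otimes>\<^bsub>R\<^esub> ?c l" .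
  moreover have "\<phi> l \<otimes>\<^bsub>R\<^esub> (inv\<^bsub>R\<^esub> \<phi> l \<otimes>\<^bsub>R\<^esub> (?c k \<otimes>\<^bsub>R\<^esub> (\<phi> l \<otimes>\<^bsub>R\<^esub> ?c l))) = ?c k \<otimes>\<^bsub>R\<^esub> (\<phi> l \<otimes>\<^bsub>R\<^esub> ?c l)"
    using kl c by (simp flip: R.m_assoc)
  ultimately show "\<phi> (k \<otimes>\<^bsub>G\<lparr>carrier := K\<rparr>\<^esub> l) \<otimes>\<^bsub>R\<^esub> ?c (k \<otimes>\<^bsub>G\<lparr>carrier := K\<rparr>\<^esub> l)
      = (\<phi> k \<otimes>\<^bsub>R\<^esub> ?c k) \<otimes>\<^bsub>R\<^esub> (\<phi> l \<otimes>\<^bsub>R\<^esub> ?c l)"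
    using kl c by (simp add: \<phi>_mult R.m_assoc)
qed

end

section \<open>Groups generated along a graph\<close>

text \<open>What the presentation leaves behind in the group itself: images of the vertex and edge
  groups and one element for each edge, both directions of an edge being on the same
  footing.\<close>

locale generated_along_graph = group G + serre_graph \<Gamma> bar
  for G :: "('a, 'm) monoid_scheme" (structure) and \<Gamma> :: "('v, 'e) pre_digraph" and bar :: "'e \<Rightarrow> 'e" +
  fixes B :: "'v \<Rightarrow> 'a set" and C :: "'e \<Rightarrow> 'a set" and t :: "'e \<Rightarrow> 'a" and v0 :: 'v
  assumes B_subgroup: "v \<in> verts \<Gamma> \<Longrightarrow> subgroup (B v) G"
    and C_subset: "e \<in> arcs \<Gamma> \<Longrightarrow> C e \<subseteq> B (tail \<Gamma> e)"
    and C_subgroup: "e \<in> arcs \<Gamma> \<Longrightarrow> subgroup (C e) G"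
    and t_closed: "e \<in> arcs \<Gamma> \<Longrightarrow> t e \<in> carrier G"
    and t_bar: "e \<in> arcs \<Gamma> \<Longrightarrow> t (bar e) = inv (t e)"
    and t_conj: "e \<in> arcs \<Gamma> \<Longrightarrow> c \<in> C (bar e) \<Longrightarrow> t e \<otimes> c \<otimes> inv (t e) \<in> C e"
begin

section \<open>Paths in a graph of groups and their values\<close>

fun path_val :: "('a \<times> 'e) list \<Rightarrow> 'a \<Rightarrow> 'a" where
  "path_val [] g = g"
| "path_val ((h, e) # p) g = h \<otimes> (t e \<otimes> path_val p g)"

fun is_path :: "'v \<Rightarrow> ('a \<times> 'e) list \<Rightarrow> 'a \<Rightarrow> 'v \<Rightarrow> bool" where
  "is_path u [] g v \<longleftrightarrow> u = v \<and> u \<in> verts \<Gamma> \<and> g \<in> B u"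
| "is_path u ((h, e) # p) g v \<longleftrightarrow>
     e \<in> arcs \<Gamma> \<and> tail \<Gamma> e = u \<and> h \<in> B u \<and> is_path (head \<Gamma> e) p g v"

lemma B_closed: "v \<in> verts \<Gamma> \<Longrightarrow> g \<in> B v \<Longrightarrow> g \<in> carrier G"
  using B_subgroup subgroup.mem_carrier by fast

lemma path_val_closed: "is_path u p g v \<Longrightarrow> path_val p g \<in> carrier G"
  by (induction u p g v rule: is_path.induct)
    (auto simp: B_closed t_closed dest: B_closed[OF tail_in_verts])

text \<open>\<open>L\<close> receives the value of the path behind the edge, because a cocycle
  evaluated at the identity reads each edge at the point which the rest of the path has
  reached.\<close>

fun letters :: "('e \<Rightarrow> 'a \<Rightarrow> 'l) \<Rightarrow> ('a \<times> 'e) list \<Rightarrow> 'a \<Rightarrow> 'l list" where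
  "letters L [] g = []"
| "letters L ((h, e) # p) g = L e (path_val p g) # letters L p g"

text \<open>The factor is absorbed into the first vertex element. Letters depend only on what comes
  behind their edges, so they are unaffected.\<close>

lemma is_path_premult:
  assumes "is_path u p g v" "b \<in> B u" "u \<in> verts \<Gamma>"
  obtains p' g' where "is_path u p' g' v" "path_val p' g' = b \<otimes> path_val p g"
    "letters L p' g' = letters L p g"
proof (cases p)
  case Nil
  then have "g \<in> B u" using assms(1) by auto
  then have "b \<otimes> g \<in> B u" using assms(2) subgroup.m_closed[OF B_subgroup[OF assms(3)]] by blast
  then show ?thesis using that[of "[]" "b \<otimes> g"] Nil assms by simp
next
  case (Cons hf q)
  obtain h f where hf: "hf = (h, f)" by (cases hf)
  have "h \<in> B u" "is_path (head \<Gamma> f) q g v" "f \<in> arcs \<Gamma>" using assms Cons hf by auto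
  moreover from this have "b \<otimes> h \<in> B u"
    using assms(2) subgroup.m_closed[OF B_subgroup[OF assms(3)]] by blast
  ultimately show ?thesis
    using that[of "(b \<otimes> h, f) # q" g] assms Cons hf
    by (simp add: m_assoc B_closed t_closed path_val_closed)
qed

text \<open>Only the existence of reduced paths is needed, not the normal form theorem: a backtracking that
  makes two letters cancel can be removed from the path.\<close>

lemma reduced_path:
  assumes L: "\<And>e f g q. \<lbrakk>e \<in> arcs \<Gamma>; f \<in> arcs \<Gamma>; head \<Gamma> e = tail \<Gamma> f; g \<in> B (head \<Gamma> e); q \<in> carrier G;
      L f q = flip (L e (g \<otimes> (t f \<otimes> q)))\<rbrakk> \<Longrightarrow> f = bar e \<and> g \<in> C f"
    and "is_path u p g v"
  obtains p' g' where "is_path u p' g' v" "path_val p' g' = path_val p g" "reduced (letters L p' g')"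
proof -
  have "\<exists>p' g'. is_path u p' g' v \<and> path_val p' g' = path_val p g \<and> reduced (letters L p' g')"
    using assms(2)
  proof (induction p arbitrary: u)
    case Nil
    then show ?case by (intro exI[of _ "[]"]) auto
  next
    case (Cons he p)
    obtain h e where he: "he = (h, e)" by (cases he)
    have e: "e \<in> arcs \<Gamma>" "tail \<Gamma> e = u" "h \<in> B u" and p: "is_path (head \<Gamma> e) p g v"
      using Cons.prems he by auto
    obtain p' g' where p': "is_path (head \<Gamma> e) p' g' v" "path_val p' g' = path_val p g"
      "reduced (letters L p' g')"
      using Cons.IH[OF p] by blast
    show ?case
    proof (cases "reduced (letters L ((h, e) # p') g')")
      case True
      then show ?thesis using p' e he by (intro exI[of _ "(h, e) # p'"] exI[of _ g']) simp
    next
      case False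
      \<comment> \<open>The rest is reduced already, so the cancellation is between the first two
        letters.\<close>
      then obtain k f q where q: "p' = (k, f) # q"
        using p' by (cases p') auto
      have f: "f \<in> arcs \<Gamma>" "tail \<Gamma> f = head \<Gamma> e" "k \<in> B (head \<Gamma> e)" "is_path (head \<Gamma> f) q g' v"
        using p' q by auto
      let ?q = "path_val q g'"
      have qG: "?q \<in> carrier G" using f path_val_closed by blast
      have "L f ?q = flip (L e (k \<otimes> (t f \<otimes> ?q)))" "reduced (letters L q g')"
        using False p'(3) q by (auto simp: reduced_Cons)
      then have fe: "f = bar e" and k: "k \<in> C f" using L[OF e(1) f(1) f(2)[symmetric] f(3) qG] by auto
      \<comment> \<open>The path crosses \<open>e\<close>, meets an element of the edge group and
        crosses back. The stable letter carries that element over to \<open>B u\<close>, where the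
        whole turn is absorbed.\<close>
      define c where "c = t e \<otimes> k \<otimes> inv (t e)"
      have c: "c \<in> B u"
        using t_conj[OF e(1)] k fe C_subset[OF e(1)] e(2) by (auto simp: c_def)
      have u: "u \<in> verts \<Gamma>" using e tail_in_verts by blast
      have cG: "h \<in> carrier G" "k \<in> carrier G" "t e \<in> carrier G"
        using e f u by (auto intro: B_closed t_closed head_in_verts)
      have hc: "h \<otimes> c \<in> B u" using subgroup.m_closed[OF B_subgroup[OF u]] e c by blast
      have "is_path u q g' v" using f fe e by (simp add: head_bar)
      from is_path_premult[OF this hc u, of L]
      obtain p'' g'' where "is_path u p'' g'' v" "path_val p'' g'' = (h \<otimes> c) \<otimes> ?q"
        "letters L p'' g'' = letters L q g'" by metis
      moreover have "(h \<otimes> c) \<otimes> ?q = path_val (he # p) g"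
        using p'(2) q he fe e cG qG by (simp add: c_def t_bar m_assoc flip: p'(2))
      ultimately show ?thesis using \<open>reduced (letters L q g')\<close> by (intro exI[of _ p''] exI[of _ g'']) simp
    qed
  qed
  then show ?thesis using that by blast
qed

section \<open>Concatenation of paths and paths along a tree\<close>

lemma is_path_target: "is_path u p g v \<Longrightarrow> v \<in> verts \<Gamma>"
  by (induction u p g v rule: is_path.induct) auto

definition joined :: "'v \<Rightarrow> 'v \<Rightarrow> 'a \<Rightarrow> bool" where
  "joined u v h \<longleftrightarrow> (\<exists>p g. is_path u p g v \<and> path_val p g = h)"

lemma joined_vertex: "u \<in> verts \<Gamma> \<Longrightarrow> b \<in> B u \<Longrightarrow> joined u u b"
  unfolding joined_def by (intro exI[of _ "[]"] exI[of _ b]) simp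

lemma joined_edge:
  assumes "e \<in> arcs \<Gamma>"
  shows "joined (tail \<Gamma> e) (head \<Gamma> e) (t e)"
proof -
  have "\<one> \<in> B (tail \<Gamma> e)" "\<one> \<in> B (head \<Gamma> e)"
    using assms subgroup.one_closed[OF B_subgroup] by auto
  then show ?thesis
    unfolding joined_def using assms t_closed[OF assms]
    by (intro exI[of _ "[(\<one>, e)]"] exI[of _ \<one>]) simp
qed

lemma joined_trans:
  assumes "joined u v h" "joined v w k"
  shows "joined u w (h \<otimes> k)"
proof -
  obtain p g where p: "is_path u p g v" "path_val p g = h" using assms by (auto simp: joined_def)
  obtain q l where q: "is_path v q l w" "path_val q l = k" using assms by (auto simp: joined_def)
  have "joined u w (path_val p g \<otimes> path_val q l)"
    using p(1) q(1)
  proof (induction u p g v rule: is_path.induct)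
    case (1 u g v)
    then have "is_path u q l w" "g \<in> B u" "u \<in> verts \<Gamma>" by auto
    then obtain p' g' where "is_path u p' g' w" "path_val p' g' = g \<otimes> path_val q l"
      using is_path_premult[where L = "\<lambda>_ _. ()"] by metis
    then show ?case by (auto simp: joined_def)
  next
    case (2 u f e p g v)
    then have e: "e \<in> arcs \<Gamma>" "tail \<Gamma> e = u" "f \<in> B u" and p: "is_path (head \<Gamma> e) p g v"
      and "joined (head \<Gamma> e) w (path_val p g \<otimes> path_val q l)" by auto
    then obtain r m where r: "is_path (head \<Gamma> e) r m w" "path_val r m = path_val p g \<otimes> path_val q l"
      by (auto simp: joined_def)
    have "f \<in> carrier G" using e B_closed[OF tail_in_verts[OF e(1)]] by simp
    then have "path_val ((f, e) # r) m = path_val ((f, e) # p) g \<otimes> path_val q l"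
      using r t_closed[OF e(1)] path_val_closed[OF p] path_val_closed[OF 2(3)] by (simp add: m_assoc)
    moreover have "is_path u ((f, e) # r) m w" using e r by simp
    ultimately show ?case unfolding joined_def by blast
  qed
  then show ?thesis using p q by simp
qed

text \<open>The vertices joined to \<open>u\<close> in both directions by paths of value one cannot
  be left along a tree edge, whose own value is one.\<close>

lemma joined_along_tree:
  assumes sub: "subgraph T \<Gamma>" and bar: "bar ` arcs T \<subseteq> arcs T"
    and conn: "Digraph_Component.connected T" and span: "verts T = verts \<Gamma>"
    and t1: "\<And>e. e \<in> arcs T \<Longrightarrow> t e = \<one>" and u: "u \<in> verts \<Gamma>" and v: "v \<in> verts \<Gamma>"
  shows "joined u v \<one>"
proof -
  have TG: "tail T = tail \<Gamma>" "head T = head \<Gamma>" "arcs T \<subseteq> arcs \<Gamma>" and wf: "wf_digraph T"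
    using sub by (auto simp: subgraph_def compatible_def)
  interpret T: serre_graph T bar
    using wf bar TG by (auto simp: serre_graph_def serre_graph_axioms_def bar_bar bar_neq tail_bar subset_iff)
  define U where "U = {v \<in> verts \<Gamma>. joined u v \<one> \<and> joined v u \<one>}"
  have "U = verts \<Gamma>"
  proof (rule ccontr)
    assume ne: "U \<noteq> verts \<Gamma>"
    have "u \<in> U"
      using u joined_vertex[OF u subgroup.one_closed[OF B_subgroup[OF u]]] by (simp add: U_def)
    then obtain e where e: "e \<in> arcs T" "tail \<Gamma> e \<in> U" "head \<Gamma> e \<notin> U"
      using T.connected_exit[OF conn, of u U] ne span TG by (auto simp: U_def)
    then have eG: "e \<in> arcs \<Gamma>" "bar e \<in> arcs T" using TG bar by auto
    have "joined (tail \<Gamma> e) (head \<Gamma> e) \<one>" "joined (head \<Gamma> e) (tail \<Gamma> e) \<one>"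
      using joined_edge[OF eG(1)] joined_edge[OF bar_arcs[OF eG(1)]] t1[OF e(1)] t1[OF eG(2)]
        tail_bar[OF eG(1)] head_bar[OF eG(1)] by auto
    then have "joined u (head \<Gamma> e) (\<one> \<otimes> \<one>)" "joined (head \<Gamma> e) u (\<one> \<otimes> \<one>)"
      using e(2) unfolding U_def by (blast intro: joined_trans)+
    then show False using e(3) head_in_verts[OF eG(1)] by (simp add: U_def)
  qed
  then show "joined u v \<one>" using v by (auto simp: U_def)
qed

end

section \<open>The cocycle and its faithfulness\<close>

text \<open>The two alternatives in \<open>separated\<close> are the two ways of backtracking over
  \<open>e\<close>: turning at its head, or turning at its tail with the turning element carried
  over to the head side.\<close>

locale separated_along_graph = generated_along_graph G \<Gamma> bar B C t v0
  for G :: "('a, 'm) monoid_scheme" (structure) and \<Gamma> :: "('v, 'e) pre_digraph" and bar B C t v0 +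
  fixes Ep :: "'e set" and K :: "'a set" and \<psi> :: "nat \<Rightarrow> 'a \<Rightarrow> int" and N :: nat
  assumes fin_arcs: "finite (arcs \<Gamma>)"
    and Ep_arcs: "e \<in> Ep \<Longrightarrow> e \<in> arcs \<Gamma>"
    and Ep_bar: "e \<in> arcs \<Gamma> \<Longrightarrow> bar e \<in> Ep \<longleftrightarrow> e \<notin> Ep"
    and v0: "v0 \<in> verts \<Gamma>"
    and generated: "g \<in> carrier G \<Longrightarrow> \<exists>p h. is_path v0 p h v0 \<and> path_val p h = g"
    and K: "finite_index_subgroup K G"
    and \<psi>: "i < N \<Longrightarrow> additive_on K (\<psi> i)"
    and separated: "\<lbrakk>e \<in> Ep; g \<in> carrier G; x \<in> K;
        g \<otimes> x \<otimes> inv g \<in> B (head \<Gamma> e) \<or> t e \<otimes> (g \<otimes> x \<otimes> inv g) \<otimes> inv (t e) \<in> B (tail \<Gamma> e);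
        \<And>i. i < N \<Longrightarrow> (\<And>y. y \<in> K \<Longrightarrow> g \<otimes> y \<otimes> inv g \<in> C (bar e) \<Longrightarrow> \<psi> i y = 0) \<Longrightarrow> \<psi> i x = 0\<rbrakk>
      \<Longrightarrow> g \<otimes> x \<otimes> inv g \<in> C (bar e)"
    and separated_v0: "x \<in> K \<Longrightarrow> x \<in> B v0 \<Longrightarrow> (\<And>i. i < N \<Longrightarrow> \<psi> i x = 0) \<Longrightarrow> x = \<one>"
begin

lemma K_subgroup: "subgroup K G"
  using K by (simp add: finite_index_subgroup_def)

lemma K_closed: "k \<in> K \<Longrightarrow> k \<in> carrier G"
  using K_subgroup by (rule subgroup.mem_carrier)

lemma C_closed: "e \<in> arcs \<Gamma> \<Longrightarrow> c \<in> C e \<Longrightarrow> c \<in> carrier G"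
  using C_subgroup subgroup.mem_carrier by fast

lemma Ep_bar_arcs: "e \<in> Ep \<Longrightarrow> bar e \<in> arcs \<Gamma>"
  using Ep_arcs bar_arcs by blast

section \<open>Double cosets and their labels\<close>

definition dc :: "'e \<Rightarrow> 'a \<Rightarrow> 'a set" where
  "dc e p = {b \<otimes> p \<otimes> k | b k. b \<in> C (bar e) \<and> k \<in> K}"

text \<open>Chosen from the double coset as a set, so that all its points share one
  representative.\<close>

definition rep :: "'e \<Rightarrow> 'a \<Rightarrow> 'a" where
  "rep e p = (SOME q. q \<in> dc e p)"

text \<open>Determined up to left multiplication by those elements of \<open>K\<close> which the
  representative conjugates into \<open>C (bar e)\<close>; by \<open>T_eq\<close> the choice does
  not matter.\<close>

definition kpart :: "'e \<Rightarrow> 'a \<Rightarrow> 'a" where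
  "kpart e p = (SOME k. k \<in> K \<and> (\<exists>b\<in>C (bar e). p = b \<otimes> rep e p \<otimes> k))"

lemma dc_eq:
  assumes e: "e \<in> Ep" and p: "p \<in> carrier G" and b: "b \<in> C (bar e)" and k: "k \<in> K"
  shows "dc e (b \<otimes> p \<otimes> k) = dc e p"
proof -
  note Cs = C_subgroup[OF Ep_bar_arcs[OF e]]
  have le: "dc e (b \<otimes> p \<otimes> k) \<subseteq> dc e p" if "p \<in> carrier G" "b \<in> C (bar e)" "k \<in> K" for p b k
  proof
    fix x assume "x \<in> dc e (b \<otimes> p \<otimes> k)"
    then obtain c l where cl: "c \<in> C (bar e)" "l \<in> K" "x = c \<otimes> (b \<otimes> p \<otimes> k) \<otimes> l"
      by (auto simp: dc_def)
    then have "x = (c \<otimes> b) \<otimes> p \<otimes> (k \<otimes> l)"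
      using that subgroup.mem_carrier[OF Cs] K_closed by (simp add: m_assoc)
    then show "x \<in> dc e p"
      unfolding dc_def using that cl subgroup.m_closed[OF Cs] subgroup.m_closed[OF K_subgroup] by blast
  qed
  have "b \<in> carrier G" "k \<in> carrier G" using b k subgroup.mem_carrier[OF Cs] K_closed by auto
  then have "p = inv b \<otimes> (b \<otimes> p \<otimes> k) \<otimes> inv k" "b \<otimes> p \<otimes> k \<in> carrier G"
    using p by (simp_all add: m_assoc) (simp flip: m_assoc)
  then have "dc e p \<subseteq> dc e (b \<otimes> p \<otimes> k)"
    using le[of "b \<otimes> p \<otimes> k" "inv b" "inv k"] b k
      subgroup.m_inv_closed[OF Cs] subgroup.m_inv_closed[OF K_subgroup] by simp
  with le[OF p b k] show ?thesis by blast
qed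

lemma rep_decomp:
  assumes e: "e \<in> Ep" and p: "p \<in> carrier G"
  shows "rep e p \<in> carrier G" "kpart e p \<in> K" "\<exists>b\<in>C (bar e). p = b \<otimes> rep e p \<otimes> kpart e p"
proof -
  note Cs = C_subgroup[OF Ep_bar_arcs[OF e]]
  have "\<one> \<otimes> p \<otimes> \<one> \<in> dc e p"
    unfolding dc_def using subgroup.one_closed[OF Cs] subgroup.one_closed[OF K_subgroup] by blast
  then have "rep e p \<in> dc e p" unfolding rep_def by (rule someI)
  then obtain b k where bk: "b \<in> C (bar e)" "k \<in> K" "rep e p = b \<otimes> p \<otimes> k" by (auto simp: dc_def)
  have G: "b \<in> carrier G" "k \<in> carrier G" using bk subgroup.mem_carrier[OF Cs] K_closed by auto
  then show "rep e p \<in> carrier G" using bk p by simp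
  have "p = inv b \<otimes> rep e p \<otimes> inv k"
    unfolding bk(3) using G p by (simp add: m_assoc) (simp flip: m_assoc)
  then have "inv k \<in> K \<and> (\<exists>b\<in>C (bar e). p = b \<otimes> rep e p \<otimes> inv k)"
    using bk subgroup.m_inv_closed[OF Cs] subgroup.m_inv_closed[OF K_subgroup] by blast
  then have "kpart e p \<in> K \<and> (\<exists>b\<in>C (bar e). p = b \<otimes> rep e p \<otimes> kpart e p)"
    unfolding kpart_def by (rule someI)
  then show "kpart e p \<in> K" "\<exists>b\<in>C (bar e). p = b \<otimes> rep e p \<otimes> kpart e p" by auto
qed

definition double_cosets :: "('e \<times> 'a set) set" where
  "double_cosets = (\<lambda>(e, p). (e, dc e p)) ` (Ep \<times> carrier G)"

text \<open>The cosets counted by the index carry \<open>K\<close> on the left, while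
  \<open>dc\<close> has it on the right. Inversion exchanges the sides: a double coset is
  \<open>C (bar e)\<close> times the inverses of one coset of \<open>K\<close>.\<close>

lemma finite_double_cosets: "finite double_cosets"
proof -
  define F where "F = (\<lambda>(e, D). (e, {c \<otimes> inv q | c q. c \<in> C (bar e) \<and> q \<in> D})) ` (Ep \<times> (rcosets K))"
  have "finite Ep" using fin_arcs Ep_arcs by (meson finite_subset subsetI)
  then have "finite F" using K by (auto simp: F_def finite_index_subgroup_def)
  moreover have "double_cosets \<subseteq> F"
  proof
    fix x assume "x \<in> double_cosets"
    then obtain e p where ep: "e \<in> Ep" "p \<in> carrier G" "x = (e, dc e p)" by (auto simp: double_cosets_def)
    have "dc e p = {c \<otimes> inv q | c q. c \<in> C (bar e) \<and> q \<in> K #> inv p}" (is "_ = ?D")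
    proof
      show "dc e p \<subseteq> ?D"
      proof
        fix z assume "z \<in> dc e p"
        then obtain b k where bk: "b \<in> C (bar e)" "k \<in> K" "z = b \<otimes> p \<otimes> k" by (auto simp: dc_def)
        have "inv k \<otimes> inv p \<in> K #> inv p"
          using bk subgroup.m_inv_closed[OF K_subgroup] by (auto simp: r_coset_def)
        moreover have "z = b \<otimes> inv (inv k \<otimes> inv p)"
          using bk ep K_closed C_closed[OF Ep_bar_arcs[OF ep(1)]] by (simp add: inv_mult_group m_assoc)
        ultimately show "z \<in> ?D" using bk by blast
      qed
      show "?D \<subseteq> dc e p"
      proof
        fix z assume "z \<in> ?D"
        then obtain c k where ck: "c \<in> C (bar e)" "k \<in> K" "z = c \<otimes> inv (k \<otimes> inv p)"
          by (auto simp: r_coset_def)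
        then have "z = c \<otimes> p \<otimes> inv k"
          using ep K_closed C_closed[OF Ep_bar_arcs[OF ep(1)]] by (simp add: inv_mult_group m_assoc)
        then show "z \<in> dc e p"
          using ck subgroup.m_inv_closed[OF K_subgroup] by (auto simp: dc_def)
      qed
    qed
    moreover have "K #> inv p \<in> rcosets K" using ep by (auto simp: RCOSETS_def)
    ultimately show "x \<in> F" using ep unfolding F_def by (intro image_eqI[of _ _ "(e, K #> inv p)"]) auto
  qed
  ultimately show ?thesis by (rule finite_subset[rotated])
qed

definition M :: nat where "M = card double_cosets"

definition enc :: "'e \<times> 'a set \<Rightarrow> nat" where
  "enc = (SOME f. bij_betw f double_cosets {0..<M})"

lemma enc: "bij_betw enc double_cosets {0..<M}"
  unfolding enc_def M_def by (rule someI_ex[OF ex_bij_betw_finite_nat[OF finite_double_cosets]])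

text \<open>The offset leaves the numbers below \<open>N\<close> to the commuting
  generators.\<close>

definition lab :: "'e \<Rightarrow> 'a \<Rightarrow> nat" where
  "lab e p = N + enc (e, dc e p)"

lemma lab_bounds: "e \<in> Ep \<Longrightarrow> p \<in> carrier G \<Longrightarrow> N \<le> lab e p \<and> lab e p < N + M"
  using bij_betwE[OF enc] by (force simp: lab_def double_cosets_def)

lemma lab_eqD:
  assumes "e \<in> Ep" "p \<in> carrier G" "f \<in> Ep" "q \<in> carrier G" "lab e p = lab f q"
  shows "e = f \<and> dc e p = dc f q"
proof -
  have "(e, dc e p) \<in> double_cosets" "(f, dc f q) \<in> double_cosets"
    using assms by (auto simp: double_cosets_def)
  moreover have "enc (e, dc e p) = enc (f, dc f q)" using assms by (simp add: lab_def)
  ultimately show ?thesis using bij_betw_imp_inj_on[OF enc] by (metis inj_onD prod.inject)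
qed

definition Q :: "nat \<Rightarrow> nat set" where
  "Q j = {i. i < N \<and> (\<exists>e\<in>Ep. \<exists>p\<in>carrier G. j = lab e p \<and>
     (\<forall>y\<in>K. rep e p \<otimes> y \<otimes> inv (rep e p) \<in> C (bar e) \<longrightarrow> \<psi> i y = 0))}"

text \<open>A label determines its edge and its double coset, hence the representative, so the
  existential quantifiers in \<open>Q\<close> leave no freedom.\<close>

lemma Q_lab:
  assumes "e \<in> Ep" "p \<in> carrier G"
  shows "i \<in> Q (lab e p) \<longleftrightarrow> i < N \<and> (\<forall>y\<in>K. rep e p \<otimes> y \<otimes> inv (rep e p) \<in> C (bar e) \<longrightarrow> \<psi> i y = 0)"
proof -
  have same: "rep f q = rep e p" "f = e" if "f \<in> Ep" "q \<in> carrier G" "lab e p = lab f q" for f q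
  proof -
    have "dc e p = dc f q" "e = f" using lab_eqD[OF assms that] by blast+
    then show "rep f q = rep e p" "f = e" by (simp_all only: rep_def)
  qed
  show ?thesis
  proof
    assume "i \<in> Q (lab e p)"
    then obtain f q where fq: "f \<in> Ep" "q \<in> carrier G" "lab e p = lab f q"
      and i: "i < N" "\<forall>y\<in>K. rep f q \<otimes> y \<otimes> inv (rep f q) \<in> C (bar f) \<longrightarrow> \<psi> i y = 0"
      unfolding Q_def by blast
    from i[unfolded same(1)[OF fq]] show "i < N \<and> (\<forall>y\<in>K. rep e p \<otimes> y \<otimes> inv (rep e p) \<in> C (bar e) \<longrightarrow> \<psi> i y = 0)"
      using same(2)[OF fq] by simp
  next
    assume "i < N \<and> (\<forall>y\<in>K. rep e p \<otimes> y \<otimes> inv (rep e p) \<in> C (bar e) \<longrightarrow> \<psi> i y = 0)"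
    then show "i \<in> Q (lab e p)"
      unfolding Q_def using assms by (intro CollectI conjI bexI[of _ e] bexI[of _ p]) auto
  qed
qed

section \<open>The right angled Artin group and the reading of stable letters\<close>

sublocale S: split_raag N M Q .

definition \<phi> :: "'a \<Rightarrow> nat word set" where
  "\<phi> k = monomial S.R S.x (\<lambda>i. \<psi> i k) N"

lemma xx_commute: "i < N \<Longrightarrow> j < N \<Longrightarrow> S.x i \<otimes>\<^bsub>S.R\<^esub> S.x j = S.x j \<otimes>\<^bsub>S.R\<^esub> S.x i"
proof (cases "i = j")
  case False
  moreover assume "i < N" "j < N"
  ultimately show ?thesis by (intro S.x_commute) (simp add: split_graph_def)
qed simp

sublocale E: equivariant_cocycles G S.R K \<phi>
proof (intro equivariant_cocycles.intro equivariant_cocycles_axioms.intro is_group S.R.is_group)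
  show "subgroup K G" by (rule K_subgroup)
  show "\<phi> \<in> hom (G\<lparr>carrier := K\<rparr>) S.R"
  proof (rule homI)
    show "\<phi> k \<in> carrier S.R" for k unfolding \<phi>_def by (rule S.R.monomial_closed) simp
    fix k l assume "k \<in> carrier (G\<lparr>carrier := K\<rparr>)" "l \<in> carrier (G\<lparr>carrier := K\<rparr>)"
    then have "\<psi> i (k \<otimes> l) = \<psi> i k + \<psi> i l" if "i < N" for i
      using \<psi>[OF that] by (simp add: additive_on_def)
    then have "\<phi> (k \<otimes> l) = monomial S.R S.x (\<lambda>i. \<psi> i k + \<psi> i l) N"
      unfolding \<phi>_def by (rule monomial_exponent_cong)
    also have "\<dots> = \<phi> k \<otimes>\<^bsub>S.R\<^esub> \<phi> l"
      unfolding \<phi>_def by (rule S.R.monomial_add) (simp_all add: xx_commute)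
    finally show "\<phi> (k \<otimes>\<^bsub>G\<lparr>carrier := K\<rparr>\<^esub> l) = \<phi> k \<otimes>\<^bsub>S.R\<^esub> \<phi> l" by simp
  qed
qed

lemma x_lab_closed: "e \<in> Ep \<Longrightarrow> p \<in> carrier G \<Longrightarrow> S.x (lab e p) \<in> carrier S.R"
  using lab_bounds by simp

text \<open>A character that does not vanish at \<open>y\<close> is not in \<open>Q\<close>, so its
  generator is joined to that of the double coset.\<close>

lemma x_\<phi>_commute:
  assumes e: "e \<in> Ep" "p \<in> carrier G" and y: "y \<in> K" "rep e p \<otimes> y \<otimes> inv (rep e p) \<in> C (bar e)"
  shows "S.x (lab e p) \<otimes>\<^bsub>S.R\<^esub> \<phi> y = \<phi> y \<otimes>\<^bsub>S.R\<^esub> S.x (lab e p)"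
  unfolding \<phi>_def
proof (rule S.R.monomial_commute)
  fix i assume i: "i < N"
  show "\<psi> i y = 0 \<or> S.x (lab e p) \<otimes>\<^bsub>S.R\<^esub> S.x i = S.x i \<otimes>\<^bsub>S.R\<^esub> S.x (lab e p)"
  proof (cases "i \<in> Q (lab e p)")
    case True
    then show ?thesis using Q_lab[OF e] y by blast
  next
    case False
    then have "(lab e p, i) \<in> arcs (split_graph N M Q)"
      using i lab_bounds[OF e] by (auto simp: split_graph_def)
    then show ?thesis using S.x_commute by blast
  qed
qed (use x_lab_closed[OF e] in simp_all)

definition T :: "'e \<Rightarrow> 'a \<Rightarrow> nat word set" where
  "T e p = inv\<^bsub>S.R\<^esub> \<phi> (kpart e p) \<otimes>\<^bsub>S.R\<^esub> S.x (lab e p) \<otimes>\<^bsub>S.R\<^esub> \<phi> (kpart e p)"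

lemma T_closed: "e \<in> Ep \<Longrightarrow> p \<in> carrier G \<Longrightarrow> T e p \<in> carrier S.R"
  using rep_decomp(2) x_lab_closed by (simp add: T_def)

text \<open>Two decompositions differ by some \<open>y\<close> in \<open>K\<close> that the
  representative conjugates into the edge group, and \<open>\<phi> y\<close> commutes with the
  generator of the double coset. For this consistency the commutation relations were made.\<close>

lemma T_eq:
  assumes e: "e \<in> Ep" and p: "p \<in> carrier G" and b: "b \<in> C (bar e)" and k: "k \<in> K"
    and eq: "p = b \<otimes> rep e p \<otimes> k"
  shows "T e p = inv\<^bsub>S.R\<^esub> \<phi> k \<otimes>\<^bsub>S.R\<^esub> S.x (lab e p) \<otimes>\<^bsub>S.R\<^esub> \<phi> k"
proof -
  note Cs = C_subgroup[OF Ep_bar_arcs[OF e]]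
  let ?r = "rep e p" and ?k = "kpart e p" and ?x = "S.x (lab e p)"
  obtain c where c: "c \<in> C (bar e)" "p = c \<otimes> ?r \<otimes> ?k" using rep_decomp(3)[OF e p] by blast
  have k': "?k \<in> K" and r: "?r \<in> carrier G" using rep_decomp[OF e p] by auto
  have G: "b \<in> carrier G" "c \<in> carrier G" "k \<in> carrier G" "?k \<in> carrier G"
    using b c k k' K_closed subgroup.mem_carrier[OF Cs] by auto
  define y where "y = ?k \<otimes> inv k"
  have y: "y \<in> K" unfolding y_def
    using k k' subgroup.m_closed[OF K_subgroup] subgroup.m_inv_closed[OF K_subgroup] by blast
  have "?r \<otimes> ?k = inv c \<otimes> p"
    using c(2) G r p by (metis inv_solve_left m_assoc m_closed)
  also have "\<dots> = inv c \<otimes> b \<otimes> ?r \<otimes> k" by (subst eq) (use G r in \<open>simp add: m_assoc\<close>)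
  finally have "?r \<otimes> y \<otimes> inv ?r = inv c \<otimes> b"
    unfolding y_def using G r by (simp flip: m_assoc) (simp add: m_assoc)
  then have com: "?x \<otimes>\<^bsub>S.R\<^esub> \<phi> y = \<phi> y \<otimes>\<^bsub>S.R\<^esub> ?x"
    using x_\<phi>_commute[OF e p y] b c subgroup.m_closed[OF Cs] subgroup.m_inv_closed[OF Cs] by simp
  have "?k = y \<otimes> k" unfolding y_def using G by (simp add: m_assoc)
  then have \<phi>k: "\<phi> ?k = \<phi> y \<otimes>\<^bsub>S.R\<^esub> \<phi> k" using E.\<phi>_mult y k by simp
  have R: "?x \<in> carrier S.R" "\<phi> y \<in> carrier S.R" "\<phi> k \<in> carrier S.R"
    using x_lab_closed[OF e p] y k by simp_all
  have "T e p = inv\<^bsub>S.R\<^esub> \<phi> k \<otimes>\<^bsub>S.R\<^esub> (inv\<^bsub>S.R\<^esub> \<phi> y \<otimes>\<^bsub>S.R\<^esub> (?x \<otimes>\<^bsub>S.R\<^esub> \<phi> y)) \<otimes>\<^bsub>S.R\<^esub> \<phi> k"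
    unfolding T_def \<phi>k using R by (simp add: S.R.inv_mult_group S.R.m_assoc)
  also have "inv\<^bsub>S.R\<^esub> \<phi> y \<otimes>\<^bsub>S.R\<^esub> (?x \<otimes>\<^bsub>S.R\<^esub> \<phi> y) = ?x"
    unfolding com using R by (simp flip: S.R.m_assoc)
  finally show ?thesis .
qed

text \<open>Invariance under \<open>b\<close> yields the edge relation in
  \<open>\<tau>_const\<close>; equivariance under \<open>k\<close> yields membership in the cocycle
  group.\<close>

lemma T_translate:
  assumes e: "e \<in> Ep" and p: "p \<in> carrier G" and b: "b \<in> C (bar e)" and k: "k \<in> K"
  shows "T e (b \<otimes> p \<otimes> k) = inv\<^bsub>S.R\<^esub> \<phi> k \<otimes>\<^bsub>S.R\<^esub> T e p \<otimes>\<^bsub>S.R\<^esub> \<phi> k"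
proof -
  note Cs = C_subgroup[OF Ep_bar_arcs[OF e]]
  let ?p = "b \<otimes> p \<otimes> k" and ?k = "kpart e p"
  have same: "rep e ?p = rep e p" "lab e ?p = lab e p"
    using dc_eq[OF e p b k] by (simp_all add: rep_def lab_def)
  obtain c where c: "c \<in> C (bar e)" "p = c \<otimes> rep e p \<otimes> ?k" using rep_decomp(3)[OF e p] by blast
  have k': "?k \<in> K" and r: "rep e p \<in> carrier G" using rep_decomp[OF e p] by auto
  have G: "b \<in> carrier G" "c \<in> carrier G" "k \<in> carrier G" "?k \<in> carrier G"
    using b c k k' K_closed subgroup.mem_carrier[OF Cs] by auto
  have "?p = (b \<otimes> c) \<otimes> rep e ?p \<otimes> (?k \<otimes> k)"
    unfolding same by (subst c(2)) (use G r in \<open>simp add: m_assoc\<close>)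
  then have "T e ?p = inv\<^bsub>S.R\<^esub> \<phi> (?k \<otimes> k) \<otimes>\<^bsub>S.R\<^esub> S.x (lab e ?p) \<otimes>\<^bsub>S.R\<^esub> \<phi> (?k \<otimes> k)"
    using T_eq[OF e, of ?p "b \<otimes> c" "?k \<otimes> k"] G p b c k k'
      subgroup.m_closed[OF Cs] subgroup.m_closed[OF K_subgroup] by simp
  then show ?thesis
    unfolding same T_def using k k' x_lab_closed[OF e p]
    by (simp add: E.\<phi>_mult S.R.inv_mult_group S.R.m_assoc)
qed

definition \<tau> :: "'e \<Rightarrow> ('a \<Rightarrow> nat word set) \<times> 'a" where
  "\<tau> e = (if e \<in> Ep then (\<lambda>p\<in>carrier G. T e p, t e)
     else inv\<^bsub>E.W\<^esub> (\<lambda>p\<in>carrier G. T (bar e) p, t (bar e)))"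

lemma T_in_W: "e \<in> Ep \<Longrightarrow> (\<lambda>p\<in>carrier G. T e p, t e) \<in> carrier E.W"
proof (rule E.W_memI)
  fix p k assume e: "e \<in> Ep" and pk: "p \<in> carrier G" "k \<in> K"
  then show "T e (p \<otimes> k) = inv\<^bsub>S.R\<^esub> \<phi> k \<otimes>\<^bsub>S.R\<^esub> T e p \<otimes>\<^bsub>S.R\<^esub> \<phi> k"
    using T_translate[OF e pk(1) _ pk(2), of \<one>] subgroup.one_closed[OF C_subgroup[OF Ep_bar_arcs[OF e]]]
    by simp
qed (auto simp: T_closed t_closed Ep_arcs)

lemma \<tau>_closed: "e \<in> arcs \<Gamma> \<Longrightarrow> \<tau> e \<in> carrier E.W"
  using T_in_W Ep_bar by (auto simp: \<tau>_def)

lemma \<tau>_bar: "e \<in> arcs \<Gamma> \<Longrightarrow> \<tau> (bar e) = inv\<^bsub>E.W\<^esub> \<tau> e"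
  using T_in_W Ep_bar by (auto simp: \<tau>_def bar_bar)

lemma snd_\<tau>: "e \<in> arcs \<Gamma> \<Longrightarrow> snd (\<tau> e) = t e"
  using T_in_W[of "bar e"] Ep_bar[of e] by (auto simp: \<tau>_def E.W_inv t_bar t_closed)

lemma fst_\<tau>_neg:
  assumes "e \<in> arcs \<Gamma>" "e \<notin> Ep" "q \<in> carrier G"
  shows "fst (\<tau> e) q = inv\<^bsub>S.R\<^esub> T (bar e) (t e \<otimes> q)"
  using assms T_in_W[of "bar e"] Ep_bar[of e] t_closed[of e] by (simp add: \<tau>_def E.W_inv t_bar)

text \<open>For constant cocycles on the vertex groups the relation amounts to
  \<open>T e (c \<otimes> p) = T e p\<close>.\<close>

lemma \<tau>_const:
  assumes e: "e \<in> Ep" and c: "c \<in> C (bar e)"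
  shows "\<tau> e \<otimes>\<^bsub>E.W\<^esub> E.const c \<otimes>\<^bsub>E.W\<^esub> inv\<^bsub>E.W\<^esub> \<tau> e = E.const (t e \<otimes> c \<otimes> inv (t e))"
proof -
  note Cs = C_subgroup[OF Ep_bar_arcs[OF e]]
  have cG: "c \<in> carrier G" and tG: "t e \<in> carrier G"
    using c subgroup.mem_carrier[OF Cs] t_closed Ep_arcs[OF e] by auto
  have W: "\<tau> e \<in> carrier E.W" "E.const c \<in> carrier E.W" "E.const (t e \<otimes> c \<otimes> inv (t e)) \<in> carrier E.W"
    using \<tau>_closed[OF Ep_arcs[OF e]] hom_in_carrier[OF E.const_hom] cG tG by auto
  have "T e (c \<otimes> p) = T e p" if "p \<in> carrier G" for p
    using T_translate[OF e that c subgroup.one_closed[OF K_subgroup]] cG that T_closed[OF e that]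
    by (simp add: \<phi>_def S.R.monomial_zero additive_on_one[OF K_subgroup \<psi>])
  then have "\<tau> e \<otimes>\<^bsub>E.W\<^esub> E.const c = E.const (t e \<otimes> c \<otimes> inv (t e)) \<otimes>\<^bsub>E.W\<^esub> \<tau> e"
    using e cG tG T_closed[OF e] by (auto simp: \<tau>_def E.W_mult E.const_def m_assoc fun_eq_iff)
  then show ?thesis using W by (simp add: E.W.m_assoc)
qed

section \<open>Reading paths as words in a free group\<close>

fun wval :: "('a \<times> 'e) list \<Rightarrow> 'a \<Rightarrow> ('a \<Rightarrow> nat word set) \<times> 'a" where
  "wval [] g = E.const g"
| "wval ((h, e) # p) g = E.const h \<otimes>\<^bsub>E.W\<^esub> (\<tau> e \<otimes>\<^bsub>E.W\<^esub> wval p g)"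

lemma wval_closed: "is_path u p g v \<Longrightarrow> wval p g \<in> carrier E.W"
proof (induction u p g v rule: is_path.induct)
  case (2 u h e p g v)
  then have "h \<in> carrier G" using B_closed[OF tail_in_verts] by auto
  then show ?case using 2 hom_in_carrier[OF E.const_hom] \<tau>_closed by simp
qed (use hom_in_carrier[OF E.const_hom] B_closed in auto)

lemma snd_wval: "is_path u p g v \<Longrightarrow> snd (wval p g) = path_val p g"
  by (induction u p g v rule: is_path.induct) (auto simp: E.const_def E.W_mult snd_\<tau>)

lemma fst_wval_Cons:
  assumes "is_path u ((h, e) # p) g v"
  shows "fst (wval ((h, e) # p) g) \<one> = fst (\<tau> e) (path_val p g) \<otimes>\<^bsub>S.R\<^esub> fst (wval p g) \<one>"
proof -
  have e: "e \<in> arcs \<Gamma>" and p: "is_path (head \<Gamma> e) p g v" using assms by auto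
  show ?thesis
    using E.W_closed[OF \<tau>_closed[OF e]] E.W_closed[OF wval_closed[OF p]] path_val_closed[OF p]
    by (simp add: E.const_def E.W_mult snd_wval[OF p])
qed

text \<open>The basis element by which \<open>T e p\<close> acts. The sign is negative because
  \<open>T e p\<close> has the inverse of the monomial on its left; the cut-off is that of
  \<open>word_action_monomial\<close>.\<close>

definition letter :: "'e \<Rightarrow> 'a \<Rightarrow> (nat \<times> (nat \<Rightarrow> int)) \<times> bool" where
  "letter e p = shift Q (\<lambda>i. - (if i < N then \<psi> i (kpart e p) else 0)) ((lab e p, \<lambda>_. 0), True)"

text \<open>The inverse of a cocycle with group part \<open>h\<close> takes at \<open>q\<close> the
  inverse of the value at \<open>inv h \<otimes> q\<close>. For a negative edge \<open>h\<close> is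
  \<open>t (bar e)\<close>, whence the point \<open>t e \<otimes> q\<close>.\<close>

definition L :: "'e \<Rightarrow> 'a \<Rightarrow> (nat \<times> (nat \<Rightarrow> int)) \<times> bool" where
  "L e q = (if e \<in> Ep then letter e q else flip (letter (bar e) (t e \<otimes> q)))"

text \<open>The place where \<open>separated\<close> is used. Equal letters mean equal double cosets
  and equal values of the characters in \<open>Q\<close> on the parts in \<open>K\<close>. The
  quotient \<open>x\<close> of these parts is therefore killed by every character that vanishes on
  the edge group there, and the representative conjugates it to
  \<open>inv c \<otimes> y \<otimes> b\<close>; so this element lies in \<open>C (bar e)\<close>,
  and \<open>y\<close> with it.\<close>

lemma letter_eqD:
  assumes e: "e \<in> Ep" and p: "p \<in> carrier G" and y: "y \<in> carrier G"
    and yB: "y \<in> B (head \<Gamma> e) \<or> t e \<otimes> y \<otimes> inv (t e) \<in> B (tail \<Gamma> e)"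
    and eq: "letter e p = letter e (y \<otimes> p)"
  shows "y \<in> C (bar e)"
proof -
  note Cs = C_subgroup[OF Ep_bar_arcs[OF e]]
  have eA: "e \<in> arcs \<Gamma>" using Ep_arcs[OF e] .
  have yp: "y \<otimes> p \<in> carrier G" using y p by simp
  have labs: "lab e p = lab e (y \<otimes> p)" using eq by (simp add: letter_def shift_def)
  then have "dc e p = dc e (y \<otimes> p)" using lab_eqD[OF e p e yp] by blast
  then have rep: "rep e (y \<otimes> p) = rep e p" by (simp add: rep_def)
  let ?r = "rep e p" and ?k = "kpart e p" and ?l = "kpart e (y \<otimes> p)"
  have \<psi>_eq: "\<psi> i ?k = \<psi> i ?l" if "i \<in> Q (lab e p)" for i
  proof -
    have "i < N" using that by (simp add: Q_def)
    moreover have "snd (fst (letter e p)) i = snd (fst (letter e (y \<otimes> p))) i" using eq by simp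
    ultimately show ?thesis using that by (simp add: letter_def shift_def flip: labs)
  qed
  obtain b where b: "b \<in> C (bar e)" "p = b \<otimes> ?r \<otimes> ?k" using rep_decomp(3)[OF e p] by blast
  obtain c where c: "c \<in> C (bar e)" "y \<otimes> p = c \<otimes> ?r \<otimes> ?l" using rep_decomp(3)[OF e yp] rep by auto
  have k: "?k \<in> K" "?l \<in> K" and r: "?r \<in> carrier G" using rep_decomp[OF e p] rep_decomp[OF e yp] by auto
  have G: "b \<in> carrier G" "c \<in> carrier G" "?k \<in> carrier G" "?l \<in> carrier G"
    using b c k K_closed subgroup.mem_carrier[OF Cs] by auto
  define x where "x = ?l \<otimes> inv ?k"
  have x: "x \<in> K" unfolding x_def
    using k subgroup.m_closed[OF K_subgroup] subgroup.m_inv_closed[OF K_subgroup] by blast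
  have "y \<otimes> b \<otimes> ?r \<otimes> ?k = c \<otimes> ?r \<otimes> ?l"
    using c(2) by (subst (asm) (1) b(2)) (use G r y in \<open>simp add: m_assoc\<close>)
  then have "y \<otimes> b \<otimes> ?r = c \<otimes> ?r \<otimes> ?l \<otimes> inv ?k"
    using G r y by (simp add: inv_solve_right)
  then have conj: "?r \<otimes> x \<otimes> inv ?r = inv c \<otimes> y \<otimes> b"
  proof -
    assume *: "y \<otimes> b \<otimes> ?r = c \<otimes> ?r \<otimes> ?l \<otimes> inv ?k"
    have "?r \<otimes> x \<otimes> inv ?r = inv c \<otimes> (c \<otimes> ?r \<otimes> ?l \<otimes> inv ?k) \<otimes> inv ?r"
      unfolding x_def using G r by (simp add: m_assoc) (simp flip: m_assoc)
    also have "\<dots> = inv c \<otimes> y \<otimes> b"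
      unfolding *[symmetric] using G r y by (simp add: m_assoc)
    finally show ?thesis .
  qed
  have "?r \<otimes> x \<otimes> inv ?r \<in> C (bar e)"
  proof (rule separated[OF e r x])
    \<comment> \<open>The factors \<open>inv c\<close> and \<open>b\<close> come from the edge
      group, which is contained in both subgroups, so each alternative passes from \<open>y\<close>
      to the conjugate of \<open>x\<close>.\<close>
    show "?r \<otimes> x \<otimes> inv ?r \<in> B (head \<Gamma> e) \<or> t e \<otimes> (?r \<otimes> x \<otimes> inv ?r) \<otimes> inv (t e) \<in> B (tail \<Gamma> e)"
      using yB
    proof
      assume "y \<in> B (head \<Gamma> e)"
      moreover have "C (bar e) \<subseteq> B (head \<Gamma> e)"
        using C_subset[OF Ep_bar_arcs[OF e]] tail_bar[OF eA] by simp
      moreover have "subgroup (B (head \<Gamma> e)) G" using B_subgroup eA by simp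
      ultimately have "inv c \<otimes> y \<otimes> b \<in> B (head \<Gamma> e)"
        using b c by (meson subgroup.m_closed subgroup.m_inv_closed subsetD)
      then show ?thesis unfolding conj by blast
    next
      assume yt: "t e \<otimes> y \<otimes> inv (t e) \<in> B (tail \<Gamma> e)"
      have tG: "t e \<in> carrier G" using t_closed[OF eA] .
      have "t e \<otimes> inv c \<otimes> inv (t e) \<in> B (tail \<Gamma> e)" "t e \<otimes> b \<otimes> inv (t e) \<in> B (tail \<Gamma> e)"
        using t_conj[OF eA] C_subset[OF eA] b c subgroup.m_inv_closed[OF Cs] by blast+
      moreover have "subgroup (B (tail \<Gamma> e)) G" using B_subgroup eA by simp
      ultimately have "(t e \<otimes> inv c \<otimes> inv (t e)) \<otimes> (t e \<otimes> y \<otimes> inv (t e)) \<otimes> (t e \<otimes> b \<otimes> inv (t e)) \<in> B (tail \<Gamma> e)"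
        using yt by (meson subgroup.m_closed)
      moreover have cancel: "inv (t e) \<otimes> (t e \<otimes> z) = z" if "z \<in> carrier G" for z
        using that tG by (simp flip: m_assoc)
      have "(t e \<otimes> inv c \<otimes> inv (t e)) \<otimes> (t e \<otimes> y \<otimes> inv (t e)) \<otimes> (t e \<otimes> b \<otimes> inv (t e))
          = t e \<otimes> (inv c \<otimes> y \<otimes> b) \<otimes> inv (t e)"
        using G y tG by (simp add: m_assoc cancel)
      ultimately show ?thesis unfolding conj by simp
    qed
  next
    fix i assume i: "i < N" and van: "\<And>z. z \<in> K \<Longrightarrow> ?r \<otimes> z \<otimes> inv ?r \<in> C (bar e) \<Longrightarrow> \<psi> i z = 0"
    then have "i \<in> Q (lab e p)" using Q_lab[OF e p] by blast
    then have "\<psi> i ?k = \<psi> i ?l" by (rule \<psi>_eq)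
    moreover have "\<psi> i x = \<psi> i ?l + \<psi> i (inv ?k)"
      unfolding x_def using \<psi>[OF i] k subgroup.m_inv_closed[OF K_subgroup] by (simp add: additive_on_def)
    ultimately show "\<psi> i x = 0" using additive_on_inv[OF K_subgroup \<psi>[OF i] k(1)] by simp
  qed
  then have "inv c \<otimes> y \<otimes> b \<in> C (bar e)" unfolding conj .
  then have "c \<otimes> (inv c \<otimes> y \<otimes> b) \<otimes> inv b \<in> C (bar e)"
    using b c by (meson Cs subgroup.m_closed subgroup.m_inv_closed)
  moreover have "c \<otimes> (inv c \<otimes> y \<otimes> b) \<otimes> inv b = y"
    using G y by (simp add: m_assoc) (simp flip: m_assoc)
  ultimately show ?thesis by simp
qed

lemma snd_letter: "snd (letter e p)"
  by (simp add: letter_def shift_def)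

lemma fst_letter_eqD:
  assumes "e \<in> Ep" "p \<in> carrier G" "f \<in> Ep" "q \<in> carrier G" "letter e p = letter f q"
  shows "e = f"
proof -
  have "lab e p = lab f q" using assms by (simp add: letter_def shift_def)
  then show ?thesis using lab_eqD assms by blast
qed

text \<open>Signs tell positive from negative edges, so cancelling letters belong to one of each.
  Their common label determines the edge, and \<open>letter_eqD\<close> locates the turning
  element.\<close>

lemma L_backtrack:
  assumes e: "e \<in> arcs \<Gamma>" and f: "f \<in> arcs \<Gamma>" and ef: "head \<Gamma> e = tail \<Gamma> f"
    and g: "g \<in> B (head \<Gamma> e)" and q: "q \<in> carrier G"
    and eq: "L f q = flip (L e (g \<otimes> (t f \<otimes> q)))"
  shows "f = bar e \<and> g \<in> C f"
proof -
  have G: "g \<in> carrier G" "t e \<in> carrier G" "t f \<in> carrier G"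
    using B_closed[OF head_in_verts[OF e] g] t_closed e f by auto
  have "(e \<in> Ep) \<noteq> (f \<in> Ep)"
    using eq snd_letter by (auto simp: L_def prod_eq_iff split: if_splits)
  then consider "e \<in> Ep" "f \<notin> Ep" | "e \<notin> Ep" "f \<in> Ep" by blast
  then show ?thesis
  proof cases
    case 1
    have eq': "letter (bar f) (t f \<otimes> q) = letter e (g \<otimes> (t f \<otimes> q))"
      using eq 1 by (simp add: L_def prod_eq_iff)
    then have "bar f = e" using 1 f Ep_bar[OF f] G q by (intro fst_letter_eqD[of "bar f" _ e]) auto
    then show ?thesis
      using letter_eqD[of e "t f \<otimes> q" g] eq' 1 G q g f by (auto simp: bar_bar)
  next
    case 2
    have eq': "letter f q = letter (bar e) (t e \<otimes> (g \<otimes> (t f \<otimes> q)))"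
      using eq 2 by (simp add: L_def prod_eq_iff)
    then have fe: "f = bar e" using 2 e Ep_bar[OF e] G q by (intro fst_letter_eqD[of f _ "bar e"]) auto
    have te: "t e = inv (t f)" using fe e f t_bar[OF f] by (simp add: bar_bar)
    \<comment> \<open>The turn is at the tail of \<open>f\<close>, and the point moves by
      \<open>g\<close> carried across the edge. Once \<open>y\<close> is found in
      \<open>C (bar f)\<close>, conjugating back puts \<open>g\<close> into
      \<open>C f\<close>.\<close>
    define y where "y = t e \<otimes> g \<otimes> t f"
    have ty: "t f \<otimes> y \<otimes> inv (t f) = g"
    proof -
      have "t f \<otimes> y \<otimes> inv (t f) = (t f \<otimes> inv (t f)) \<otimes> g \<otimes> (t f \<otimes> inv (t f))"
        unfolding y_def te using G by (simp only: m_assoc m_closed inv_closed)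
      then show ?thesis using G by simp
    qed
    have "y \<in> C (bar f)"
    proof (rule letter_eqD[OF 2(2) q])
      show "y \<in> carrier G" using G by (simp add: y_def)
      show "y \<in> B (head \<Gamma> f) \<or> t f \<otimes> y \<otimes> inv (t f) \<in> B (tail \<Gamma> f)" using g ef ty by simp
      show "letter f q = letter f (y \<otimes> q)"
        using eq' fe G q by (simp add: y_def m_assoc)
    qed
    then show ?thesis using t_conj[OF f, of y] ty fe by simp
  qed
qed

section \<open>The actions that detect the kernel\<close>

lemma action_T:
  assumes h: "h \<in> hom S.R (BijGroup UNIV)"
    "\<And>i. i < N \<Longrightarrow> h (S.x i) = map (shift Q (\<lambda>k. of_bool (k = i)))"
    "\<And>j. N \<le> j \<Longrightarrow> j < N + M \<Longrightarrow> h (S.x j) = lmul ((j, \<lambda>_. 0), True)"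
    and e: "e \<in> Ep" and p: "p \<in> carrier G"
  shows "h (T e p) = lmul (letter e p)"
proof -
  let ?W = "BijGroup (UNIV :: ((nat \<times> (nat \<Rightarrow> int)) \<times> bool) list set)"
  interpret h: group_hom S.R ?W h
    using h(1) S.R.is_group group_BijGroup by (simp add: group_hom_def group_hom_axioms_def)
  let ?v = "\<lambda>i. if i < N then \<psi> i (kpart e p) else 0" and ?l = "((lab e p, \<lambda>_. 0 :: int), True)"
  have k: "\<phi> (kpart e p) \<in> carrier S.R" using rep_decomp(2)[OF e p] by simp
  have hk: "h (\<phi> (kpart e p)) = map (shift Q ?v)"
    unfolding \<phi>_def by (rule S.word_action_monomial[OF h(1,2)])
  have hx: "h (S.x (lab e p)) = lmul ?l" using h(3) lab_bounds[OF e p] by blast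
  have "h (T e p) = map (shift Q (\<lambda>i. - ?v i)) \<otimes>\<^bsub>?W\<^esub> lmul ?l \<otimes>\<^bsub>?W\<^esub> map (shift Q ?v)"
    unfolding T_def using k x_lab_closed[OF e p] by (simp add: hk hx inv_map_shift)
  also have "\<dots> = map (shift Q (\<lambda>i. - ?v i)) \<circ> lmul ?l \<circ> map (shift Q ?v)"
    by (simp add: BijGroup_UNIV bij_map_shift bij_lmul bij_comp)
  also have "\<dots> = lmul (shift Q (\<lambda>i. - ?v i) ?l)"
  proof
    fix w
    have "shift Q (\<lambda>i. - ?v i) (shift Q ?v m) = m" for m
      by (simp only: shift_shift) (simp add: shift_zero)
    then have "map (shift Q (\<lambda>i. - ?v i)) (map (shift Q ?v) w) = w"
      by (simp add: map_idI)
    then show "(map (shift Q (\<lambda>i. - ?v i)) \<circ> lmul ?l \<circ> map (shift Q ?v)) w = lmul (shift Q (\<lambda>i. - ?v i) ?l) w"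
      by (simp only: o_apply flip: lmul_map_shift)
  qed
  finally show ?thesis by (simp add: letter_def)
qed

text \<open>In a reduced word every letter is put in front without cancellation, so the action on
  the empty word writes out the letters of the path.\<close>

lemma action_wval:
  assumes h: "h \<in> hom S.R (BijGroup UNIV)"
    "\<And>i. i < N \<Longrightarrow> h (S.x i) = map (shift Q (\<lambda>k. of_bool (k = i)))"
    "\<And>j. N \<le> j \<Longrightarrow> j < N + M \<Longrightarrow> h (S.x j) = lmul ((j, \<lambda>_. 0), True)"
    and "is_path u p g v" "reduced (letters L p g)"
  shows "h (fst (wval p g) \<one>) [] = letters L p g"
  using assms(4,5)
proof (induction u p g v rule: is_path.induct)
  case (1 u g v)
  then show ?case using h(1) hom_one[OF h(1) S.R.is_group group_BijGroup]
    by (simp add: E.const_def BijGroup_UNIV)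
next
  case (2 u f e p g v)
  let ?W = "BijGroup (UNIV :: ((nat \<times> (nat \<Rightarrow> int)) \<times> bool) list set)"
  interpret h: group_hom S.R ?W h
    using h(1) S.R.is_group group_BijGroup by (simp add: group_hom_def group_hom_axioms_def)
  have e: "e \<in> arcs \<Gamma>" and p: "is_path (head \<Gamma> e) p g v" using 2 by auto
  let ?q = "path_val p g"
  have q: "?q \<in> carrier G" using path_val_closed[OF p] .
  have c: "fst (\<tau> e) ?q \<in> carrier S.R" "fst (wval p g) \<one> \<in> carrier S.R"
    using E.W_closed(2)[OF \<tau>_closed[OF e] q] E.W_closed(2)[OF wval_closed[OF p]] by auto
  have \<tau>: "h (fst (\<tau> e) ?q) = lmul (L e ?q)"
  proof (cases "e \<in> Ep")
    case True
    then show ?thesis using action_T[OF h True q] q by (simp add: \<tau>_def L_def)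
  next
    case False
    then have be: "bar e \<in> Ep" and tq: "t e \<otimes> ?q \<in> carrier G" using Ep_bar[OF e] t_closed[OF e] q by auto
    then show ?thesis
      using action_T[OF h be tq] T_closed[OF be tq] False
      by (simp add: fst_\<tau>_neg[OF e False q] L_def inv_lmul)
  qed
  have red: "reduced (L e ?q # letters L p g)" using 2 by simp
  then have "h (fst (wval p g) \<one>) [] = letters L p g" using 2 p by (auto simp: reduced_Cons)
  moreover have "bij (h (fst (wval p g) \<one>))" using h.hom_closed[OF c(2)] by (simp add: BijGroup_UNIV)
  ultimately show ?case
    unfolding fst_wval_Cons[OF 2(2)] using c red
    by (simp add: \<tau> BijGroup_UNIV bij_lmul lmul_Cons)
qed

text \<open>Stable letters are read as conjugates of generators with labels from \<open>N\<close>
  on, or as inverses of these, and vertex elements as one; on all of them the exponent of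
  \<open>x i\<close> vanishes.\<close>

lemma exponent_wval:
  assumes i: "i < N" and h: "h \<in> hom S.R integer_group"
    "\<And>j. j < N + M \<Longrightarrow> h (S.x j) = (if j = i then 1 else 0)"
    and "is_path u p g v"
  shows "h (fst (wval p g) \<one>) = 0"
  using assms(4)
proof (induction u p g v rule: is_path.induct)
  case (1 u g v)
  then show ?case using hom_one[OF h(1) S.R.is_group group_integer_group] by (simp add: E.const_def)
next
  case (2 u f e p g v)
  interpret h: group_hom S.R integer_group h
    using h(1) S.R.is_group by (simp add: group_hom_def group_hom_axioms_def)
  have e: "e \<in> arcs \<Gamma>" and p: "is_path (head \<Gamma> e) p g v" using 2 by auto
  let ?q = "path_val p g"
  have q: "?q \<in> carrier G" using path_val_closed[OF p] .
  have c: "fst (\<tau> e) ?q \<in> carrier S.R" "fst (wval p g) \<one> \<in> carrier S.R"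
    using E.W_closed(2)[OF \<tau>_closed[OF e] q] E.W_closed(2)[OF wval_closed[OF p]] by auto
  have T0: "h (T f z) = 0" if "f \<in> Ep" "z \<in> carrier G" for f z
    using that rep_decomp(2)[OF that] x_lab_closed[OF that] lab_bounds[OF that] i
    by (simp add: T_def h(2))
  have "h (fst (\<tau> e) ?q) = 0"
  proof (cases "e \<in> Ep")
    case True
    then show ?thesis using T0 q by (simp add: \<tau>_def)
  next
    case False
    then have be: "bar e \<in> Ep" and tq: "t e \<otimes> ?q \<in> carrier G" using Ep_bar[OF e] t_closed[OF e] q by auto
    then show ?thesis using T0[OF be tq] T_closed[OF be tq] by (simp add: fst_\<tau>_neg[OF e False q])
  qed
  then show ?case unfolding fst_wval_Cons[OF 2(2)] using c 2 p by simp
qed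

text \<open>An element of the kernel is tested on a reduced path: exponents recover its characters,
  and the action on words recovers the edges of the path.\<close>

theorem virtually_special:
  assumes \<Theta>: "\<Theta> \<in> hom G E.W" "\<And>p g. is_path v0 p g v0 \<Longrightarrow> \<Theta> (path_val p g) = wval p g"
  shows "virtually_special G"
proof -
  have snd_\<Theta>: "snd (\<Theta> g) = g" if "g \<in> carrier G" for g
    using generated[OF that] \<Theta>(2) snd_wval by metis
  define \<Phi> where "\<Phi> k = \<phi> k \<otimes>\<^bsub>S.R\<^esub> fst (\<Theta> k) \<one>" for k
  have hom: "\<Phi> \<in> hom (G\<lparr>carrier := K\<rparr>) S.R"
    unfolding \<Phi>_def using \<Theta>(1) snd_\<Theta> by (rule E.untwist_hom)
  interpret \<Phi>: group_hom "G\<lparr>carrier := K\<rparr>" S.R \<Phi>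
    using hom S.R.is_group subgroup.subgroup_is_group[OF K_subgroup is_group]
    by (simp add: group_hom_def group_hom_axioms_def)
  have "k = \<one>" if k: "k \<in> K" and one: "\<Phi> k = \<one>\<^bsub>S.R\<^esub>" for k
  proof -
    obtain p0 g0 where p0: "is_path v0 p0 g0 v0" "path_val p0 g0 = k"
      using generated[OF K_closed[OF k]] by blast
    obtain p g where p: "is_path v0 p g v0" "path_val p g = k" "reduced (letters L p g)"
    proof (rule reduced_path[where L = L])
      show "is_path v0 p0 g0 v0" by (rule p0)
    qed (use L_backtrack p0(2) in auto)
    have \<Theta>k: "\<Theta> k = wval p g" using \<Theta>(2)[OF p(1)] p(2) by simp
    have c: "fst (wval p g) \<one> \<in> carrier S.R" using E.W_closed(2)[OF wval_closed[OF p(1)]] by simp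
    \<comment> \<open>In the exponent of \<open>x i\<close> the reading of the path contributes
      nothing, and what is left is the value of the character.\<close>
    have \<psi>0: "\<psi> i k = 0" if i: "i < N" for i
    proof -
      obtain h where h: "h \<in> hom S.R integer_group" "\<And>j. j < N + M \<Longrightarrow> h (S.x j) = (if j = i then 1 else 0)"
        using S.exponent_hom[OF i] by blast
      interpret h: group_hom S.R integer_group h
        using h(1) S.R.is_group by (simp add: group_hom_def group_hom_axioms_def)
      have "h (\<Phi> k) = h (\<phi> k) + h (fst (wval p g) \<one>)"
        unfolding \<Phi>_def \<Theta>k using k c by simp
      moreover have "h (\<phi> k) = (\<Sum>j<N. \<psi> j k * (if j = i then 1 else 0))"
      proof -
        have "h (\<phi> k) = monomial integer_group (\<lambda>j. h (S.x j)) (\<lambda>j. \<psi> j k) N"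
          unfolding \<phi>_def by (rule hom_monomial[OF S.R.is_group group_integer_group h(1)]) simp
        also have "\<dots> = monomial integer_group (\<lambda>j. if j = i then 1 else 0) (\<lambda>j. \<psi> j k) N"
          by (rule monomial_cong) (simp add: h(2))
        also have "\<dots> = (\<Sum>j<N. \<psi> j k * (if j = i then 1 else 0))"
          by (rule monomial_integer_group)
        finally show ?thesis .
      qed
      moreover have "(\<Sum>j<N. \<psi> j k * (if j = i then 1 else 0)) = \<psi> i k"
        using i by (simp add: if_distrib cong: if_cong)
      ultimately show ?thesis
        using exponent_wval[OF i h p(1)] h.hom_one unfolding one by simp
    qed
    then have "\<phi> k = \<one>\<^bsub>S.R\<^esub>" unfolding \<phi>_def by (rule S.R.monomial_zero)
    then have "fst (wval p g) \<one> = \<one>\<^bsub>S.R\<^esub>" using one c unfolding \<Phi>_def \<Theta>k by simp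
    moreover obtain h where h: "h \<in> hom S.R (BijGroup UNIV)"
      "\<And>i. i < N \<Longrightarrow> h (S.x i) = map (shift Q (\<lambda>k. of_bool (k = i)))"
      "\<And>j. N \<le> j \<Longrightarrow> j < N + M \<Longrightarrow> h (S.x j) = lmul ((j, \<lambda>_. 0), True)"
      using S.word_action by blast
    \<comment> \<open>The trivial element fixes the empty word, which the action carries to the
      letters of the path; so the path has no edges and \<open>k\<close> lies in
      \<open>B v0\<close>.\<close>
    ultimately have "letters L p g = []"
      using action_wval[OF h p(1,3)] hom_one[OF h(1) S.R.is_group group_BijGroup]
      by (simp add: BijGroup_UNIV)
    then have "p = []" by (cases p) auto
    then have "k \<in> B v0" using p by simp
    then show ?thesis using separated_v0[OF k] \<psi>0 by blast
  qed
  then have "inj_on \<Phi> K"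
    using \<Phi>.inj_on_one_iff by simp
  then show ?thesis
    unfolding virtually_special_def using K hom graph_split_graph by blast
qed

end

section \<open>Fundamental groups of tubular graphs of groups\<close>

theorem proposition1p10:
  fixes H :: "'h monoid"
    and \<Gamma> T :: "('v, 'e) pre_digraph"
    and bar :: "'e \<Rightarrow> 'e"
    and Gv :: "'v \<Rightarrow> 'g monoid"
    and Ge :: "'e \<Rightarrow> 'k monoid"
    and emb :: "'e \<Rightarrow> 'k \<Rightarrow> 'g"
    and Epos :: "'e set"
  assumes "tubular_graph_of_groups \<Gamma> bar Gv Ge emb"
    and "maximal_tree \<Gamma> bar T"
    and "orientation \<Gamma> bar Epos"
    and "group H"
    and "H \<cong> fundamental_group \<Gamma> bar Gv Ge emb T Epos"
    and "VRC H"
  shows "virtually_special H"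
proof -
  interpret \<Gamma>: tubular_graph_of_groups \<Gamma> bar Gv Ge emb by (rule assms(1))
  interpret H: group H by (rule assms(4))
  interpret S: serre_graph \<Gamma> bar
    by (intro serre_graph.intro serre_graph_axioms.intro \<Gamma>.wf_digraph)
      (simp_all add: \<Gamma>.arev_neq)
  have T: "subgraph T \<Gamma>" "serre_tree bar T"
    using assms(2) by (auto simp: maximal_tree_def pre_digraph.max_subgraph_def)
  have span: "verts T = verts \<Gamma>"
    by (rule S.maximal_tree_spanning[OF \<Gamma>.connected_graph assms(2)])
  have TG: "tail T = tail \<Gamma>" "head T = head \<Gamma>" "arcs T \<subseteq> arcs \<Gamma>" and wfT: "wf_digraph T"
    using T by (auto simp: subgraph_def compatible_def)
  have barT: "bar ` arcs T \<subseteq> arcs T" and connT: "Digraph_Component.connected T"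
    using T by (auto simp: serre_tree_def)
  interpret T: serre_graph T bar
    using wfT barT TG by (auto simp: serre_graph_def serre_graph_axioms_def S.bar_neq subset_iff)
  obtain v0 where v0: "v0 \<in> verts \<Gamma>"
    using \<Gamma>.connected_graph by (auto simp: Digraph_Component.connected_def strongly_connected_def)
  have Epos: "Epos \<subseteq> arcs \<Gamma>" "\<And>e. e \<in> arcs \<Gamma> \<Longrightarrow> bar e \<in> Epos \<longleftrightarrow> e \<notin> Epos"
  proof -
    show "Epos \<subseteq> arcs \<Gamma>" using assms(3) by (auto simp: orientation_def)
    fix e assume "e \<in> arcs \<Gamma>"
    then show "bar e \<in> Epos \<longleftrightarrow> e \<notin> Epos"
      using assms(3) unfolding orientation_def by (metis Un_iff \<Gamma>.arev_arev disjoint_iff image_eqI imageE)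
  qed

  \<comment> \<open>Images of vertex groups, edge groups and stable letters in
    \<open>H\<close>\<close>
  let ?X = "pi1_gens \<Gamma> Gv Epos" and ?R = "pi1_rels \<Gamma> bar Gv Ge emb T Epos"
  \<comment> \<open>\<open>W\<close> gets the type of the cocycle group, which can be built only
    once the characters are known.\<close>
  obtain \<eta> where \<eta>: "\<eta> \<in> ?X \<rightarrow> carrier H"
    and rel: "\<And>u v. (u, v) \<in> ?R \<Longrightarrow> u \<in> words ?X \<Longrightarrow> v \<in> words ?X \<Longrightarrow> word_eval H \<eta> u = word_eval H \<eta> v"
    and gens: "\<And>h. h \<in> carrier H \<Longrightarrow> \<exists>w\<in>words ?X. h = word_eval H \<eta> w"
    and lift: "\<And>(W :: (('h \<Rightarrow> nat word set) \<times> 'h) monoid) f. group W \<Longrightarrow> f \<in> ?X \<rightarrow> carrier W \<Longrightarrow>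
       (\<And>u v. (u, v) \<in> ?R \<Longrightarrow> u \<in> words ?X \<Longrightarrow> v \<in> words ?X \<Longrightarrow> word_eval W f u = word_eval W f v) \<Longrightarrow>
       \<exists>\<Theta>\<in>hom H W. \<forall>x\<in>?X. \<Theta> (\<eta> x) = f x"
    by (rule iso_presented_group[OF assms(4), where 'w = "('h \<Rightarrow> nat word set) \<times> 'h" and 'n = unit])
      (use assms(5) in \<open>auto simp: fundamental_group_def\<close>)
  have X_vertex: "Vertex_Elem v g \<in> ?X \<longleftrightarrow> v \<in> verts \<Gamma> \<and> g \<in> carrier (Gv v)" for v g
    by (auto simp: pi1_gens_def)
  have X_edge: "Stable_Letter e \<in> ?X \<longleftrightarrow> e \<in> Epos" for e
    by (auto simp: pi1_gens_def)
  define \<iota> where "\<iota> v g = \<eta> (Vertex_Elem v g)" for v g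
  have \<iota>_closed: "\<iota> v g \<in> carrier H" if "v \<in> verts \<Gamma>" "g \<in> carrier (Gv v)" for v g
    using \<eta> X_vertex that by (auto simp: \<iota>_def)
  have s_closed: "\<eta> (Stable_Letter e) \<in> carrier H" if "e \<in> Epos" for e
    using \<eta> X_edge that by auto
  have \<iota>_hom: "\<iota> v \<in> hom (Gv v) H" if v: "v \<in> verts \<Gamma>" for v
  proof (rule homI)
    show "\<iota> v g \<in> carrier H" if "g \<in> carrier (Gv v)" for g using \<iota>_closed v that by blast
    fix g h assume gh: "g \<in> carrier (Gv v)" "h \<in> carrier (Gv v)"
    have "g \<otimes>\<^bsub>Gv v\<^esub> h \<in> carrier (Gv v)"
      using gh \<Gamma>.vertex_group[OF v] by (simp add: group.is_monoid monoid.m_closed)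
    moreover have "(gen (Vertex_Elem v g) @ gen (Vertex_Elem v h), gen (Vertex_Elem v (g \<otimes>\<^bsub>Gv v\<^esub> h))) \<in> ?R"
      unfolding pi1_rels_def using v gh by blast
    ultimately have "word_eval H \<eta> (gen (Vertex_Elem v g) @ gen (Vertex_Elem v h))
        = word_eval H \<eta> (gen (Vertex_Elem v (g \<otimes>\<^bsub>Gv v\<^esub> h)))"
      using v gh X_vertex by (intro rel) auto
    then show "\<iota> v (g \<otimes>\<^bsub>Gv v\<^esub> h) = \<iota> v g \<otimes>\<^bsub>H\<^esub> \<iota> v h"
      using \<iota>_closed[OF v gh(1)] \<iota>_closed[OF v gh(2)] \<iota>_closed[OF v \<open>g \<otimes>\<^bsub>Gv v\<^esub> h \<in> carrier (Gv v)\<close>]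
      by (simp add: \<iota>_def)
  qed
  define t where "t e = (if e \<in> Epos then \<eta> (Stable_Letter e) else inv\<^bsub>H\<^esub> \<eta> (Stable_Letter (bar e)))" for e
  define B where "B v = \<iota> v ` carrier (Gv v)" for v
  define j where "j e a = \<iota> (tail \<Gamma> e) (emb e a)" for e a
  define C where "C e = j e ` carrier (Ge e)" for e
  have j_hom: "j e \<in> hom (Ge e) H" if e: "e \<in> arcs \<Gamma>" for e
    using hom_compose[OF \<Gamma>.emb_hom[OF e] \<iota>_hom] e by (simp add: j_def[abs_def] comp_def)
  have emb_closed: "emb e a \<in> carrier (Gv (tail \<Gamma> e))" if "e \<in> arcs \<Gamma>" "a \<in> carrier (Ge e)" for e a
    using hom_in_carrier[OF \<Gamma>.emb_hom] that by blast
  have t_closed: "t e \<in> carrier H" if "e \<in> arcs \<Gamma>" for e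
    using s_closed Epos(2)[OF that] by (simp add: t_def)
  have t_bar: "t (bar e) = inv\<^bsub>H\<^esub> t e" if "e \<in> arcs \<Gamma>" for e
    using s_closed Epos(2)[OF that] by (simp add: t_def)
  have t_pos: "t e \<otimes>\<^bsub>H\<^esub> j (bar e) a \<otimes>\<^bsub>H\<^esub> inv\<^bsub>H\<^esub> t e = j e a" if e: "e \<in> Epos" and a: "a \<in> carrier (Ge e)" for e a
  proof -
    have eG: "e \<in> arcs \<Gamma>" and be: "bar e \<in> arcs \<Gamma>" using e Epos by auto
    have a': "emb (bar e) a \<in> carrier (Gv (head \<Gamma> e))" "emb e a \<in> carrier (Gv (tail \<Gamma> e))"
      using emb_closed[OF be, of a] emb_closed[OF eG a] a \<Gamma>.edge_group_bar[OF eG] eG by simp_all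
    have "word_eval H \<eta> (gen (Stable_Letter e) @ gen (Vertex_Elem (head \<Gamma> e) (emb (bar e) a)) @ gen_inv (Stable_Letter e))
       = word_eval H \<eta> (gen (Vertex_Elem (tail \<Gamma> e) (emb e a)))"
    proof (rule rel)
      show "(gen (Stable_Letter e) @ gen (Vertex_Elem (head \<Gamma> e) (emb (bar e) a)) @ gen_inv (Stable_Letter e),
          gen (Vertex_Elem (tail \<Gamma> e) (emb e a))) \<in> ?R"
        unfolding pi1_rels_def using e a by blast
    qed (use e eG a' X_vertex X_edge in auto)
    moreover have "\<eta> (Vertex_Elem (head \<Gamma> e) (emb (bar e) a)) \<in> carrier H"
      "\<eta> (Vertex_Elem (tail \<Gamma> e) (emb e a)) \<in> carrier H"
      using \<iota>_closed a' eG by (auto simp: \<iota>_def)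
    ultimately show ?thesis
      using s_closed[OF e] e eG by (simp add: t_def j_def \<iota>_def H.m_assoc)
  qed
  have t_conj: "t e \<otimes>\<^bsub>H\<^esub> c \<otimes>\<^bsub>H\<^esub> inv\<^bsub>H\<^esub> t e \<in> C e" if e: "e \<in> arcs \<Gamma>" and c: "c \<in> C (bar e)" for e c
  proof -
    obtain a where a: "a \<in> carrier (Ge e)" "c = j (bar e) a"
      using c \<Gamma>.edge_group_bar[OF e] by (auto simp: C_def)
    have be: "bar e \<in> arcs \<Gamma>" using e by simp
    have jc: "j e a \<in> carrier H" using hom_in_carrier[OF j_hom[OF e]] a by blast
    show ?thesis
    proof (cases "e \<in> Epos")
      case True
      then show ?thesis using t_pos[OF True a(1)] a by (auto simp: C_def)
    next
      case False
      then have "bar e \<in> Epos" using Epos(2)[OF e] by simp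
      then have "c = inv\<^bsub>H\<^esub> t e \<otimes>\<^bsub>H\<^esub> j e a \<otimes>\<^bsub>H\<^esub> inv\<^bsub>H\<^esub> (inv\<^bsub>H\<^esub> t e)"
        using t_pos[of "bar e" a] a \<Gamma>.edge_group_bar[OF e] t_bar[OF e] by simp
      then have "t e \<otimes>\<^bsub>H\<^esub> c \<otimes>\<^bsub>H\<^esub> inv\<^bsub>H\<^esub> t e
          = (t e \<otimes>\<^bsub>H\<^esub> inv\<^bsub>H\<^esub> t e) \<otimes>\<^bsub>H\<^esub> j e a \<otimes>\<^bsub>H\<^esub> (t e \<otimes>\<^bsub>H\<^esub> inv\<^bsub>H\<^esub> t e)"
        using t_closed[OF e] jc by (simp only: H.inv_inv H.m_assoc H.m_closed H.inv_closed)
      then have "t e \<otimes>\<^bsub>H\<^esub> c \<otimes>\<^bsub>H\<^esub> inv\<^bsub>H\<^esub> t e = j e a" using t_closed[OF e] jc by simp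
      then show ?thesis using a by (auto simp: C_def)
    qed
  qed
  interpret L: generated_along_graph H \<Gamma> bar B C t v0
  proof (intro generated_along_graph.intro generated_along_graph_axioms.intro H.is_group S.serre_graph_axioms)
    show "subgroup (B v) H" if v: "v \<in> verts \<Gamma>" for v
    proof -
      interpret i: group_hom "Gv v" H "\<iota> v"
        using \<Gamma>.vertex_group[OF v] \<iota>_hom[OF v] H.is_group by (simp add: group_hom_def group_hom_axioms_def)
      show ?thesis unfolding B_def by (rule i.img_is_subgroup)
    qed
    show "subgroup (C e) H" if e: "e \<in> arcs \<Gamma>" for e
    proof -
      interpret i: group_hom "Ge e" H "j e"
        using \<Gamma>.edge_group[OF e] j_hom[OF e] H.is_group by (simp add: group_hom_def group_hom_axioms_def)
      show ?thesis unfolding C_def by (rule i.img_is_subgroup)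
    qed
    show "C e \<subseteq> B (tail \<Gamma> e)" if "e \<in> arcs \<Gamma>" for e
      using emb_closed[OF that] by (auto simp: C_def B_def j_def)
  qed (rule t_closed t_bar t_conj; assumption)+
  have t_tree: "t f = \<one>\<^bsub>H\<^esub>" if f: "f \<in> arcs T" for f
  proof -
    have pos: "\<eta> (Stable_Letter f) = \<one>\<^bsub>H\<^esub>" if "f \<in> arcs T \<inter> Epos" for f
    proof -
      have "(gen (Stable_Letter f), []) \<in> ?R" unfolding pi1_rels_def using that by blast
      then have "word_eval H \<eta> (gen (Stable_Letter f)) = word_eval H \<eta> []"
        using that X_edge by (intro rel) auto
      then show ?thesis using s_closed[of f] that by simp
    qed
    show ?thesis
    proof (cases "f \<in> Epos")
      case False
      then have "bar f \<in> arcs T \<inter> Epos" using f Epos(2)[of f] TG barT by auto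
      then show ?thesis using pos False by (simp add: t_def)
    qed (use pos f in \<open>simp add: t_def\<close>)
  qed
  have tree_joined: "L.joined u v \<one>\<^bsub>H\<^esub>" if "u \<in> verts \<Gamma>" "v \<in> verts \<Gamma>" for u v
    by (rule L.joined_along_tree[OF T(1) barT connT span t_tree that])
  \<comment> \<open>Between two tree paths of value one, a vertex element or a stable letter becomes
    the value of a loop at \<open>v0\<close>, and loops can be concatenated.\<close>
  have loops: "L.joined v0 v0 h" if h: "h \<in> carrier H" for h
  proof -
    have via: "L.joined v0 v0 k" if k: "L.joined u v k" "u \<in> verts \<Gamma>" "v \<in> verts \<Gamma>" "k \<in> carrier H" for u v k
    proof -
      have "L.joined v0 v0 (\<one>\<^bsub>H\<^esub> \<otimes>\<^bsub>H\<^esub> k \<otimes>\<^bsub>H\<^esub> \<one>\<^bsub>H\<^esub>)"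
        using tree_joined[OF v0 k(2)] tree_joined[OF k(3) v0] k(1) by (blast intro: L.joined_trans)
      then show ?thesis using k(4) by simp
    qed
    have letter: "L.joined v0 v0 (if s then \<eta> x else inv\<^bsub>H\<^esub> \<eta> x)" if x: "x \<in> ?X" for x s
    proof -
      consider v g where "x = Vertex_Elem v g" "v \<in> verts \<Gamma>" "g \<in> carrier (Gv v)"
        | e where "x = Stable_Letter e" "e \<in> Epos"
        using x by (auto simp: pi1_gens_def)
      then show ?thesis
      proof cases
        case 1
        have "\<eta> x \<in> B v" using 1 by (auto simp: B_def \<iota>_def)
        then have b: "(if s then \<eta> x else inv\<^bsub>H\<^esub> \<eta> x) \<in> B v"
          using subgroup.m_inv_closed[OF L.B_subgroup[OF 1(2)]] by simp
        show ?thesis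
          by (rule via[OF L.joined_vertex[OF 1(2) b] 1(2) 1(2) L.B_closed[OF 1(2) b]])
      next
        case 2
        then have e: "e \<in> arcs \<Gamma>" "bar e \<in> arcs \<Gamma>" using Epos by auto
        have "t e = \<eta> x" "t (bar e) = inv\<^bsub>H\<^esub> \<eta> x" using 2 t_bar[OF e(1)] by (simp_all add: t_def)
        moreover have "L.joined v0 v0 (t e)"
          by (rule via[OF L.joined_edge[OF e(1)] _ _ t_closed[OF e(1)]]) (simp_all add: e)
        moreover have "L.joined v0 v0 (t (bar e))"
          by (rule via[OF L.joined_edge[OF e(2)] _ _ t_closed[OF e(2)]]) (simp_all add: e)
        ultimately show ?thesis by simp
      qed
    qed
    obtain w where w: "w \<in> words ?X" "h = word_eval H \<eta> w" using gens[OF h] by blast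
    have "L.joined v0 v0 (word_eval H \<eta> w)"
      using w(1)
    proof (induction w)
      case Nil
      then show ?case
        using L.joined_vertex[OF v0 subgroup.one_closed[OF L.B_subgroup[OF v0]]] by simp
    next
      case (Cons xs w)
      obtain x s where xs: "xs = (x, s)" by (cases xs)
      then have "L.joined v0 v0 ((if s then \<eta> x else inv\<^bsub>H\<^esub> \<eta> x) \<otimes>\<^bsub>H\<^esub> word_eval H \<eta> w)"
        using Cons letter[of x s] by (intro L.joined_trans[of v0 v0]) auto
      then show ?case by (simp add: xs)
    qed
    then show ?thesis using w by simp
  qed

  \<comment> \<open>The subgroups to be separated and their characters\<close>
  have bicyclic_B: "H.bicyclic (B v)" if v: "v \<in> verts \<Gamma>" for v
  proof -
    let ?F = "free_Abelian_group {..<2::nat}"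
    have "?F \<cong> Gv v"
      using \<Gamma>.vertex_free_abelian_rank_2[OF v] \<Gamma>.vertex_group[OF v] by (rule group.iso_sym[rotated])
    then obtain k where k: "k \<in> iso ?F (Gv v)" by (auto simp: is_iso_def)
    then have "\<iota> v \<circ> k \<in> hom ?F H" using \<iota>_hom[OF v] by (auto simp: iso_def intro: hom_compose)
    moreover have "(\<iota> v \<circ> k) ` carrier ?F = B v"
      using k unfolding B_def image_comp[symmetric] by (simp add: iso_def bij_betw_def)
    ultimately show ?thesis using H.bicyclic_image_free_Abelian by metis
  qed
  have cyclic_C: "\<exists>c\<in>carrier H. C e = range (\<lambda>n::int. c [^]\<^bsub>H\<^esub> n)" if e: "e \<in> arcs \<Gamma>" for e
    unfolding C_def
    using \<Gamma>.edge_group[OF e] H.is_group \<Gamma>.edge_infinite_cyclic[OF e] j_hom[OF e]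
    by (intro hom_image_cyclic) auto
  \<comment> \<open>The vertex group at the tail, carried to the head side by the stable letter, so
    that the groups at both ends contain the same \<open>C (bar e)\<close>.\<close>
  define B' where "B' e = {y \<in> carrier H. t e \<otimes>\<^bsub>H\<^esub> y \<otimes>\<^bsub>H\<^esub> inv\<^bsub>H\<^esub> t e \<in> B (tail \<Gamma> e)}" for e
  \<comment> \<open>Separating the trivial subgroup from \<open>B v0\<close> makes the characters
    jointly injective on \<open>K \<inter> B v0\<close>, as \<open>separated_v0\<close>
    demands.\<close>
  define \<L> where "\<L> = insert (B v0, {\<one>\<^bsub>H\<^esub>})
    ((\<lambda>e. (B (head \<Gamma> e), C (bar e))) ` Epos \<union> (\<lambda>e. (B' e, C (bar e))) ` Epos)"
  have "finite Epos" using Epos(1) \<Gamma>.finite_arcs finite_subset by blast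
  then have fin_\<L>: "finite \<L>" by (simp add: \<L>_def)
  have pairs: "H.bicyclic D \<and> F \<subseteq> D \<and> (\<exists>c\<in>carrier H. F = range (\<lambda>n::int. c [^]\<^bsub>H\<^esub> n))"
    if DF: "(D, F) \<in> \<L>" for D F
  proof -
    consider "D = B v0" "F = {\<one>\<^bsub>H\<^esub>}" | e where "e \<in> Epos" "D = B (head \<Gamma> e)" "F = C (bar e)"
      | e where "e \<in> Epos" "D = B' e" "F = C (bar e)"
      using DF by (auto simp: \<L>_def)
    then show ?thesis
    proof cases
      case 1
      have "{\<one>\<^bsub>H\<^esub>} = range (\<lambda>n::int. \<one>\<^bsub>H\<^esub> [^]\<^bsub>H\<^esub> n)" by auto
      then show ?thesis
        using 1 bicyclic_B[OF v0] subgroup.one_closed[OF L.B_subgroup[OF v0]] by blast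
    next
      case 2
      then have e: "e \<in> arcs \<Gamma>" "bar e \<in> arcs \<Gamma>" using Epos by auto
      show ?thesis
        using 2 bicyclic_B[of "head \<Gamma> e"] L.C_subset[OF e(2)] cyclic_C[OF e(2)] e by auto
    next
      case 3
      then have e: "e \<in> arcs \<Gamma>" "bar e \<in> arcs \<Gamma>" using Epos by auto
      have "C (bar e) \<subseteq> B' e"
        unfolding B'_def using L.C_subset[OF e(1)] t_conj[OF e(1)] subgroup.subset[OF L.C_subgroup[OF e(2)]]
        by blast
      moreover have "H.bicyclic (B' e)"
        unfolding B'_def using bicyclic_B[of "tail \<Gamma> e"] t_closed[OF e(1)] e by (intro H.bicyclic_conj) auto
      ultimately show ?thesis using 3 cyclic_C[OF e(2)] by auto
    qed
  qed
  obtain K \<psi> and N :: nat where K: "finite_index_subgroup K H"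
    and \<psi>: "\<And>i. i < N \<Longrightarrow> H.additive_on K (\<psi> i)"
    and sep: "\<And>D F g x. (D, F) \<in> \<L> \<Longrightarrow> g \<in> carrier H \<Longrightarrow> x \<in> K \<Longrightarrow> g \<otimes>\<^bsub>H\<^esub> x \<otimes>\<^bsub>H\<^esub> inv\<^bsub>H\<^esub> g \<in> D \<Longrightarrow>
       (\<And>i. i < N \<Longrightarrow> (\<And>y. y \<in> K \<Longrightarrow> g \<otimes>\<^bsub>H\<^esub> y \<otimes>\<^bsub>H\<^esub> inv\<^bsub>H\<^esub> g \<in> F \<Longrightarrow> \<psi> i y = 0) \<Longrightarrow> \<psi> i x = 0) \<Longrightarrow>
       g \<otimes>\<^bsub>H\<^esub> x \<otimes>\<^bsub>H\<^esub> inv\<^bsub>H\<^esub> g \<in> F"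
  proof (rule H.VRC_separating_characters[OF assms(6) fin_\<L> pairs], goal_cases)
    case (1 D F)
    show ?case by (rule 1(2))
  next
    case (2 K \<psi> N)
    show ?case by (rule 2(1)[OF 2(2,3)], assumption, rule 2(4), assumption+, blast)
  qed
  have KH: "K \<subseteq> carrier H" using K by (auto simp: finite_index_subgroup_def dest: subgroup.subset)
  interpret A: separated_along_graph H \<Gamma> bar B C t v0 Epos K \<psi> N
  proof (intro separated_along_graph.intro separated_along_graph_axioms.intro L.generated_along_graph_axioms)
    show "finite (arcs \<Gamma>)" by simp
    show "v0 \<in> verts \<Gamma>" by (rule v0)
    show "\<exists>p h. L.is_path v0 p h v0 \<and> L.path_val p h = g" if "g \<in> carrier H" for g
      using loops[OF that] by (simp add: L.joined_def)
    show "finite_index_subgroup K H" by (rule K)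
    show "H.additive_on K (\<psi> i)" if "i < N" for i using \<psi>[OF that] .
    show "bar e \<in> Epos \<longleftrightarrow> e \<notin> Epos" if "e \<in> arcs \<Gamma>" for e using Epos(2)[OF that] .
    show "e \<in> arcs \<Gamma>" if "e \<in> Epos" for e using Epos(1) that by blast
    show "x = \<one>\<^bsub>H\<^esub>" if x: "x \<in> K" "x \<in> B v0" "\<And>i. i < N \<Longrightarrow> \<psi> i x = 0" for x
    proof -
      have conj1: "\<one>\<^bsub>H\<^esub> \<otimes>\<^bsub>H\<^esub> x \<otimes>\<^bsub>H\<^esub> inv\<^bsub>H\<^esub> \<one>\<^bsub>H\<^esub> = x"
        using x(1) KH by (simp add: subset_iff)
      have "\<one>\<^bsub>H\<^esub> \<otimes>\<^bsub>H\<^esub> x \<otimes>\<^bsub>H\<^esub> inv\<^bsub>H\<^esub> \<one>\<^bsub>H\<^esub> \<in> {\<one>\<^bsub>H\<^esub>}"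
      proof (rule sep[OF _ H.one_closed x(1)])
        show "(B v0, {\<one>\<^bsub>H\<^esub>}) \<in> \<L>" by (simp add: \<L>_def)
        show "\<one>\<^bsub>H\<^esub> \<otimes>\<^bsub>H\<^esub> x \<otimes>\<^bsub>H\<^esub> inv\<^bsub>H\<^esub> \<one>\<^bsub>H\<^esub> \<in> B v0" unfolding conj1 by (rule x(2))
        show "\<psi> i x = 0" if "i < N" for i by (rule x(3)[OF that])
      qed
      then show ?thesis unfolding conj1 by simp
    qed
    fix e g x
    assume e: "e \<in> Epos" and g: "g \<in> carrier H" and x: "x \<in> K"
      and disj: "g \<otimes>\<^bsub>H\<^esub> x \<otimes>\<^bsub>H\<^esub> inv\<^bsub>H\<^esub> g \<in> B (head \<Gamma> e) \<or>
        t e \<otimes>\<^bsub>H\<^esub> (g \<otimes>\<^bsub>H\<^esub> x \<otimes>\<^bsub>H\<^esub> inv\<^bsub>H\<^esub> g) \<otimes>\<^bsub>H\<^esub> inv\<^bsub>H\<^esub> t e \<in> B (tail \<Gamma> e)"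
      and van: "\<And>i. i < N \<Longrightarrow> (\<And>y. y \<in> K \<Longrightarrow> g \<otimes>\<^bsub>H\<^esub> y \<otimes>\<^bsub>H\<^esub> inv\<^bsub>H\<^esub> g \<in> C (bar e) \<Longrightarrow> \<psi> i y = 0) \<Longrightarrow> \<psi> i x = 0"
    have "g \<otimes>\<^bsub>H\<^esub> x \<otimes>\<^bsub>H\<^esub> inv\<^bsub>H\<^esub> g \<in> carrier H" using g x KH by auto
    then have "g \<otimes>\<^bsub>H\<^esub> x \<otimes>\<^bsub>H\<^esub> inv\<^bsub>H\<^esub> g \<in> B (head \<Gamma> e) \<or> g \<otimes>\<^bsub>H\<^esub> x \<otimes>\<^bsub>H\<^esub> inv\<^bsub>H\<^esub> g \<in> B' e"
      using disj by (simp add: B'_def)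
    then show "g \<otimes>\<^bsub>H\<^esub> x \<otimes>\<^bsub>H\<^esub> inv\<^bsub>H\<^esub> g \<in> C (bar e)"
    proof
      assume *: "g \<otimes>\<^bsub>H\<^esub> x \<otimes>\<^bsub>H\<^esub> inv\<^bsub>H\<^esub> g \<in> B (head \<Gamma> e)"
      have "(B (head \<Gamma> e), C (bar e)) \<in> \<L>" using e by (simp add: \<L>_def)
      from sep[OF this g x * van] show ?thesis .
    next
      assume *: "g \<otimes>\<^bsub>H\<^esub> x \<otimes>\<^bsub>H\<^esub> inv\<^bsub>H\<^esub> g \<in> B' e"
      have "(B' e, C (bar e)) \<in> \<L>" using e by (simp add: \<L>_def)
      from sep[OF this g x * van] show ?thesis .
    qed
  qed

  \<comment> \<open>The potential on the tree and the homomorphism to the cocycle group\<close>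
  have "finite (verts T)" using span \<Gamma>.finite_verts by simp
  moreover have "v0 \<in> verts T" using v0 span by simp
  moreover have "A.\<tau> \<in> arcs T \<rightarrow> carrier A.E.W" using A.\<tau>_closed TG by auto
  moreover have "A.\<tau> (bar e) = inv\<^bsub>A.E.W\<^esub> A.\<tau> e" if "e \<in> arcs T" for e using A.\<tau>_bar TG that by blast
  ultimately obtain \<gamma> where \<gamma>: "\<gamma> v0 = \<one>\<^bsub>A.E.W\<^esub>" "\<gamma> \<in> verts T \<rightarrow> carrier A.E.W"
    "\<And>e. e \<in> arcs T \<Longrightarrow> \<gamma> (head T e) = \<gamma> (tail T e) \<otimes>\<^bsub>A.E.W\<^esub> A.\<tau> e"
    using T.serre_tree_potential[OF T(2) _ _ A.E.W.is_group] by metis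
  have \<gamma>_closed: "\<gamma> v \<in> carrier A.E.W" if "v \<in> verts \<Gamma>" for v using \<gamma>(2) span that by auto
  have const_closed: "A.E.const g \<in> carrier A.E.W" if "g \<in> carrier H" for g
    using hom_in_carrier[OF A.E.const_hom that] .
  \<comment> \<open>Twisting by the potential at both ends: inner values telescope along a path by
    \<open>conj_mult\<close>, and a tree edge becomes one by the defining property of
    \<gamma>.\<close>
  define conj where "conj u w v = \<gamma> u \<otimes>\<^bsub>A.E.W\<^esub> w \<otimes>\<^bsub>A.E.W\<^esub> inv\<^bsub>A.E.W\<^esub> \<gamma> v" for u w v
  have conj_mult: "conj u w v \<otimes>\<^bsub>A.E.W\<^esub> conj v w' v' = conj u (w \<otimes>\<^bsub>A.E.W\<^esub> w') v'"
    if "u \<in> verts \<Gamma>" "v \<in> verts \<Gamma>" "v' \<in> verts \<Gamma>" "w \<in> carrier A.E.W" "w' \<in> carrier A.E.W" for u v v' w w'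
  proof -
    have "conj u w v \<otimes>\<^bsub>A.E.W\<^esub> conj v w' v' = \<gamma> u \<otimes>\<^bsub>A.E.W\<^esub> w \<otimes>\<^bsub>A.E.W\<^esub>
        (inv\<^bsub>A.E.W\<^esub> \<gamma> v \<otimes>\<^bsub>A.E.W\<^esub> \<gamma> v) \<otimes>\<^bsub>A.E.W\<^esub> w' \<otimes>\<^bsub>A.E.W\<^esub> inv\<^bsub>A.E.W\<^esub> \<gamma> v'"
      unfolding conj_def using that \<gamma>_closed
      by (simp only: A.E.W.m_assoc A.E.W.m_closed A.E.W.inv_closed)
    then show ?thesis unfolding conj_def using that \<gamma>_closed by (simp add: A.E.W.m_assoc)
  qed
  have conj_inv: "inv\<^bsub>A.E.W\<^esub> conj u w v = conj v (inv\<^bsub>A.E.W\<^esub> w) u"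
    if "u \<in> verts \<Gamma>" "v \<in> verts \<Gamma>" "w \<in> carrier A.E.W" for u v w
    unfolding conj_def using that \<gamma>_closed by (simp add: A.E.W.inv_mult_group A.E.W.m_assoc)
  have conj_closed: "conj u w v \<in> carrier A.E.W"
    if "u \<in> verts \<Gamma>" "v \<in> verts \<Gamma>" "w \<in> carrier A.E.W" for u v w
    unfolding conj_def using that \<gamma>_closed by simp
  define f where "f x = (case x of Vertex_Elem v g \<Rightarrow> conj v (A.E.const (\<iota> v g)) v
    | Stable_Letter e \<Rightarrow> conj (tail \<Gamma> e) (A.\<tau> e) (head \<Gamma> e))" for x
  have f_simps: "f (Vertex_Elem v g) = conj v (A.E.const (\<iota> v g)) v"
    "f (Stable_Letter e) = conj (tail \<Gamma> e) (A.\<tau> e) (head \<Gamma> e)" for v g e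
    by (simp_all add: f_def)
  have f_vertex: "f (Vertex_Elem v g) \<in> carrier A.E.W" if "v \<in> verts \<Gamma>" "g \<in> carrier (Gv v)" for v g
    unfolding f_simps using that by (intro conj_closed const_closed \<iota>_closed)
  have f_edge: "f (Stable_Letter e) \<in> carrier A.E.W" if "e \<in> Epos" for e
    unfolding f_simps using that Epos(1) by (intro conj_closed A.\<tau>_closed) auto
  have "\<exists>\<Theta>\<in>hom H A.E.W. \<forall>x\<in>?X. \<Theta> (\<eta> x) = f x"
  proof (rule lift[OF A.E.W.is_group])
    show "f \<in> ?X \<rightarrow> carrier A.E.W" using f_vertex f_edge by (auto simp: pi1_gens_def)
    fix u v assume uv: "(u, v) \<in> ?R" "u \<in> words ?X" "v \<in> words ?X"
    then consider (vertex) x g h where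
        "u = gen (Vertex_Elem x g) @ gen (Vertex_Elem x h)" "v = gen (Vertex_Elem x (g \<otimes>\<^bsub>Gv x\<^esub> h))"
        "x \<in> verts \<Gamma>" "g \<in> carrier (Gv x)" "h \<in> carrier (Gv x)"
      | (edge) e a where
        "u = gen (Stable_Letter e) @ gen (Vertex_Elem (head \<Gamma> e) (emb (bar e) a)) @ gen_inv (Stable_Letter e)"
        "v = gen (Vertex_Elem (tail \<Gamma> e) (emb e a))" "e \<in> Epos" "a \<in> carrier (Ge e)"
      | (tree) e where "u = gen (Stable_Letter e)" "v = []" "e \<in> arcs T" "e \<in> Epos"
      unfolding pi1_rels_def by auto
    then show "word_eval A.E.W f u = word_eval A.E.W f v"
    proof cases
      case vertex
      have gh: "g \<otimes>\<^bsub>Gv x\<^esub> h \<in> carrier (Gv x)"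
        using vertex \<Gamma>.vertex_group by (simp add: group.is_monoid monoid.m_closed)
      have "A.E.const (\<iota> x (g \<otimes>\<^bsub>Gv x\<^esub> h)) = A.E.const (\<iota> x g) \<otimes>\<^bsub>A.E.W\<^esub> A.E.const (\<iota> x h)"
        using vertex \<iota>_closed by (simp add: hom_mult[OF \<iota>_hom] hom_mult[OF A.E.const_hom])
      then have "f (Vertex_Elem x g) \<otimes>\<^bsub>A.E.W\<^esub> f (Vertex_Elem x h) = f (Vertex_Elem x (g \<otimes>\<^bsub>Gv x\<^esub> h))"
        unfolding f_simps using vertex \<iota>_closed const_closed by (simp add: conj_mult)
      then show ?thesis using vertex gh f_vertex by simp
    next
      case edge
      then have e: "e \<in> arcs \<Gamma>" "bar e \<in> arcs \<Gamma>" using Epos by auto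
      have a: "emb (bar e) a \<in> carrier (Gv (head \<Gamma> e))" "emb e a \<in> carrier (Gv (tail \<Gamma> e))"
        using emb_closed[OF e(2), of a] emb_closed[OF e(1)] edge \<Gamma>.edge_group_bar[OF e(1)] e by simp_all
      have j: "\<iota> (head \<Gamma> e) (emb (bar e) a) = j (bar e) a" "\<iota> (tail \<Gamma> e) (emb e a) = j e a"
        using e by (simp_all add: j_def)
      have "j (bar e) a \<in> C (bar e)" using edge \<Gamma>.edge_group_bar[OF e(1)] by (auto simp: C_def)
      then have "A.\<tau> e \<otimes>\<^bsub>A.E.W\<^esub> A.E.const (j (bar e) a) \<otimes>\<^bsub>A.E.W\<^esub> inv\<^bsub>A.E.W\<^esub> A.\<tau> e = A.E.const (j e a)"
        using A.\<tau>_const[OF edge(3)] t_pos[OF edge(3,4)] by simp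
      moreover have "j (bar e) a \<in> carrier H"
        using \<open>j (bar e) a \<in> C (bar e)\<close> A.C_closed[OF e(2)] by blast
      ultimately have "f (Stable_Letter e) \<otimes>\<^bsub>A.E.W\<^esub> f (Vertex_Elem (head \<Gamma> e) (emb (bar e) a)) \<otimes>\<^bsub>A.E.W\<^esub>
          inv\<^bsub>A.E.W\<^esub> f (Stable_Letter e) = f (Vertex_Elem (tail \<Gamma> e) (emb e a))"
        unfolding f_simps j using e A.\<tau>_closed[OF e(1)] const_closed
        by (simp add: conj_mult conj_inv)
      then show ?thesis
        using edge e a f_edge[OF edge(3)] f_vertex by (simp add: A.E.W.m_assoc)
    next
      case tree
      then have e: "e \<in> arcs \<Gamma>" using TG by auto
      have "f (Stable_Letter e) = \<one>\<^bsub>A.E.W\<^esub>"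
        unfolding f_simps conj_def using \<gamma>(3)[OF tree(3)] TG \<gamma>_closed A.\<tau>_closed[OF e] e by simp
      then show ?thesis using tree by simp
    qed
  qed
  then obtain \<Theta> where \<Theta>: "\<Theta> \<in> hom H A.E.W" "\<And>x. x \<in> ?X \<Longrightarrow> \<Theta> (\<eta> x) = f x" by blast
  interpret \<Theta>: group_hom H A.E.W \<Theta>
    using \<Theta>(1) H.is_group A.E.W.is_group by (simp add: group_hom_def group_hom_axioms_def)
  have \<Theta>_B: "\<Theta> b = conj v (A.E.const b) v" if v: "v \<in> verts \<Gamma>" and b: "b \<in> B v" for v b
    using b \<Theta>(2) X_vertex v f_simps by (auto simp: B_def \<iota>_def)
  have \<Theta>_t: "\<Theta> (t e) = conj (tail \<Gamma> e) (A.\<tau> e) (head \<Gamma> e)" if e: "e \<in> arcs \<Gamma>" for e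
  proof (cases "e \<in> Epos")
    case True
    then show ?thesis using \<Theta>(2) X_edge f_simps by (simp add: t_def)
  next
    case False
    then have be: "bar e \<in> Epos" "bar e \<in> arcs \<Gamma>" using Epos(2)[OF e] e by auto
    have "\<Theta> (t e) = inv\<^bsub>A.E.W\<^esub> f (Stable_Letter (bar e))"
      using False \<Theta>(2) X_edge be s_closed by (simp add: t_def)
    also have "\<dots> = conj (tail \<Gamma> e) (inv\<^bsub>A.E.W\<^esub> A.\<tau> (bar e)) (head \<Gamma> e)"
      unfolding f_simps using be e A.\<tau>_closed by (simp add: conj_inv)
    also have "inv\<^bsub>A.E.W\<^esub> A.\<tau> (bar e) = A.\<tau> e"
      using A.\<tau>_bar[OF be(2)] by simp
    finally show ?thesis .
  qed
  have path: "\<Theta> (L.path_val p g) = conj u (A.wval p g) v" if "L.is_path u p g v" "u \<in> verts \<Gamma>" for u p g v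
    using that
  proof (induction u p g v rule: L.is_path.induct)
    case (1 u g v)
    then have "u = v" "g \<in> B u" by auto
    then show ?case using \<Theta>_B[OF 1(2)] by simp
  next
    case (2 u h e p g v)
    then have e: "e \<in> arcs \<Gamma>" "tail \<Gamma> e = u" "h \<in> B u" and p: "L.is_path (head \<Gamma> e) p g v"
      and IH: "\<Theta> (L.path_val p g) = conj (head \<Gamma> e) (A.wval p g) v" by auto
    have v: "v \<in> verts \<Gamma>" using p by (rule L.is_path_target)
    have G: "h \<in> carrier H" "t e \<in> carrier H" "L.path_val p g \<in> carrier H"
      using L.B_closed[OF 2(3) e(3)] t_closed[OF e(1)] L.path_val_closed[OF p] by auto
    have "\<Theta> (L.path_val ((h, e) # p) g) = conj u (A.E.const h) u \<otimes>\<^bsub>A.E.W\<^esub>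
        (conj u (A.\<tau> e) (head \<Gamma> e) \<otimes>\<^bsub>A.E.W\<^esub> conj (head \<Gamma> e) (A.wval p g) v)"
      using G \<Theta>_B[OF 2(3) e(3)] \<Theta>_t[OF e(1)] e(2) IH by simp
    also have "\<dots> = conj u (A.wval ((h, e) # p) g) v"
      using 2(3) e v A.\<tau>_closed[OF e(1)] A.wval_closed[OF p] const_closed[OF G(1)]
      by (simp add: conj_mult)
    finally show ?case .
  qed
  show ?thesis
  proof (rule A.virtually_special[OF \<Theta>(1)])
    \<comment> \<open>The potential is one at \<open>v0\<close>, so for loops there the twist
      disappears.\<close>
    fix p g assume p: "L.is_path v0 p g v0"
    then show "\<Theta> (L.path_val p g) = A.wval p g"
      using path[OF p v0] \<gamma>(1) A.wval_closed[OF p] by (simp add: conj_def)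
  qed
qed

end
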